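(* Let $a\in\{2,3,\dots\}$, $\rho=1/a$, and $\xi_{a\mathbb{Z}}=\sum_{k\in\mathbb{Z}}\delta_{ak}$. Then the noncolliding continuous-time simple symmetric random walk with infinitely many particles $(\Xi(t),\,t\in[0,\infty),\,\mathbb{P}_{\xi_{a\mathbb{Z}}})$ started at $\xi_{a\mathbb{Z}}$ shows a relaxation phenomenon to a stationary process $(\Xi(t),\,t\in[0,\infty),\,\mathbb{P}_\rho)$: as $\tau\to\infty$, the process $(\Xi(t+\tau))_{t\ge0}$ under $\mathbb{P}_{\xi_{a\mathbb{Z}}}$ converges, in the sense of finite-dimensional distributions, to $(\Xi(t))_{t\ge0}$ under $\mathbb{P}_\rho$. The stationary process $(\Xi(t),\,t\in[0,\infty),\,\mathbb{P}_\rho)$ is reversible with respect to $\mu^{\sin}_\rho$, the determinantal point process on $\mathbb{Z}$ with the sine kernel of density $\rho$, and is determinantal with correlation kernel $\mathbb{K}(s,x;t,y)=\mathbf{K}_\rho(t-s,y-x)$, $(s,x),(t,y)\in[0,\infty)\times\mathbb{Z}$, where $$\mathbf{K}_\rho(t-s,y-x)=\begin{cases}\displaystyle\int_0^\rho du\,\cos(u\pi(y-x))\,e^{-(t-s)\cos u\pi}, & s<t,\\[6pt] \displaystyle\frac{\sin(\rho\pi(y-x))}{\pi(y-x)}, & s=t,\\[6pt] \displaystyle-\int_\rho^1 du\,\cos(u\pi(y-x))\,e^{-(t-s)\cos u\pi}, & s>t.\end{cases}$$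
   Context: $\mu^{\sin}_\rho$ ($0<\rho<1$) denotes the determinantal point process on $\mathbb{Z}$ with correlation kernel $\mathbf{K}^{\sin}_\rho(y-x)=\frac{\sin(\rho\pi(y-x))}{\pi(y-x)}$, understood to be $\rho$ when $x=y$. Reversible with respect to $\mu$ means that the one-time marginals are $\mu$ and the finite-dimensional distributions are invariant under time reversal. $i=\sqrt{-1}$. Let $V_j(t)$, $t\ge0$, $j\in\mathbb{Z}$, be independent continuous-time simple symmetric random walks on $\mathbb{Z}$ (generator $(L_1f)(x)=\frac12[f(x+1)+f(x-1)-2f(x)]$) with $V_j(0)=aj$ under the law $\mathrm{P}_{a\mathbb{Z}}$ (expectation $\mathrm{E}_{a\mathbb{Z}}$). For $k\in\mathbb{Z}$, $(t,y)\in[0,\infty)\times\mathbb{Z}$ put $$\hat{\mathcal{M}}^k_{a\mathbb{Z}}(t,y)=\frac1{2\pi}\int_{-\pi}^{\pi}d\lambda\,e^{i\lambda(y/a-k)}\exp\{t(1-\cos(\lambda/a))\}.$$ Each $\hat{\mathcal{M}}^k_{a\mathbb{Z}}(t,V_j(t))$ is a martingale with expectation $\delta_{jk}$. For a finite set $\mathbb{J}\subset\mathbb{Z}$ put $\hat{\mathcal{D}}_{a\mathbb{Z}}(t,\mathbf{V}_{\mathbb{J}}(t))=\det_{j,k\in\mathbb{J}}[\hat{\mathcal{M}}^k_{a\mathbb{Z}}(t,V_j(t))]$. Definition of the infinite noncolliding random walk: $(\Xi(t),t\in[0,\infty),\mathbb{P}_{\xi_{a\mathbb{Z}}})$ is the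 process of nonnegative integer-valued Radon measures on $\mathbb{Z}$ whose expectations are given by the determinantal martingale representation: for $0\le t\le T<\infty$ and a bounded $\sigma(\Xi(s):0\le s\le t)$-measurable functional $F$ involving only the paths with indices in a finite set $\mathbb{J}$, the expectation is $\mathrm{E}_{a\mathbb{Z}}\big[F(\sum_{j\in\mathbb{J}}\delta_{V_j(\cdot)})\,\hat{\mathcal{D}}_{a\mathbb{Z}}(T,\mathbf{V}_{\mathbb{J}}(T))\big]$ (adding further indices to $\mathbb{J}$ does not change the value). For bounded functionals $F$ of the configuration process depending only on the occupation numbers of finitely many sites at finitely many times in $[0,t]$, this is read as $$\mathbb{E}_{\xi_{a\mathbb{Z}}}[F(\Xi(\cdot))]=\lim_{L\to\infty}\mathrm{E}_{a\mathbb{Z}}\Big[F\Big(\sum_{|j|\le L}\delta_{V_j(\cdot)}\Big)\det_{|j|,|k|\le L}\big[\hat{\mathcal{M}}^k_{a\mathbb{Z}}(T,V_j(T))\big]\Big].$$ Determinantal: for $M\in\mathbb{N}$, times $0\le t_1<\cdots<t_M<\infty$ and finitely supported functions $f_{t_1},\dots,f_{t_M}:\mathbb{Z}\to\mathbb{R}$, set $\chi_{t_m}=e^{f_{t_m}}-1$ and $\mathbb{W}_n=\{\mathbf{x}\in\mathbb{R}^n:x_1<\cdots<x_n\}$. A configuration-valued process $\Xi$ with expectation $\mathbb{E}$ is called determinantal with correlation kernel $\mathbb{K}$ if for all such data $\mathbb{E}\big[\exp\{\sum_{m=1}^M\sum_{x\in\mathbb{Z}}f_{t_m}(x)\,\Xi(t_m,\{x\})\}\big]$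 equals the Fredholm determinant $$\sum_{\substack{N_m\ge0\\1\le m\le M}}\ \sum_{\substack{\mathbf{x}^{(m)}\in\mathbb{Z}^{N_m}\cap\mathbb{W}_{N_m}\\1\le m\le M}}\ \prod_{m=1}^M\prod_{j=1}^{N_m}\chi_{t_m}(x^{(m)}_j)\ \det_{\substack{1\le j\le N_m,\,1\le k\le N_n\\1\le m,n\le M}}\big[\mathbb{K}(t_m,x^{(m)}_j;t_n,x^{(n)}_k)\big].$$ In this case all spatio-temporal correlation functions are the determinants $\det[\mathbb{K}(t_m,x^{(m)}_j;t_n,x^{(n)}_k)]$. *)

theory Defs
  imports "HOL-Probability.Probability"
begin

text \<open>A nonnegative integer-valued Radon measure \<open>\<xi>\<close> on the integers is identified with its
  occupation numbers \<open>x \<mapsto> \<xi>({x})\<close>. Under this identification the vague topology is the product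
  topology on the type \<open>int \<Rightarrow> nat\<close>, with Borel sets the product sigma-algebra below.\<close>

type_synonym config = "int \<Rightarrow> nat"

definition config_space :: "config measure" where
  "config_space = (\<Pi>\<^sub>M x\<in>UNIV. count_space UNIV)"

definition config_process :: "'w measure \<Rightarrow> (real \<Rightarrow> 'w \<Rightarrow> config) \<Rightarrow> bool" where
  "config_process M \<Xi> \<longleftrightarrow> prob_space M \<and> (\<forall>t\<ge>0. \<Xi> t \<in> measurable M config_space)"

definition joint_law ::
  "'w measure \<Rightarrow> (real \<Rightarrow> 'w \<Rightarrow> config) \<Rightarrow> (real \<Rightarrow> real) \<Rightarrow> real set \<Rightarrow> (real \<Rightarrow> config) measure" where
  "joint_law M \<Xi> g J = distr M (\<Pi>\<^sub>M s\<in>J. config_space) (\<lambda>\<omega>. \<lambda>s\<in>J. \<Xi> (g s) \<omega>)"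

definition stationary :: "'w measure \<Rightarrow> (real \<Rightarrow> 'w \<Rightarrow> config) \<Rightarrow> bool" where
  "stationary M \<Xi> \<longleftrightarrow>
     (\<forall>J h. finite J \<and> J \<subseteq> {0..} \<and> 0 \<le> h \<longrightarrow>
        joint_law M \<Xi> (\<lambda>s. s + h) J = joint_law M \<Xi> (\<lambda>s. s) J)"

definition reversible_wrt :: "'w measure \<Rightarrow> (real \<Rightarrow> 'w \<Rightarrow> config) \<Rightarrow> config measure \<Rightarrow> bool" where
  "reversible_wrt M \<Xi> \<mu> \<longleftrightarrow>
     (\<forall>t\<ge>0. distr M config_space (\<Xi> t) = \<mu>) \<and>
     (\<forall>J T. finite J \<and> J \<subseteq> {0..T} \<longrightarrow>
        joint_law M \<Xi> (\<lambda>s. T - s) J = joint_law M \<Xi> (\<lambda>s. s) J)"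

text \<open>Weak convergence of the laws of \<open>(\<Xi>(s + \<tau>))\<close>, \<open>s \<in> J\<close>, to that of \<open>(\<Upsilon>(s))\<close>, \<open>s \<in> J\<close>, as
  \<open>\<tau> \<rightarrow> \<infinity>\<close>, for every finite set \<open>J\<close> of times. Continuity of \<open>G\<close> refers to the product topology;
  since \<open>G\<close> is only evaluated at functions restricted to \<open>J\<close>, these are exactly the bounded
  continuous test functions on the finite power of the configuration space indexed by \<open>J\<close>.\<close>

definition shifted_fdd_convergence ::
  "'w measure \<Rightarrow> (real \<Rightarrow> 'w \<Rightarrow> config) \<Rightarrow> 'v measure \<Rightarrow> (real \<Rightarrow> 'v \<Rightarrow> config) \<Rightarrow> bool" where
  "shifted_fdd_convergence M \<Xi> N \<Upsilon> \<longleftrightarrow>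
     (\<forall>J. finite J \<and> J \<subseteq> {0..} \<longrightarrow>
       (\<forall>G :: (real \<Rightarrow> config) \<Rightarrow> real. continuous_on UNIV G \<and> bounded (range G) \<longrightarrow>
         ((\<lambda>\<tau>. \<integral>\<omega>. G (\<lambda>s\<in>J. \<Xi> (s + \<tau>) \<omega>) \<partial>M) \<longlongrightarrow> (\<integral>\<omega>. G (\<lambda>s\<in>J. \<Upsilon> s \<omega>) \<partial>N)) at_top))"

text \<open>The library's determinant is indexed by a type; here the index is a finite set.\<close>

definition det_on :: "'i set \<Rightarrow> ('i \<Rightarrow> 'i \<Rightarrow> 'a::comm_ring_1) \<Rightarrow> 'a" where
  "det_on S A = (\<Sum>p | p permutes S. of_int (sign p) * (\<Prod>i\<in>S. A i (p i)))"

lemma det_on_UNIV: "det_on UNIV (\<lambda>i j. A $ i $ j) = det A"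
  by (simp add: det_on_def det_def)

text \<open>In the Fredholm expansion below, \<open>x m\<close> is a strictly increasing list of sites and its
  length is \<open>N\<^sub>m\<close>, so the single sum over \<open>x\<close> runs over all particle numbers and all
  ordered positions together. It is only used with finitely supported \<open>w m\<close>, for which all
  but finitely many terms vanish.\<close>

definition fredholm_det ::
  "nat \<Rightarrow> (nat \<Rightarrow> int \<Rightarrow> real) \<Rightarrow> (nat \<Rightarrow> int \<Rightarrow> nat \<Rightarrow> int \<Rightarrow> real) \<Rightarrow> real" where
  "fredholm_det M w K =
     (\<Sum>\<^sub>\<infinity> x\<in>(\<Pi>\<^sub>E m\<in>{1..M}. {xs :: int list. sorted_wrt (<) xs}).
        (\<Prod>m\<in>{1..M}. \<Prod>j<length (x m). w m (x m ! j)) *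
        det_on (SIGMA m:{1..M}. {..<length (x m)})
          (\<lambda>(m, j) (n, k). K m (x m ! j) n (x n ! k)))"

definition determinantal_process ::
  "'w measure \<Rightarrow> (real \<Rightarrow> 'w \<Rightarrow> config) \<Rightarrow> (real \<Rightarrow> int \<Rightarrow> real \<Rightarrow> int \<Rightarrow> real) \<Rightarrow> bool" where
  "determinantal_process P \<Xi> K \<longleftrightarrow>
     (\<forall>M (t :: nat \<Rightarrow> real) (f :: nat \<Rightarrow> int \<Rightarrow> real).
        (\<forall>m\<in>{1..M}. 0 \<le> t m) \<and> strict_mono_on {1..M} t \<and>
        (\<forall>m\<in>{1..M}. finite {x. f m x \<noteq> 0}) \<longrightarrow>
        has_bochner_integral P
          (\<lambda>\<omega>. exp (\<Sum>m\<in>{1..M}. \<Sum>x | f m x \<noteq> 0. f m x * real (\<Xi> (t m) \<omega> x)))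
          (fredholm_det M (\<lambda>m x. exp (f m x) - 1) (\<lambda>m x n y. K (t m) x (t n) y)))"

definition determinantal_point_process :: "config measure \<Rightarrow> (int \<Rightarrow> int \<Rightarrow> real) \<Rightarrow> bool" where
  "determinantal_point_process \<mu> K \<longleftrightarrow>
     prob_space \<mu> \<and> sets \<mu> = sets config_space \<and>
     (\<forall>f :: int \<Rightarrow> real. finite {x. f x \<noteq> 0} \<longrightarrow>
        has_bochner_integral \<mu> (\<lambda>\<xi>. exp (\<Sum>x | f x \<noteq> 0. f x * real (\<xi> x)))
          (fredholm_det 1 (\<lambda>_ x. exp (f x) - 1) (\<lambda>_ x _ y. K x y)))"

definition srw_generator :: "(int \<Rightarrow> real) \<Rightarrow> int \<Rightarrow> real" where
  "srw_generator f x = (f (x + 1) + f (x - 1) - 2 * f x) / 2"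

text \<open>The generator is bounded, so its semigroup is the exponential series; the transition
  probability from \<open>x\<close> to \<open>y\<close> in time \<open>t\<close> is this semigroup applied to the indicator of \<open>y\<close>.\<close>

definition srw_transition :: "real \<Rightarrow> int \<Rightarrow> int \<Rightarrow> real" where
  "srw_transition t x y = (\<Sum>n. t ^ n / fact n * (srw_generator ^^ n) (indicator {y}) x)"

text \<open>The walk is specified by its finite-dimensional distributions; no path regularity is used.\<close>

definition srw_from :: "'v measure \<Rightarrow> (real \<Rightarrow> 'v \<Rightarrow> int) \<Rightarrow> int \<Rightarrow> bool" where
  "srw_from W X x0 \<longleftrightarrow>
     (\<forall>t\<ge>0. X t \<in> measurable W (count_space UNIV)) \<and>
     (\<forall>n (t :: nat \<Rightarrow> real) x. t 0 = 0 \<and> mono_on {..n} t \<and> x 0 = x0 \<longrightarrow>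
        measure W {\<omega> \<in> space W. \<forall>i\<le>n. X (t i) \<omega> = x i} =
        (\<Prod>i<n. srw_transition (t (Suc i) - t i) (x i) (x (Suc i))))"

definition independent_walks ::
  "nat \<Rightarrow> 'v measure \<Rightarrow> (int \<Rightarrow> real \<Rightarrow> 'v \<Rightarrow> int) \<Rightarrow> bool" where
  "independent_walks a W V \<longleftrightarrow>
     prob_space W \<and>
     (\<forall>j. srw_from W (V j) (int a * j)) \<and>
     prob_space.indep_vars W (\<lambda>_. \<Pi>\<^sub>M t\<in>{0..}. count_space UNIV)
       (\<lambda>j \<omega>. \<lambda>t\<in>{0..}. V j t \<omega>) UNIV"

text \<open>The values are real, since the imaginary part of the integrand is odd.\<close>

definition M_hat :: "nat \<Rightarrow> int \<Rightarrow> real \<Rightarrow> int \<Rightarrow> complex" where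
  "M_hat a k t y = 1 / (2 * of_real pi) *
     integral {-pi..pi} (\<lambda>l :: real.
       exp (\<i> * of_real (l * (of_int y / of_nat a - of_int k))) *
       of_real (exp (t * (1 - cos (l / of_nat a)))))"

definition D_hat ::
  "nat \<Rightarrow> int set \<Rightarrow> real \<Rightarrow> (int \<Rightarrow> int) \<Rightarrow> complex" where
  "D_hat a J t v = det_on J (\<lambda>j k. M_hat a k t (v j))"

definition empirical_config :: "int set \<Rightarrow> (int \<Rightarrow> int) \<Rightarrow> config" where
  "empirical_config J v x = card {j \<in> J. v j = x}"

definition local_functional ::
  "real set \<Rightarrow> int set \<Rightarrow> ((real \<Rightarrow> config) \<Rightarrow> real) \<Rightarrow> bool" where
  "local_functional S A F \<longleftrightarrow>
     bounded (range F) \<and>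
     (\<forall>\<xi> \<eta>. (\<forall>s\<in>S. \<forall>x\<in>A. \<xi> s x = \<eta> s x) \<longrightarrow> F \<xi> = F \<eta>)"

text \<open>The process is characterised by its determinantal martingale representation: expectations
  of bounded functionals of finitely many occupation numbers up to time \<open>T\<close> are limits, as the
  window of labels grows, of expectations over the independent walks \<open>V\<close> weighted by
  \<open>D_hat\<close> at time \<open>T\<close>.\<close>

definition noncolliding_walk ::
  "nat \<Rightarrow> 'v measure \<Rightarrow> (int \<Rightarrow> real \<Rightarrow> 'v \<Rightarrow> int) \<Rightarrow> 'w measure \<Rightarrow> (real \<Rightarrow> 'w \<Rightarrow> config) \<Rightarrow> bool" where
  "noncolliding_walk a W V M \<Xi> \<longleftrightarrow>
     config_process M \<Xi> \<and>
     (\<forall>T S A F. 0 \<le> T \<and> finite S \<and> S \<subseteq> {0..T} \<and> finite A \<and> local_functional S A F \<longrightarrow>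
        (\<lambda>L :: nat. \<integral>\<omega>.
            of_real (F (\<lambda>s. empirical_config {-int L..int L} (\<lambda>j. V j s \<omega>))) *
            D_hat a {-int L..int L} T (\<lambda>j. V j T \<omega>) \<partial>W)
        \<longlonglongrightarrow> of_real (\<integral>\<omega>. F (\<lambda>s. \<Xi> s \<omega>) \<partial>M))"

definition sine_kernel :: "real \<Rightarrow> int \<Rightarrow> real" where
  "sine_kernel \<rho> z = (if z = 0 then \<rho> else sin (\<rho> * pi * of_int z) / (pi * of_int z))"

definition extended_sine_kernel :: "real \<Rightarrow> real \<Rightarrow> int \<Rightarrow> real" where
  "extended_sine_kernel \<rho> r z =
     (if 0 < r then integral {0..\<rho>} (\<lambda>u. cos (u * pi * of_int z) * exp (- r * cos (u * pi)))
      else if r = 0 then sine_kernel \<rho> z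
      else - integral {\<rho>..1} (\<lambda>u. cos (u * pi * of_int z) * exp (- r * cos (u * pi))))"

end

theory Submission
  imports Defs "Jordan_Normal_Form.Determinant"
begin

text \<open>
  Weighting independent walks by the determinant of the martingales \<open>M_hat\<close> makes every
  generating function of occupation numbers a determinant. For a finite set \<open>B\<close> of
  space-time points and weights \<open>z\<close>, the functional \<open>\<Prod>b\<in>B. z b ^ \<Xi>(b)\<close> factorises over the
  walks, so by independence its weighted expectation is the determinant, over labels \<open>j, k\<close>,
  of one-particle expectations. The martingale property evaluates these as
  \<open>\<delta>\<^sub>j\<^sub>k + \<Sum>b A j b * (z b - 1) * M_hat k b\<close>, where \<open>A\<close> solves a linear
  system that is triangular in time. Sylvester's identity \<open>det (1 + XY) = det (1 + YX)\<close> moves the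
  determinant from labels to \<open>B\<close>, where the window of labels can be enlarged, and triangularity
  removes the interaction between times. The result is \<open>det (1 + (z - 1) K)\<close> with
  \<open>K b c = \<Sum>j M_hat j b * p(a j, c) - p(b, c)\<close>, the last term being present only if
  \<open>b\<close> precedes \<open>c\<close> (\<open>noncolliding_generating_function\<close>).

  Being affine in each \<open>z b\<close>, this determinant forces at most one particle per site
  (\<open>noncolliding_occupation_le_1\<close>), and Moebius inversion turns it into: the probability that
  all points of \<open>D\<close> are occupied is the minor \<open>det K\<close> on \<open>D\<close> (\<open>noncolliding_correlation\<close>).
  The law of the process is thereby reduced to probabilities of occupied sets.

  Poisson summation over the lattice \<open>a\<int>\<close> writes the sum over all labels \<open>j\<close> as a sum over the
  \<open>a\<close> frequencies \<open>(l + 2 * pi * r) / a\<close> that agree on it. When both times are shifted by \<open>\<tau>\<close>, the term \<open>r\<close>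
  acquires the factor \<open>exp (- \<tau> * (cos (l / a) - cos ((l + 2 * pi * r) / a)))\<close>, so all terms but
  \<open>r = 0\<close> disappear (\<open>lattice_kernel_limit\<close>). Together with the term \<open>- p(b, c)\<close>, what remains is the transpose of the extended sine
  kernel up to a factor \<open>exp (t - s)\<close>, and neither transposition nor such a factor
  changes a minor (\<open>noncolliding_correlation_limit\<close>).

  The limiting minors determine the probability of every pattern of occupied and empty points
  in a finite window. These probabilities are consistent because they are limits of consistent
  ones, and Kolmogorov's theorem yields the stationary process (\<open>limit_law_exists\<close>).
  Convergence of finite-dimensional distributions follows from that of patterns, since
  \<open>{0, 1}\<close>-valued configurations form a compact space, on which continuous functionals are
  uniformly approximated by functionals of finite windows (\<open>shifted_fdd_convergenceI\<close>).
  Stationarity and reversibility are invariance of the minors of the extended sine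
  kernel under time shifts and, up to transposition, under time reflection. The Fredholm
  expansion of the generating functional is the expansion of \<open>\<Prod>b. 1 + (exp (f b) - 1) * \<Xi>(b)\<close>
  over subsets.
\<close>

section \<open>Determinants over finite index sets\<close>

lemma det_on_cong:
  assumes "\<And>i j. i \<in> S \<Longrightarrow> j \<in> S \<Longrightarrow> A i j = B i j"
  shows "det_on S A = det_on S B"
  unfolding det_on_def
  by (intro sum.cong refl arg_cong2[where f="(*)"] prod.cong assms) (auto simp: permutes_in_image)

lemma det_on_reindex:
  assumes f: "bij_betw f S S'" and fin: "finite S"
  shows "det_on S' A = det_on S (\<lambda>i j. A (f i) (f j))"
proof -
  have inj: "inj_on f S" and im: "f ` S = S'"
    using f by (auto simp: bij_betw_def)
  define g where "g = (\<lambda>p x. if x \<in> S' then f (p (inv_into S f x)) else x)"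
  have g: "bij_betw g {p. p permutes S} {p. p permutes S'}"
    unfolding g_def by (rule bij_betw_permutations[OF f])
  have eq: "g p = map_permutation S f p" if "p permutes S" for p
    using im by (auto simp: g_def map_permutation_def restrict_id_def fun_eq_iff)
  have "det_on S' A = (\<Sum>p | p permutes S. of_int (sign (g p)) * (\<Prod>i\<in>S'. A i (g p i)))"
    unfolding det_on_def by (rule sum.reindex_bij_betw[OF g, symmetric])
  also have "\<dots> = det_on S (\<lambda>i j. A (f i) (f j))"
    unfolding det_on_def
  proof (intro sum.cong refl arg_cong2[where f="(*)"])
    fix p assume "p \<in> {p. p permutes S}"
    then have p: "p permutes S" by simp
    show "of_int (sign (g p)) = of_int (sign p)"
      using sign_map_permutation[OF inj p fin] by (simp add: eq[OF p])
    have "(\<Prod>i\<in>S'. A i (g p i)) = (\<Prod>i\<in>S. A (f i) (g p (f i)))"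
      by (rule prod.reindex_bij_betw[OF f, symmetric])
    also have "\<dots> = (\<Prod>i\<in>S. A (f i) (f (p i)))"
      using im inj by (intro prod.cong refl) (auto simp: g_def)
    finally show "(\<Prod>i\<in>S'. A i (g p i)) = (\<Prod>i\<in>S. A (f i) (f (p i)))" .
  qed
  finally show ?thesis .
qed

lemma det_on_transpose:
  assumes "finite S"
  shows "det_on S (\<lambda>i j. A j i) = det_on S A"
proof -
  have "det_on S A = (\<Sum>p | p permutes S. of_int (sign (Hilbert_Choice.inv p)) * (\<Prod>i\<in>S. A i (Hilbert_Choice.inv p i)))"
    unfolding det_on_def
    by (rule sum_permutations_inverse)
  also have "\<dots> = det_on S (\<lambda>i j. A j i)"
    unfolding det_on_def
  proof (intro sum.cong refl arg_cong2[where f="(*)"])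
    fix p assume "p \<in> {p. p permutes S}"
    then have p: "p permutes S" by simp
    show "of_int (sign (Hilbert_Choice.inv p)) = of_int (sign p)"
      using sign_inverse[of p] p assms by (simp add: permutation_permutes exI)
    have "(\<Prod>i\<in>S. A i (Hilbert_Choice.inv p i)) = (\<Prod>i\<in>S. A (p i) (Hilbert_Choice.inv p (p i)))"
      by (rule prod.reindex_bij_betw[OF permutes_imp_bij[OF p], symmetric])
    then show "(\<Prod>i\<in>S. A i (Hilbert_Choice.inv p i)) = (\<Prod>i\<in>S. A (p i) i)"
      by (simp add: permutes_inverses[OF p])
  qed
  finally show ?thesis by simp
qed

lemma det_on_scale_rows:
  assumes "finite S"
  shows "det_on S (\<lambda>i j. c i * A i j) = (\<Prod>i\<in>S. c i) * det_on S A"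
  by (simp add: det_on_def prod.distrib sum_distrib_left algebra_simps)

lemma det_on_scale_columns:
  assumes "finite S"
  shows "det_on S (\<lambda>i j. A i j * c j) = det_on S A * (\<Prod>i\<in>S. c i)"
proof -
  have "(\<Prod>i\<in>S. c (p i)) = (\<Prod>i\<in>S. c i)" if "p permutes S" for p
    by (rule prod.reindex_bij_betw[OF permutes_imp_bij[OF that]])
  then show ?thesis
    by (auto simp: det_on_def prod.distrib sum_distrib_right mult.assoc intro!: sum.cong)
qed

text \<open>Conjugation by a diagonal matrix. It absorbs the factor \<open>exp (t - s)\<close> by which the limit
  kernel differs from the extended sine kernel.\<close>
lemma det_on_gauge:
  fixes A :: "'i \<Rightarrow> 'i \<Rightarrow> 'a::field"
  assumes "finite S" and "\<And>i. i \<in> S \<Longrightarrow> c i \<noteq> 0"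
  shows "det_on S (\<lambda>i j. c i * A i j / c j) = det_on S A"
proof -
  have "det_on S (\<lambda>i j. c i * A i j / c j) = det_on S (\<lambda>i j. (c i * A i j) * inverse (c j))"
    by (simp add: divide_inverse)
  also have "\<dots> = det_on S A * ((\<Prod>i\<in>S. c i) * (\<Prod>i\<in>S. inverse (c i)))"
    using assms(1) by (simp add: det_on_scale_columns det_on_scale_rows)
  also have "\<dots> = det_on S A"
    using assms by (simp flip: prod.distrib)
  finally show ?thesis .
qed

lemma det_on_of_real: "det_on S (\<lambda>i j. of_real (A i j)) = (of_real (det_on S A) :: complex)"
  by (simp add: det_on_def)

lemma det_on_tendsto:
  fixes A :: "'n \<Rightarrow> 'i \<Rightarrow> 'i \<Rightarrow> complex"
  assumes "\<And>i j. i \<in> S \<Longrightarrow> j \<in> S \<Longrightarrow> ((\<lambda>n. A n i j) \<longlongrightarrow> B i j) F"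
  shows "((\<lambda>n. det_on S (A n)) \<longlongrightarrow> det_on S B) F"
  unfolding det_on_def
  by (intro tendsto_intros tendsto_sum tendsto_prod assms) (auto simp: permutes_in_image)

text \<open>Each diagonal position either uses the \<open>1\<close> or the entry of \<open>K\<close>. A permutation of \<open>S\<close>
  contributes to the choice \<open>D\<close> of the latter positions exactly if it fixes all of \<open>S - D\<close>, that
  is, if it is a permutation of \<open>D\<close>.\<close>
lemma det_on_one_plus:
  fixes K :: "'i \<Rightarrow> 'i \<Rightarrow> 'a::comm_ring_1"
  assumes fin: "finite S"
  shows "det_on S (\<lambda>i j. of_bool (i = j) + K i j) = (\<Sum>D\<in>Pow S. det_on D K)"
proof -
  let ?d = "\<lambda>i j. of_bool (i = j)"
  have fixes_prod: "(\<Prod>i\<in>S - D. ?d i (p i)) = (of_bool (p permutes D) :: 'a)"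
    if p: "p permutes S" and D: "D \<subseteq> S" for p D
  proof (cases "\<forall>i\<in>S - D. p i = i")
    case True
    then have "p permutes D" using permutes_superset[OF p] by blast
    with True show ?thesis by (auto intro!: prod.neutral)
  next
    case False
    then obtain i where i: "i \<in> S - D" "p i \<noteq> i" by blast
    then have "\<not> p permutes D" by (auto simp: permutes_def)
    moreover have "\<exists>i\<in>S - D. ?d i (p i) = (0::'a)"
      using i by (intro bexI[of _ i]) auto
    ultimately show ?thesis using fin by (auto intro!: prod_zero)
  qed
  have "det_on S (\<lambda>i j. ?d i j + K i j) =
      (\<Sum>p | p permutes S. of_int (sign p) *
        (\<Sum>D\<in>Pow S. (\<Prod>i\<in>D. K i (p i)) * (\<Prod>i\<in>S - D. ?d i (p i))))"
    unfolding det_on_def by (subst add.commute, subst prod_add[OF fin]) simp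
  also have "\<dots> = (\<Sum>D\<in>Pow S. \<Sum>p | p permutes S.
      of_int (sign p) * ((\<Prod>i\<in>D. K i (p i)) * (\<Prod>i\<in>S - D. ?d i (p i))))"
    unfolding sum_distrib_left by (rule sum.swap)
  also have "\<dots> = (\<Sum>D\<in>Pow S. det_on D K)"
  proof (rule sum.cong[OF refl])
    fix D assume "D \<in> Pow S"
    then have D: "D \<subseteq> S" by simp
    have "(\<Sum>p | p permutes S. of_int (sign p) * ((\<Prod>i\<in>D. K i (p i)) * (\<Prod>i\<in>S - D. ?d i (p i))))
      = (\<Sum>p | p permutes S. if p permutes D then of_int (sign p) * (\<Prod>i\<in>D. K i (p i)) else 0)"
      by (intro sum.cong refl) (simp add: fixes_prod[OF _ D])
    also have "\<dots> = det_on D K"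
      unfolding det_on_def using finite_permutations[OF fin] D
      by (subst sum.inter_filter[symmetric]) (auto intro!: sum.cong dest: permutes_subset)
    finally show "(\<Sum>p | p permutes S. of_int (sign p) *
      ((\<Prod>i\<in>D. K i (p i)) * (\<Prod>i\<in>S - D. ?d i (p i)))) = det_on D K" .
  qed
  finally show ?thesis .
qed

text \<open>A permutation other than the identity cannot increase the rank \<open>r\<close> at every point it
  moves, since the sum of the ranks is preserved; so it meets a zero entry. The rank
  will be the time coordinate.\<close>
lemma det_on_unitriangular:
  fixes r :: "'i \<Rightarrow> real"
  assumes fin: "finite S" and N: "\<And>i j. i \<in> S \<Longrightarrow> j \<in> S \<Longrightarrow> \<not> r i < r j \<Longrightarrow> N i j = 0"
  shows "det_on S (\<lambda>i j. of_bool (i = j) + N i j) = 1"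
proof -
  have zero: "(\<Prod>i\<in>S. of_bool (i = p i) + N i (p i)) = 0" if p: "p permutes S" "p \<noteq> id" for p
  proof (rule ccontr)
    assume "(\<Prod>i\<in>S. of_bool (i = p i) + N i (p i)) \<noteq> 0"
    then have nz: "of_bool (i = p i) + N i (p i) \<noteq> 0" if "i \<in> S" for i
      using fin that prod_zero by fastforce
    have img: "p i \<in> S" if "i \<in> S" for i using p that by (simp add: permutes_in_image)
    have le: "r i \<le> r (p i)" and lt: "p i \<noteq> i \<Longrightarrow> r i < r (p i)" if "i \<in> S" for i
      using nz[OF that] N[OF that img[OF that]] by (cases "p i = i"; force)+
    obtain i where "p i \<noteq> i" using p by (auto simp: fun_eq_iff)
    moreover from this have "i \<in> S" using p by (auto simp: permutes_def)
    ultimately have "(\<Sum>i\<in>S. r i) < (\<Sum>i\<in>S. r (p i))"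
      using fin le lt by (intro sum_strict_mono_ex1) auto
    also have "\<dots> = (\<Sum>i\<in>S. r i)" by (rule sum.reindex_bij_betw[OF permutes_imp_bij[OF p(1)]])
    finally show False by simp
  qed
  have "det_on S (\<lambda>i j. of_bool (i = j) + N i j) =
      (\<Sum>p\<in>{id}. of_int (sign p) * (\<Prod>i\<in>S. of_bool (i = p i) + N i (p i)))"
    unfolding det_on_def using fin zero
    by (intro sum.mono_neutral_right) (auto simp: finite_permutations permutes_id)
  also have "\<dots> = 1"
    using N by (auto intro!: prod.neutral)
  finally show ?thesis .
qed

text \<open>Determinants over index sets are transferred to matrices with natural number indices, for
  which multiplicativity and block determinants are known.\<close>
lemma det_on_eq_det_mat:
  assumes f: "bij_betw f {0..<n} S"
  shows "det_on S A = Determinant.det (mat n n (\<lambda>(i, j). A (f i) (f j)))"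
proof -
  have "det_on S A = det_on {0..<n} (\<lambda>i j. A (f i) (f j))"
    by (rule det_on_reindex[OF f]) simp
  also have "\<dots> = Determinant.det (mat n n (\<lambda>(i, j). A (f i) (f j)))"
    unfolding det_on_def Determinant.det_def
    by (auto intro!: sum.cong prod.cong simp: permutes_in_image)
  finally show ?thesis .
qed

lemma det_on_mult:
  assumes fin: "finite S"
  shows "det_on S (\<lambda>i k. \<Sum>j\<in>S. A i j * B j k) = det_on S A * det_on S B"
proof -
  obtain f where f: "bij_betw f {0..<card S} S"
    using ex_bij_betw_nat_finite[OF fin] by blast
  let ?m = "\<lambda>A. mat (card S) (card S) (\<lambda>(i, j). A (f i) (f j))"
  have "?m (\<lambda>i k. \<Sum>j\<in>S. A i j * B j k) = ?m A * ?m B"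
    by (rule eq_matI)
      (auto simp: scalar_prod_def sum.reindex_bij_betw[OF f, symmetric])
  then show ?thesis
    by (simp add: det_on_eq_det_mat[OF f] Determinant.det_mult[of _ "card S"])
qed

text \<open>Sylvester's identity. The block matrix with rows \<open>(1, - X)\<close> and \<open>(Y, 1)\<close> becomes triangular
  when multiplied by the block matrix with rows \<open>(1, X)\<close> and \<open>(0, 1)\<close> from either side; the two
  products have diagonal blocks \<open>1 + XY, 1\<close> and \<open>1, 1 + YX\<close>.\<close>
lemma det_one_plus_mult_commute_mat:
  fixes X Y :: "'a::idom mat"
  assumes X: "X \<in> carrier_mat n m" and Y: "Y \<in> carrier_mat m n"
  shows "Determinant.det (1\<^sub>m n + X * Y) = Determinant.det (1\<^sub>m m + Y * X)"
proof -
  note c = X Y mult_carrier_mat[OF X Y] mult_carrier_mat[OF Y X]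
  let ?A = "four_block_mat (1\<^sub>m n) (- X) Y (1\<^sub>m m)"
  let ?U = "four_block_mat (1\<^sub>m n) X (0\<^sub>m m n) (1\<^sub>m m)"
  have cA: "?A \<in> carrier_mat (n + m) (n + m)" and cU: "?U \<in> carrier_mat (n + m) (n + m)"
    using c by auto
  have U: "Determinant.det ?U = 1"
    using c by (subst det_four_block_mat_lower_left_zero[of _ n _ m]) auto
  have "?U * ?A = four_block_mat (1\<^sub>m n + X * Y) (0\<^sub>m n m) Y (1\<^sub>m m)"
    using c by (subst mult_four_block_mat[of _ n n _ m _ m]) (auto intro!: arg_cong2[where f="\<lambda>a b. four_block_mat a b Y (1\<^sub>m m)"])
  then have 1: "Determinant.det ?U * Determinant.det ?A = Determinant.det (1\<^sub>m n + X * Y)"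
    using c by (simp flip: Determinant.det_mult[OF cU cA])
      (subst det_four_block_mat_upper_right_zero[of _ n _ m], auto)
  have "?A * ?U = four_block_mat (1\<^sub>m n) (0\<^sub>m n m) Y (1\<^sub>m m + Y * X)"
    using c by (subst mult_four_block_mat[of _ n n _ m _ m])
      (auto intro!: arg_cong2[where f="\<lambda>a b. four_block_mat (1\<^sub>m n) a Y b"] comm_add_mat)
  then have 2: "Determinant.det ?A * Determinant.det ?U = Determinant.det (1\<^sub>m m + Y * X)"
    using c by (simp flip: Determinant.det_mult[OF cA cU])
      (subst det_four_block_mat_upper_right_zero[of _ n _ m], auto)
  show ?thesis using 1 2 U by simp
qed

lemma det_on_one_plus_mult_commute:
  fixes X :: "'i \<Rightarrow> 'k \<Rightarrow> 'a::idom"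
  assumes fin: "finite S" "finite R"
  shows "det_on S (\<lambda>i j. of_bool (i = j) + (\<Sum>b\<in>R. X i b * Y b j)) =
    det_on R (\<lambda>b c. of_bool (b = c) + (\<Sum>j\<in>S. Y b j * X j c))"
proof -
  obtain f where f: "bij_betw f {0..<card S} S"
    using ex_bij_betw_nat_finite[OF fin(1)] by blast
  obtain g where g: "bij_betw g {0..<card R} R"
    using ex_bij_betw_nat_finite[OF fin(2)] by blast
  let ?X = "mat (card S) (card R) (\<lambda>(i, b). X (f i) (g b))"
  let ?Y = "mat (card R) (card S) (\<lambda>(b, i). Y (g b) (f i))"
  have injf: "f i = f j \<longleftrightarrow> i = j" if "i < card S" "j < card S" for i j
    using f that by (auto simp: bij_betw_def inj_on_def)
  have injg: "g i = g j \<longleftrightarrow> i = j" if "i < card R" "j < card R" for i j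
    using g that by (auto simp: bij_betw_def inj_on_def)
  have 1: "mat (card S) (card S) (\<lambda>(i, j). of_bool (f i = f j) + (\<Sum>b\<in>R. X (f i) b * Y b (f j)))
     = 1\<^sub>m (card S) + ?X * ?Y"
    by (rule eq_matI)
      (auto simp: scalar_prod_def sum.reindex_bij_betw[OF g, symmetric] injf)
  have 2: "mat (card R) (card R) (\<lambda>(i, j). of_bool (g i = g j) + (\<Sum>b\<in>S. Y (g i) b * X b (g j)))
     = 1\<^sub>m (card R) + ?Y * ?X"
    by (rule eq_matI)
      (auto simp: scalar_prod_def sum.reindex_bij_betw[OF f, symmetric] injg)
  show ?thesis
    unfolding det_on_eq_det_mat[OF f] det_on_eq_det_mat[OF g] 1 2
    by (rule det_one_plus_mult_commute_mat) auto
qed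

section \<open>Fourier analysis of the simple random walk\<close>

abbreviation gen_coeff :: "nat \<Rightarrow> int \<Rightarrow> int \<Rightarrow> real" where
  "gen_coeff n x y \<equiv> (srw_generator ^^ n) (indicator {y}) x"

lemma gen_coeff_Suc:
  "gen_coeff (Suc n) x y = (gen_coeff n (x + 1) y + gen_coeff n (x - 1) y - 2 * gen_coeff n x y) / 2"
  by (simp add: srw_generator_def)

lemma gen_coeff_shift: "gen_coeff n (x + k) (y + k) = gen_coeff n x y"
proof (induction n arbitrary: x)
  case 0
  show ?case by (simp add: indicator_def)
next
  case (Suc n)
  have "x + k + 1 = (x + 1) + k" "x + k - 1 = (x - 1) + k" by auto
  then show ?case by (simp only: gen_coeff_Suc Suc.IH)
qed

lemma gen_coeff_uminus: "gen_coeff n (- x) (- y) = gen_coeff n x y"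
proof (induction n arbitrary: x)
  case 0
  show ?case by (simp add: indicator_def)
next
  case (Suc n)
  have "- x + 1 = - (x - 1)" "- x - 1 = - (x + 1)" by auto
  then show ?case by (simp only: gen_coeff_Suc Suc.IH add.commute)
qed

lemma gen_coeff_commute: "gen_coeff n x y = gen_coeff n y x"
  using gen_coeff_shift[of n "- x" "x + y" "- y"] gen_coeff_uminus[of n x y] by simp

lemma srw_transition_commute: "srw_transition t x y = srw_transition t y x"
  by (simp add: srw_transition_def gen_coeff_commute[of _ x y])

text \<open>The generator has operator norm at most \<open>2\<close>. It makes the sums over sites
  below absolutely convergent.\<close>
lemma gen_coeff_bound: "finite F \<Longrightarrow> (\<Sum>y\<in>F. \<bar>gen_coeff n x y\<bar>) \<le> 2 ^ n"
proof (induction n arbitrary: x)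
  case 0
  have "(\<Sum>y\<in>F. \<bar>gen_coeff 0 x y\<bar>) = (\<Sum>y\<in>F. if y = x then 1 else 0)"
    by (intro sum.cong) (auto simp: indicator_def)
  also have "\<dots> \<le> 1" using 0 by (subst sum.delta) auto
  finally show ?case by simp
next
  case (Suc n)
  have "(\<Sum>y\<in>F. \<bar>gen_coeff (Suc n) x y\<bar>) \<le>
      (\<Sum>y\<in>F. \<bar>gen_coeff n (x + 1) y\<bar> / 2 + \<bar>gen_coeff n (x - 1) y\<bar> / 2 + \<bar>gen_coeff n x y\<bar>)"
    unfolding gen_coeff_Suc by (intro sum_mono) (auto simp: abs_if field_simps)
  also have "\<dots> = (\<Sum>y\<in>F. \<bar>gen_coeff n (x + 1) y\<bar>) / 2 + (\<Sum>y\<in>F. \<bar>gen_coeff n (x - 1) y\<bar>) / 2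
      + (\<Sum>y\<in>F. \<bar>gen_coeff n x y\<bar>)"
    by (simp add: sum.distrib sum_divide_distrib)
  also have "\<dots> \<le> 2 ^ Suc n"
    using Suc.IH[OF Suc.prems, of "x + 1"] Suc.IH[OF Suc.prems, of "x - 1"]
      Suc.IH[OF Suc.prems, of x] by simp
  finally show ?case .
qed

text \<open>Characters are eigenfunctions of the generator, with eigenvalue \<open>cos \<theta> - 1\<close>.\<close>
lemma gen_coeff_char:
  "((\<lambda>y. of_real (gen_coeff n x y) * cis (\<theta> * of_int y)) has_sum
     (cis (\<theta> * of_int x) * of_real (cos \<theta> - 1) ^ n)) UNIV"
proof (induction n arbitrary: x)
  case 0
  have "((\<lambda>y. of_real (gen_coeff 0 x y) * cis (\<theta> * of_int y)) has_sum
     (\<Sum>y\<in>{x}. of_real (gen_coeff 0 x y) * cis (\<theta> * of_int y))) UNIV"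
    by (rule has_sum_finite_neutralI[of "{x}"]) auto
  then show ?case by simp
next
  case (Suc n)
  have "((\<lambda>y. (1 / 2) * (of_real (gen_coeff n (x + 1) y) * cis (\<theta> * of_int y)) +
       (1 / 2) * (of_real (gen_coeff n (x - 1) y) * cis (\<theta> * of_int y)) +
       - (of_real (gen_coeff n x y) * cis (\<theta> * of_int y))) has_sum
     ((1 / 2) * (cis (\<theta> * of_int (x + 1)) * of_real (cos \<theta> - 1) ^ n) +
      (1 / 2) * (cis (\<theta> * of_int (x - 1)) * of_real (cos \<theta> - 1) ^ n) +
      - (cis (\<theta> * of_int x) * of_real (cos \<theta> - 1) ^ n))) UNIV"
    by (intro has_sum_add has_sum_cmult_right has_sum_uminusI Suc.IH)
  moreover have "(1 / 2) * cis (\<theta> * of_int (x + 1)) + (1 / 2) * cis (\<theta> * of_int (x - 1)) -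
      cis (\<theta> * of_int x) = cis (\<theta> * of_int x) * of_real (cos \<theta> - 1)"
    by (simp add: complex_eq_iff cos_add sin_add cos_diff sin_diff field_simps)
  from arg_cong[OF this, of "\<lambda>u. u * of_real (cos \<theta> - 1) ^ n"]
  have "(1 / 2) * (cis (\<theta> * of_int (x + 1)) * of_real (cos \<theta> - 1) ^ n) +
      (1 / 2) * (cis (\<theta> * of_int (x - 1)) * of_real (cos \<theta> - 1) ^ n) -
      (cis (\<theta> * of_int x) * of_real (cos \<theta> - 1) ^ n) =
      cis (\<theta> * of_int x) * of_real (cos \<theta> - 1) ^ Suc n"
    by (simp only: distrib_right left_diff_distrib mult.assoc power_Suc)
  moreover have "of_real (gen_coeff (Suc n) x y) * cis (\<theta> * of_int y) =
      (1 / 2) * (of_real (gen_coeff n (x + 1) y) * cis (\<theta> * of_int y)) +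
      (1 / 2) * (of_real (gen_coeff n (x - 1) y) * cis (\<theta> * of_int y)) +
      - (of_real (gen_coeff n x y) * cis (\<theta> * of_int y))" for y
    unfolding gen_coeff_Suc by (simp add: field_simps)
  ultimately show ?case by (simp only: diff_conv_add_uminus)
qed

lemma summable_gen_coeff_abs: "(\<lambda>p. norm (case p of (n, y) \<Rightarrow> t ^ n / fact n * gen_coeff n x y)) summable_on UNIV"
  unfolding abs_summable_iff_bdd_above
proof (rule bdd_aboveI2)
  fix F :: "(nat \<times> int) set" assume "F \<in> {F. F \<subseteq> UNIV \<and> finite F}"
  then have F: "finite F" by simp
  obtain N where N: "fst ` F \<subseteq> {..<N}"
    using F finite_nat_bounded[of "fst ` F"] by auto
  have "(\<Sum>(n, y)\<in>F. norm (t ^ n / fact n * gen_coeff n x y)) \<le>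
      (\<Sum>(n, y)\<in>{..<N} \<times> snd ` F. norm (t ^ n / fact n * gen_coeff n x y))"
    using F N by (intro sum_mono2) force+
  also have "\<dots> = (\<Sum>n<N. \<bar>t\<bar> ^ n / fact n * (\<Sum>y\<in>snd ` F. \<bar>gen_coeff n x y\<bar>))"
    by (simp add: sum.cartesian_product[symmetric] sum_distrib_left abs_mult power_abs)
  also have "\<dots> \<le> (\<Sum>n<N. (2 * \<bar>t\<bar>) ^ n / fact n)"
    using F gen_coeff_bound[of "snd ` F" _ x]
    by (intro sum_mono) (auto simp: power_mult_distrib divide_right_mono mult_left_mono mult.commute)
  also have "\<dots> \<le> exp (2 * \<bar>t\<bar>)"
    using sum_le_suminf[OF summable_exp_generic[of "2 * \<bar>t\<bar>"], of "{..<N}"]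
    by (simp add: exp_def divide_inverse mult.commute)
  finally show "(\<Sum>p\<in>F. norm (case p of (n, y) \<Rightarrow> t ^ n / fact n * gen_coeff n x y)) \<le> exp (2 * \<bar>t\<bar>)"
    by (simp add: case_prod_beta')
qed

lemma srw_transition_has_sum:
  "((\<lambda>n. t ^ n / fact n * gen_coeff n x y) has_sum srw_transition t x y) UNIV"
proof -
  have "(\<lambda>n. norm (t ^ n / fact n * gen_coeff n x y)) summable_on UNIV"
  proof -
    have "(\<lambda>p. norm ((\<lambda>(n, y). t ^ n / fact n * gen_coeff n x y) p)) summable_on ((\<lambda>n. (n, y)) ` UNIV)"
      by (rule summable_on_subset_banach[OF summable_gen_coeff_abs]) auto
    then show ?thesis
      by (subst (asm) summable_on_reindex) (auto simp: inj_on_def o_def)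
  qed
  then have s: "(\<lambda>n. t ^ n / fact n * gen_coeff n x y) summable_on UNIV"
    by (rule abs_summable_summable)
  then have "((\<lambda>n. t ^ n / fact n * gen_coeff n x y) has_sum (\<Sum>\<^sub>\<infinity>n. t ^ n / fact n * gen_coeff n x y)) UNIV"
    by (rule has_sum_infsum)
  moreover from this have "(\<Sum>\<^sub>\<infinity>n. t ^ n / fact n * gen_coeff n x y) = srw_transition t x y"
    unfolding srw_transition_def by (intro sums_unique has_sum_imp_sums)
  ultimately show ?thesis by simp
qed

lemma srw_transition_abs_summable: "(\<lambda>y. norm (srw_transition t x y)) summable_on UNIV"
proof -
  have sm: "(\<lambda>p. norm (case p of (y, n) \<Rightarrow> t ^ n / fact n * gen_coeff n x y)) summable_on UNIV \<times> UNIV"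
    using summable_gen_coeff_abs[of t x]
    by (subst (asm) UNIV_Times_UNIV[symmetric], subst (asm) product_swap[symmetric],
        subst (asm) summable_on_reindex) (auto simp: o_def case_prod_beta' inj_on_def)
  then have "(\<lambda>y. norm (\<Sum>\<^sub>\<infinity>n. norm (t ^ n / fact n * gen_coeff n x y))) summable_on UNIV"
    unfolding Infinite_Sum.abs_summable_on_Sigma_iff by (simp del: real_norm_def)
  then show ?thesis
  proof (rule Infinite_Sum.abs_summable_on_comparison_test)
    fix y :: int
    have "norm (srw_transition t x y) = norm (\<Sum>\<^sub>\<infinity>n. t ^ n / fact n * gen_coeff n x y)"
      using infsumI[OF srw_transition_has_sum] by simp
    also have "\<dots> \<le> (\<Sum>\<^sub>\<infinity>n. norm (t ^ n / fact n * gen_coeff n x y))"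
      using sm
      unfolding Infinite_Sum.abs_summable_on_Sigma_iff by (intro norm_infsum_bound) simp
    also have "\<dots> \<le> norm \<dots>" by simp
    finally show "norm (srw_transition t x y) \<le> norm (\<Sum>\<^sub>\<infinity>n. norm (t ^ n / fact n * gen_coeff n x y))" .
  qed
qed

text \<open>The characteristic function of the walk: the exponential series of the eigenvalue
  \<open>cos \<theta> - 1\<close>, after exchanging the sum over sites with the exponential series.\<close>
lemma srw_transition_char:
  "((\<lambda>y. of_real (srw_transition t x y) * cis (\<theta> * of_int y)) has_sum
     (cis (\<theta> * of_int x) * of_real (exp (- t * (1 - cos \<theta>))))) UNIV"
proof -
  let ?f = "\<lambda>n y. of_real (t ^ n / fact n * gen_coeff n x y) * cis (\<theta> * of_int y) :: complex"
  have abs: "(\<lambda>p. norm (case p of (n, y) \<Rightarrow> ?f n y)) summable_on UNIV \<times> UNIV"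
    using summable_gen_coeff_abs[of t x] by (simp add: case_prod_beta' norm_mult abs_mult norm_divide norm_power power_abs)
  then have sm: "(\<lambda>(n, y). ?f n y) summable_on UNIV \<times> UNIV"
    by (rule abs_summable_summable)
  have inner: "((\<lambda>n. ?f n y) has_sum (of_real (srw_transition t x y) * cis (\<theta> * of_int y))) UNIV" for y
    using has_sum_cmult_left[OF has_sum_of_real[OF srw_transition_has_sum]] .
  have outer: "((\<lambda>y. ?f n y) has_sum
      (cis (\<theta> * of_int x) * (of_real (t * (cos \<theta> - 1)) ^ n / fact n))) UNIV" for n
    using has_sum_cmult_right[OF gen_coeff_char[of n x \<theta>], of "of_real (t ^ n / fact n)"]
    by (simp only: of_real_mult power_mult_distrib of_real_divide of_real_power of_real_fact
        times_divide_eq_left times_divide_eq_right mult_ac)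
  have "(\<Sum>\<^sub>\<infinity>y. of_real (srw_transition t x y) * cis (\<theta> * of_int y)) = (\<Sum>\<^sub>\<infinity>y. \<Sum>\<^sub>\<infinity>n. ?f n y)"
    using infsumI[OF inner] by simp
  also have "\<dots> = (\<Sum>\<^sub>\<infinity>n. \<Sum>\<^sub>\<infinity>y. ?f n y)"
    by (rule infsum_swap_banach[OF sm, symmetric])
  also have "\<dots> = (\<Sum>\<^sub>\<infinity>n. cis (\<theta> * of_int x) * (of_real (t * (cos \<theta> - 1)) ^ n / fact n))"
    using infsumI[OF outer] by simp
  also have "\<dots> = cis (\<theta> * of_int x) * of_real (exp (- t * (1 - cos \<theta>)))"
  proof (rule infsumI)
    have "(\<lambda>n. of_real (t * (cos \<theta> - 1)) ^ n /\<^sub>R fact n) sums exp (of_real (t * (cos \<theta> - 1)) :: complex)"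
      by (rule exp_converges)
    moreover have "summable (\<lambda>n. norm ((of_real (t * (cos \<theta> - 1)) :: complex) ^ n /\<^sub>R fact n))"
      by (rule summable_norm_exp)
    ultimately have "((\<lambda>n. of_real (t * (cos \<theta> - 1)) ^ n /\<^sub>R fact n) has_sum
        exp (of_real (t * (cos \<theta> - 1)) :: complex)) UNIV"
      by (intro norm_summable_imp_has_sum)
    then have "((\<lambda>n. cis (\<theta> * of_int x) * (of_real (t * (cos \<theta> - 1)) ^ n /\<^sub>R fact n)) has_sum
        (cis (\<theta> * of_int x) * exp (of_real (t * (cos \<theta> - 1)) :: complex))) UNIV"
      by (rule has_sum_cmult_right)
    moreover have "exp (of_real (t * (cos \<theta> - 1)) :: complex) = of_real (exp (- t * (1 - cos \<theta>)))"
      by (simp add: exp_of_real[symmetric] algebra_simps)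
    moreover have "z /\<^sub>R fact n = z / fact n" for z :: complex and n
      by (simp add: scaleR_conv_of_real field_simps)
    ultimately show "((\<lambda>n. cis (\<theta> * of_int x) * (of_real (t * (cos \<theta> - 1)) ^ n / fact n)) has_sum
        (cis (\<theta> * of_int x) * of_real (exp (- t * (1 - cos \<theta>))))) UNIV"
      by simp
  qed
  finally have eq: "(\<Sum>\<^sub>\<infinity>y. of_real (srw_transition t x y) * cis (\<theta> * of_int y)) =
      cis (\<theta> * of_int x) * of_real (exp (- t * (1 - cos \<theta>)))" .
  have "(\<lambda>y. norm (of_real (srw_transition t x y) * cis (\<theta> * of_int y))) summable_on UNIV"
    using srw_transition_abs_summable[of t x] by (simp add: norm_mult)
  then show ?thesis
    using eq has_sum_infsum abs_summable_summable by fastforce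
qed

text \<open>Labels and sites are summed over growing symmetric windows; unconditional summation gives
  convergence along these.\<close>
lemma has_sum_int_windows:
  fixes f :: "int \<Rightarrow> 'a::{comm_monoid_add,topological_space}"
  assumes "(f has_sum l) UNIV"
  shows "(\<lambda>n. \<Sum>z\<in>{-int n..int n}. f z) \<longlonglongrightarrow> l"
proof -
  have "filterlim (\<lambda>n::nat. {-int n..int n}) (finite_subsets_at_top UNIV) sequentially"
    unfolding filterlim_iff eventually_finite_subsets_at_top
  proof safe
    fix P and X :: "int set" assume X: "finite X" and P: "\<forall>Y. finite Y \<and> X \<subseteq> Y \<and> Y \<subseteq> UNIV \<longrightarrow> P Y"
    define N where "N = nat (Max (insert 0 (abs ` X)))"
    have "X \<subseteq> {-int n..int n}" if "n \<ge> N" for n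
    proof
      fix x assume "x \<in> X"
      then have "\<bar>x\<bar> \<le> Max (insert 0 (abs ` X))" using X by (intro Max_ge) auto
      then show "x \<in> {-int n..int n}" using that unfolding N_def by auto
    qed
    then show "\<forall>\<^sub>F n in sequentially. P {-int n..int n}"
      unfolding eventually_sequentially using P by (intro exI[of _ N]) auto
  qed
  then show ?thesis
    using assms unfolding has_sum_def by (rule filterlim_compose[rotated])
qed

lemma srw_transition_sum_bound:
  obtains C where "C \<ge> 0" "\<And>F. finite F \<Longrightarrow> (\<Sum>y\<in>F. \<bar>srw_transition t x y\<bar>) \<le> C"
proof
  show "0 \<le> (\<Sum>\<^sub>\<infinity>y. \<bar>srw_transition t x y\<bar>)" by (intro infsum_nonneg) auto
  show "(\<Sum>y\<in>F. \<bar>srw_transition t x y\<bar>) \<le> (\<Sum>\<^sub>\<infinity>y. \<bar>srw_transition t x y\<bar>)" if "finite F" for F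
    using srw_transition_abs_summable[of t x] that by (intro finite_sum_le_infsum) auto
qed

lemma M_hat_cis:
  "M_hat a k t y = 1 / (2 * of_real pi) * integral {-pi..pi} (\<lambda>l.
     cis (l * (of_int y / of_nat a - of_int k)) * of_real (exp (t * (1 - cos (l / of_nat a)))))"
  by (simp add: M_hat_def cis_conv_exp)

lemma integral_cis_int:
  "integral {-pi..pi} (\<lambda>l. cis (l * of_int n)) = of_bool (n = 0) * (2 * of_real pi)"
proof (cases "n = 0")
  case True
  then show ?thesis by (simp add: scaleR_conv_of_real)
next
  case False
  have "((\<lambda>l. cis (l * of_int n)) has_integral
      (cis (pi * of_int n) / (\<i> * of_int n) - cis (-pi * of_int n) / (\<i> * of_int n))) {-pi..pi}"
  proof (rule fundamental_theorem_of_calculus)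
    fix l :: real
    have "((\<lambda>z. exp (\<i> * of_int n * z) / (\<i> * of_int n)) has_field_derivative
        exp (\<i> * of_int n * of_real l)) (at (of_real l))"
      using False by (auto intro!: derivative_eq_intros)
    from has_vector_derivative_real_field[OF this]
    show "((\<lambda>l. cis (l * of_int n) / (\<i> * of_int n)) has_vector_derivative cis (l * of_int n))
        (at l within {-pi..pi})"
      by (simp add: cis_conv_exp mult_ac)
  qed simp
  moreover have "cis (pi * of_int n) = cis (- pi * of_int n)"
    by (simp add: complex_eq_iff sin_times_pi_eq_0 mult.commute)
  ultimately show ?thesis using False by (simp add: integral_unique)
qed

text \<open>Orthogonality of the characters: at time \<open>0\<close> and on the starting lattice, \<open>M_hat\<close> is the
  identity matrix.\<close>
lemma M_hat_0:
  assumes "0 < a"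
  shows "M_hat a k 0 (int a * j) = of_bool (j = k)"
proof -
  have eq: "of_int (int a * j) / of_nat a - of_int k = (of_int (j - k) :: real)"
    using assms by simp
  show ?thesis
    unfolding M_hat_cis eq by (simp add: integral_cis_int del: of_int_diff)
qed

lemma mult_one_minus_cos_le: "t * (1 - cos x) \<le> \<bar>t\<bar> * (2 :: real)"
proof -
  have "t * (1 - cos x) \<le> \<bar>t\<bar> * (1 - cos x)" by (intro mult_right_mono) auto
  also have "\<dots> \<le> \<bar>t\<bar> * 2"
    using cos_ge_minus_one[of x] by (intro mult_left_mono) linarith+
  finally show ?thesis .
qed

lemma M_hat_bounded:
  assumes "0 < a"
  shows "\<exists>C. \<forall>y. norm (M_hat a k t y) \<le> C"
proof (intro exI allI)
  fix y
  have "norm (integral {-pi..pi} (\<lambda>l.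
     cis (l * (of_int y / of_nat a - of_int k)) * of_real (exp (t * (1 - cos (l / of_nat a)))))) \<le>
     exp (\<bar>t\<bar> * 2) * (pi - (-pi))"
  proof (rule integral_bound)
    fix l :: real
    show "norm (cis (l * (of_int y / of_nat a - of_int k)) *
        of_real (exp (t * (1 - cos (l / of_nat a)))) :: complex) \<le> exp (\<bar>t\<bar> * 2)"
      using mult_one_minus_cos_le[of t "l / of_nat a"] by (simp add: norm_mult)
  qed (use assms in \<open>auto intro!: continuous_intros\<close>)
  then show "norm (M_hat a k t y) \<le> norm (1 / (2 * of_real pi) :: complex) * (exp (\<bar>t\<bar> * 2) * (pi - (-pi)))"
    unfolding M_hat_cis norm_mult by (intro mult_left_mono) auto
qed

text \<open>The end points are excluded from the pointwise convergence because the integrand of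
  \<open>lattice_kernel_limit\<close> fails to converge to \<open>0\<close> there.\<close>
lemma integral_sequence_limit:
  fixes f :: "nat \<Rightarrow> real \<Rightarrow> complex"
  assumes cont: "\<And>n. continuous_on {-pi..pi} (f n)"
    and bound: "\<And>n l. l \<in> {-pi..pi} \<Longrightarrow> norm (f n l) \<le> B"
    and lim: "\<And>l. l \<in> {-pi<..<pi} \<Longrightarrow> (\<lambda>n. f n l) \<longlonglongrightarrow> g l"
  shows "(\<lambda>n. integral {-pi..pi} (f n)) \<longlonglongrightarrow> integral {-pi..pi} g"
proof -
  let ?S = "{-pi<..<pi}"
  have "(\<lambda>n. integral ?S (f n)) \<longlonglongrightarrow> integral ?S g"
  proof (rule dominated_convergence(2))
    show "f n integrable_on ?S" for n
      using integrable_continuous_interval[OF cont] by (simp add: integrable_on_Icc_iff_Ioo)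
    show "(\<lambda>_. B) integrable_on ?S" using integrable_const_ivl[of B "-pi" pi] by (simp add: integrable_on_Icc_iff_Ioo)
  qed (use bound lim in auto)
  then show ?thesis by (simp add: integral_open_interval_real)
qed

text \<open>A sum over sites passes under an integral over frequencies, because the summable
  coefficients bound the integrand uniformly in the window.\<close>
lemma integral_window_sums:
  fixes c :: "int \<Rightarrow> real" and e S :: "real \<Rightarrow> complex"
  assumes e: "continuous_on {-pi..pi} e" and \<phi>: "\<And>w. continuous_on {-pi..pi} (\<phi> w)"
    and C: "\<And>F. finite F \<Longrightarrow> (\<Sum>w\<in>F. \<bar>c w\<bar>) \<le> C"
    and S: "\<And>l. ((\<lambda>w. of_real (c w) * cis (\<phi> w l)) has_sum S l) UNIV"
  shows "(\<lambda>n. \<Sum>w\<in>{-int n..int n}. of_real (c w) * integral {-pi..pi} (\<lambda>l. cis (\<phi> w l) * e l))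
    \<longlonglongrightarrow> integral {-pi..pi} (\<lambda>l. S l * e l)"
proof -
  define f where "f n l = (\<Sum>w\<in>{-int n..int n}. of_real (c w) * cis (\<phi> w l)) * e l" for n :: nat and l
  obtain B where B: "\<And>l. l \<in> {-pi..pi} \<Longrightarrow> norm (e l) \<le> B"
    using compact_imp_bounded[OF compact_continuous_image[OF e compact_Icc]]
    unfolding bounded_iff by blast
  have "(\<Sum>w\<in>{-int n..int n}. of_real (c w) * integral {-pi..pi} (\<lambda>l. cis (\<phi> w l) * e l)) =
      integral {-pi..pi} (f n)" for n
    unfolding f_def sum_distrib_right mult.assoc
    by (subst integral_sum)
      (auto intro!: integrable_continuous_interval continuous_intros e \<phi>)
  moreover have "(\<lambda>n. integral {-pi..pi} (f n)) \<longlonglongrightarrow> integral {-pi..pi} (\<lambda>l. S l * e l)"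
  proof (rule integral_sequence_limit)
    show "continuous_on {-pi..pi} (f n)" for n
      unfolding f_def by (intro continuous_intros e \<phi>)
    show "norm (f n l) \<le> C * B" if "l \<in> {-pi..pi}" for n l
    proof -
      have "norm (\<Sum>w\<in>{-int n..int n}. of_real (c w) * cis (\<phi> w l)) \<le> C"
        using C[of "{-int n..int n}"]
        by (intro order_trans[OF norm_sum]) (auto simp: norm_mult)
      then show ?thesis
        unfolding f_def norm_mult using B[OF that] C[of "{}"] by (intro mult_mono) auto
    qed
    show "(\<lambda>n. f n l) \<longlonglongrightarrow> S l * e l" for l
      unfolding f_def by (intro tendsto_mult_right has_sum_int_windows S)
  qed
  ultimately show ?thesis by simp
qed

text \<open>The martingale property of \<open>M_hat\<close>, seen from the transition semigroup: the factor
  \<open>exp (t * (1 - cos (l / a)))\<close> cancels the decay of the character of frequency \<open>l / a\<close>.\<close>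
lemma srw_transition_M_hat:
  assumes a: "0 < a"
  shows "(\<lambda>n. \<Sum>w\<in>{-int n..int n}. of_real (srw_transition r y w) * M_hat a k t w) \<longlonglongrightarrow> M_hat a k (t - r) y"
proof -
  define e where "e l = cis (- l * of_int k) * of_real (exp (t * (1 - cos (l / of_nat a))))" for l
  have split: "cis (l * (of_int w / of_nat a - of_int k)) * of_real (exp (t * (1 - cos (l / of_nat a))))
      = cis (l / of_nat a * of_int w) * e l" for l w
    by (simp add: e_def cis_mult algebra_simps flip: mult.assoc)
  obtain C where C: "\<And>F. finite F \<Longrightarrow> (\<Sum>w\<in>F. \<bar>srw_transition r y w\<bar>) \<le> C"
    using srw_transition_sum_bound[of r y] by blast
  have "(\<lambda>n. \<Sum>w\<in>{-int n..int n}. of_real (srw_transition r y w) *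
        integral {-pi..pi} (\<lambda>l. cis (l / of_nat a * of_int w) * e l)) \<longlonglongrightarrow>
      integral {-pi..pi} (\<lambda>l. cis (l / of_nat a * of_int y) * of_real (exp (- r * (1 - cos (l / of_nat a)))) * e l)"
    by (rule integral_window_sums[OF _ _ C srw_transition_char])
      (use a in \<open>auto simp: e_def intro!: continuous_intros\<close>)
  moreover have "cis (l / of_nat a * of_int y) * of_real (exp (- r * (1 - cos (l / of_nat a)))) * e l =
      cis (l * (of_int y / of_nat a - of_int k)) * of_real (exp ((t - r) * (1 - cos (l / of_nat a))))" for l
  proof -
    have 1: "exp ((t - r) * (1 - cos (l / of_nat a))) =
        exp (- r * (1 - cos (l / of_nat a))) * exp (t * (1 - cos (l / of_nat a)))"
      by (simp add: exp_add[symmetric] algebra_simps)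
    have 2: "cis (l * (of_int y / of_nat a - of_int k)) = cis (l / of_nat a * of_int y) * cis (- l * of_int k)"
      by (simp add: cis_mult algebra_simps)
    show ?thesis unfolding 1 2 e_def by simp
  qed
  ultimately have "(\<lambda>n. 1 / (2 * of_real pi) * (\<Sum>w\<in>{-int n..int n}. of_real (srw_transition r y w) *
        integral {-pi..pi} (\<lambda>l. cis (l / of_nat a * of_int w) * e l))) \<longlonglongrightarrow> M_hat a k (t - r) y"
    unfolding M_hat_cis by (simp only:) (rule tendsto_mult_left)
  then show ?thesis
    unfolding M_hat_cis[of a k t] split by (simp only: sum_distrib_left mult.left_commute)
qed

text \<open>Fourier inversion, by orthogonality of the characters in the window sums.\<close>
lemma srw_transition_inversion:
  "of_real (srw_transition t x y) = 1 / (2 * of_real pi) *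
     integral {-pi..pi} (\<lambda>l. cis (l * of_int (x - y)) * of_real (exp (- t * (1 - cos l))))"
proof -
  let ?s = "\<lambda>n. \<Sum>w\<in>{-int n..int n}. of_real (srw_transition t x w) *
    integral {-pi..pi} (\<lambda>l. cis (l * of_int w) * cis (- l * of_int y))"
  obtain C where C: "\<And>F. finite F \<Longrightarrow> (\<Sum>w\<in>F. \<bar>srw_transition t x w\<bar>) \<le> C"
    using srw_transition_sum_bound[of t x] by blast
  have "?s \<longlonglongrightarrow> integral {-pi..pi}
      (\<lambda>l. cis (l * of_int x) * of_real (exp (- t * (1 - cos l))) * cis (- l * of_int y))"
    by (rule integral_window_sums[OF _ _ C srw_transition_char]) (auto intro!: continuous_intros)
  moreover have "?s \<longlonglongrightarrow> 2 * of_real pi * of_real (srw_transition t x y)"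
  proof (rule tendsto_eventually, rule eventually_sequentiallyI[of "nat \<bar>y\<bar>"])
    fix n assume n: "nat \<bar>y\<bar> \<le> n"
    have "cis (l * of_int w) * cis (- l * of_int y) = cis (l * of_int (w - y))" for l w
      by (simp add: cis_mult right_diff_distrib)
    then have "?s n = (\<Sum>w\<in>{-int n..int n}. if w = y then of_real (srw_transition t x w) * (2 * of_real pi) else 0)"
      by (intro sum.cong refl) (simp only: integral_cis_int, simp)
    also have "\<dots> = 2 * of_real pi * of_real (srw_transition t x y)"
    proof -
      have "y \<in> {-int n..int n}" using n by auto
      then show ?thesis by (simp add: sum.delta mult.commute)
    qed
    finally show "?s n = 2 * of_real pi * of_real (srw_transition t x y)" .
  qed
  ultimately have "integral {-pi..pi} (\<lambda>l. cis (l * of_int x) * of_real (exp (- t * (1 - cos l))) * cis (- l * of_int y))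
      = 2 * of_real pi * of_real (srw_transition t x y)"
    by (rule LIMSEQ_unique)
  moreover have "cis (l * of_int x) * of_real (exp (- t * (1 - cos l))) * cis (- l * of_int y) =
      cis (l * of_int (x - y)) * of_real (exp (- t * (1 - cos l)))" for l
    by (simp add: mult_ac right_diff_distrib flip: cis_divide cis_inverse) (simp add: divide_inverse)
  ultimately have "integral {-pi..pi} (\<lambda>l. cis (l * of_int (x - y)) * of_real (exp (- t * (1 - cos l))))
      = 2 * of_real pi * of_real (srw_transition t x y)"
    by (simp only:)
  then show ?thesis by simp
qed

section \<open>The correlation kernel and its long-time limit\<close>

lemma has_sum_finite_sum:
  fixes f :: "'i \<Rightarrow> 'a \<Rightarrow> 'b::topological_comm_monoid_add"
  assumes "\<And>i. i \<in> I \<Longrightarrow> (f i has_sum s i) A"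
  shows "((\<lambda>x. \<Sum>i\<in>I. f i x) has_sum (\<Sum>i\<in>I. s i)) A"
  using assms by (induction I rule: infinite_finite_induct) (auto intro: has_sum_add)

text \<open>The average of the \<open>a\<close> characters that are trivial on \<open>a\<int>\<close> is the indicator of \<open>a\<int>\<close>.\<close>
lemma sum_roots_of_unity:
  assumes a: "0 < a"
  shows "(\<Sum>r<a. cis (- (2 * pi * real r / real a) * of_int z)) = (if int a dvd z then of_nat a else 0)"
proof -
  define w where "w = cis (- (2 * pi * of_int z / real a))"
  have pow: "cis (- (2 * pi * real r / real a) * of_int z) = w ^ r" for r
    unfolding w_def Complex.DeMoivre by (rule arg_cong[where f = cis]) (simp add: field_simps)
  show ?thesis
  proof (cases "int a dvd z")
    case True
    then obtain k where k: "z = int a * k" by blast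
    have "w = cis (2 * pi * of_int (- k))"
      using a by (simp add: w_def k mult.assoc)
    also have "\<dots> = 1" by (rule cis_multiple_2pi) simp
    finally show ?thesis using True by (simp only: pow) simp
  next
    case False
    have "w \<noteq> 1"
    proof
      assume "w = 1"
      then have "cos (2 * pi * of_int z / real a) = 1"
        by (simp add: w_def complex_eq_iff)
      then obtain n :: int where "2 * pi * of_int z / real a = of_int n * 2 * pi"
        using cos_one_2pi_int by blast
      then have "of_int z = (of_int n * of_nat a :: real)"
        using a by (simp add: field_simps)
      then have "z = n * int a" by (metis of_int_eq_iff of_int_mult of_int_of_nat_eq)
      with False show False by simp
    qed
    moreover have "w ^ a = 1"
    proof -
      have "w ^ a = cis (2 * pi * of_int (- z))"
        using a by (simp add: w_def Complex.DeMoivre)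
      also have "\<dots> = 1" by (rule cis_multiple_2pi) simp
      finally show ?thesis .
    qed
    ultimately show ?thesis using False by (simp only: pow) (simp add: geometric_sum)
  qed
qed

text \<open>Poisson summation for the sublattice of starting points: restricting a sum to \<open>a\<int>\<close>
  amounts to averaging over the \<open>a\<close> frequencies that coincide on it.\<close>
lemma srw_transition_sublattice_char:
  assumes a: "0 < a"
  shows "((\<lambda>j. of_real (srw_transition s (int a * j) y) * cis (- l * of_int j)) has_sum
    (1 / of_nat a * (\<Sum>r<a. cis (- ((l + 2 * pi * real r) / real a) * of_int y) *
       of_real (exp (- s * (1 - cos ((l + 2 * pi * real r) / real a))))))) UNIV"
proof -
  define \<theta> where "\<theta> r = (l + 2 * pi * real r) / real a" for r :: nat
  have "((\<lambda>z. 1 / of_nat a * (\<Sum>r<a. of_real (srw_transition s y z) * cis (- \<theta> r * of_int z))) has_sum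
    (1 / of_nat a * (\<Sum>r<a. cis (- \<theta> r * of_int y) * of_real (exp (- s * (1 - cos (- \<theta> r))))))) UNIV"
    by (intro has_sum_cmult_right has_sum_finite_sum srw_transition_char)
  moreover have "1 / of_nat a * (\<Sum>r<a. of_real (srw_transition s y z) * cis (- \<theta> r * of_int z)) =
    (if int a dvd z then of_real (srw_transition s y z) * cis (- l / real a * of_int z) else 0)" for z
  proof -
    have "cis (- \<theta> r * of_int z) = cis (- l / real a * of_int z) * cis (- (2 * pi * real r / real a) * of_int z)" for r
      by (simp add: \<theta>_def cis_mult add_divide_distrib algebra_simps)
    then have "(\<Sum>r<a. of_real (srw_transition s y z) * cis (- \<theta> r * of_int z)) =
        of_real (srw_transition s y z) * cis (- l / real a * of_int z) *
        (\<Sum>r<a. cis (- (2 * pi * real r / real a) * of_int z))"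
      by (simp add: sum_distrib_left mult.assoc)
    then show ?thesis using a by (simp only: sum_roots_of_unity[OF a]) simp
  qed
  ultimately have "((\<lambda>z. if int a dvd z then of_real (srw_transition s y z) * cis (- l / real a * of_int z) else 0) has_sum
    (1 / of_nat a * (\<Sum>r<a. cis (- \<theta> r * of_int y) * of_real (exp (- s * (1 - cos (\<theta> r))))))) UNIV"
    by simp
  then have "((\<lambda>z. of_real (srw_transition s y z) * cis (- l / real a * of_int z)) has_sum
    (1 / of_nat a * (\<Sum>r<a. cis (- \<theta> r * of_int y) * of_real (exp (- s * (1 - cos (\<theta> r)))))))
    (range ((*) (int a)))"
    by (rule iffD1[OF has_sum_cong_neutral, rotated -1]) auto
  then show ?thesis
    using a by (subst (asm) has_sum_reindex)
      (auto simp: inj_on_def o_def \<theta>_def srw_transition_commute[of s y])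
qed

text \<open>The sum over all labels \<open>j\<close> of \<open>M_hat a j t x\<close> times the transition probability from \<open>a * j\<close>
  to \<open>y\<close> in time \<open>s\<close>, after Poisson summation.\<close>
definition lattice_kernel :: "nat \<Rightarrow> real \<Rightarrow> int \<Rightarrow> real \<Rightarrow> int \<Rightarrow> complex" where
  "lattice_kernel a t x s y = 1 / (2 * of_real pi * of_nat a) * (\<Sum>r<a. integral {-pi..pi} (\<lambda>l.
     cis (l / real a * of_int x - (l + 2 * pi * real r) / real a * of_int y) *
     of_real (exp (t * (1 - cos (l / real a)) - s * (1 - cos ((l + 2 * pi * real r) / real a))))))"

text \<open>The part \<open>\<Sum>j M_hat j b * p(a j, c)\<close> of the correlation kernel, in the limit of all labels.\<close>
lemma M_hat_srw_transition_sums: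
  assumes a: "0 < a"
  shows "(\<lambda>n. \<Sum>j\<in>{-int n..int n}. M_hat a j t x * of_real (srw_transition s (int a * j) y))
    \<longlonglongrightarrow> lattice_kernel a t x s y"
proof -
  define e where "e l = cis (l / real a * of_int x) * of_real (exp (t * (1 - cos (l / real a))))" for l
  define g where "g r l = cis (- ((l + 2 * pi * real r) / real a) * of_int y) *
       of_real (exp (- s * (1 - cos ((l + 2 * pi * real r) / real a))))" for r :: nat and l
  have cont_e: "continuous_on A e" for A
    unfolding e_def by (intro continuous_intros) (use a in auto)
  have cont_g: "continuous_on A (g r)" for A r
    unfolding g_def by (intro continuous_intros) (use a in auto)
  have split: "cis (l * (of_int x / of_nat a - of_int k)) * of_real (exp (t * (1 - cos (l / of_nat a))))
      = cis (- l * of_int k) * e l" for l k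
    by (simp add: e_def cis_mult right_diff_distrib flip: mult.assoc)
  obtain C where C: "\<And>F. finite F \<Longrightarrow> (\<Sum>w\<in>F. \<bar>srw_transition s y w\<bar>) \<le> C"
    using srw_transition_sum_bound[of s y] by blast
  have C': "(\<Sum>j\<in>F. \<bar>srw_transition s (int a * j) y\<bar>) \<le> C" if "finite F" for F
  proof -
    have "(\<Sum>j\<in>F. \<bar>srw_transition s (int a * j) y\<bar>) = (\<Sum>w\<in>(*) (int a) ` F. \<bar>srw_transition s y w\<bar>)"
      using a by (subst sum.reindex) (auto simp: inj_on_def srw_transition_commute[of s y])
    also have "\<dots> \<le> C" using that by (intro C) simp
    finally show ?thesis .
  qed
  let ?s = "\<lambda>n. \<Sum>j\<in>{-int n..int n}. of_real (srw_transition s (int a * j) y) *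
    integral {-pi..pi} (\<lambda>l. cis (- l * of_int j) * e l)"
  have "?s \<longlonglongrightarrow> integral {-pi..pi} (\<lambda>l. 1 / of_nat a * (\<Sum>r<a. g r l) * e l)"
    unfolding g_def
    by (rule integral_window_sums[OF cont_e _ C' srw_transition_sublattice_char[OF a]])
      (auto intro!: continuous_intros)
  moreover have "integral {-pi..pi} (\<lambda>l. 1 / of_nat a * (\<Sum>r<a. g r l) * e l) =
      1 / of_nat a * (\<Sum>r<a. integral {-pi..pi} (\<lambda>l. g r l * e l))"
    unfolding mult.assoc sum_distrib_right
    by (subst integral_mult_right, subst integral_sum)
      (auto intro!: integrable_continuous_interval continuous_intros cont_e cont_g)
  moreover have "g r l * e l = cis (l / real a * of_int x - (l + 2 * pi * real r) / real a * of_int y) *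
     of_real (exp (t * (1 - cos (l / real a)) - s * (1 - cos ((l + 2 * pi * real r) / real a))))" for r l
  proof -
    have 1: "exp (t * (1 - cos (l / real a)) - s * (1 - cos ((l + 2 * pi * real r) / real a))) =
       exp (- s * (1 - cos ((l + 2 * pi * real r) / real a))) * exp (t * (1 - cos (l / real a)))"
      by (simp add: exp_add[symmetric])
    have 2: "cis (l / real a * of_int x - (l + 2 * pi * real r) / real a * of_int y) =
       cis (- ((l + 2 * pi * real r) / real a) * of_int y) * cis (l / real a * of_int x)"
      by (simp add: cis_mult)
    show ?thesis unfolding 1 2 g_def e_def by simp
  qed
  ultimately have "(\<lambda>n. 1 / (2 * of_real pi) * ?s n) \<longlonglongrightarrow>
     1 / (2 * of_real pi) * (1 / of_nat a * (\<Sum>r<a. integral {-pi..pi} (\<lambda>l.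
     cis (l / real a * of_int x - (l + 2 * pi * real r) / real a * of_int y) *
     of_real (exp (t * (1 - cos (l / real a)) - s * (1 - cos ((l + 2 * pi * real r) / real a)))))))"
    by (simp only:) (rule tendsto_mult_left)
  moreover have "(\<Sum>j\<in>{-int n..int n}. M_hat a j t x * of_real (srw_transition s (int a * j) y)) =
      1 / (2 * of_real pi) * ?s n" for n
    by (simp add: M_hat_cis split sum_distrib_left mult_ac)
  ultimately show ?thesis unfolding lattice_kernel_def by (simp add: mult.assoc)
qed

text \<open>Among the frequencies \<open>(l + 2 * pi * r) / a\<close>, the one in the interval from \<open>- pi / a\<close> to \<open>pi / a\<close>
  maximises the cosine. The difference is \<open>2 * sin (pi * r / a)\<close>, which is positive, times the sine
  of an angle between \<open>0\<close> and \<open>pi\<close>.\<close>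
lemma cos_shift_less:
  assumes "0 < r" "r < a" and l: "\<bar>l\<bar> \<le> pi"
  shows "cos ((l + 2 * pi * real r) / real a) \<le> cos (l / real a)"
    and "\<bar>l\<bar> < pi \<Longrightarrow> cos ((l + 2 * pi * real r) / real a) < cos (l / real a)"
proof -
  have a: "0 < real a" using assms by simp
  have a': "0 < real a" "pi * real a / real a = pi" using a by auto
  have eq: "cos (l / real a) - cos ((l + 2 * pi * real r) / real a) =
      2 * sin ((l + pi * real r) / real a) * sin (pi * real r / real a)"
  proof -
    have "(l / real a + (l + 2 * pi * real r) / real a) / 2 = (l + pi * real r) / real a"
      "((l + 2 * pi * real r) / real a - l / real a) / 2 = pi * real r / real a"
      using a by (auto simp: field_simps)
    then show ?thesis by (simp only: cos_diff_cos)
  qed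
  have r1: "1 \<le> real r" "real r + 1 \<le> real a" using assms by auto
  have "pi * real r < pi * real a" using assms by simp
  then have 1: "0 < sin (pi * real r / real a)"
    using assms a by (intro sin_gt_zero) (auto simp: field_simps)
  have "pi * 1 \<le> pi * real r" "pi * (real r + 1) \<le> pi * real a"
    using r1 by (intro mult_left_mono; simp)+
  then have b: "pi \<le> pi * real r" "pi * real r + pi \<le> pi * real a"
    by (simp_all only: mult_1_right distrib_left)
  have "0 \<le> sin ((l + pi * real r) / real a)"
    using divide_nonneg_pos[of "l + pi * real r" "real a"] divide_right_mono[of "l + pi * real r" "pi * real a" "real a"] l b a'
    by (intro sin_ge_zero) linarith+
  then have "0 \<le> 2 * sin ((l + pi * real r) / real a) * sin (pi * real r / real a)"
    using 1 by (intro mult_nonneg_nonneg) auto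
  with eq show "cos ((l + 2 * pi * real r) / real a) \<le> cos (l / real a)" by linarith
  assume l: "\<bar>l\<bar> < pi"
  have "0 < sin ((l + pi * real r) / real a)"
    using divide_pos_pos[of "l + pi * real r" "real a"] divide_strict_right_mono[of "l + pi * real r" "pi * real a" "real a"] l b a'
    by (intro sin_gt_zero) linarith+
  then have "0 < 2 * sin ((l + pi * real r) / real a) * sin (pi * real r / real a)"
    using 1 by (intro mult_pos_pos) auto
  with eq show "cos ((l + 2 * pi * real r) / real a) < cos (l / real a)" by linarith
qed

text \<open>Relaxation: a time shift \<open>\<tau>\<close> multiplies the term \<open>r\<close> by
  \<open>exp (- \<tau> * (cos (l / a) - cos ((l + 2 * pi * r) / a)))\<close>. This factor is constant for
  \<open>r = 0\<close> and tends to \<open>0\<close> for \<open>r > 0\<close>, except at the two end points of the interval.\<close>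
lemma lattice_kernel_limit:
  assumes a: "0 < a"
  shows "((\<lambda>\<tau>. lattice_kernel a (t + \<tau>) x (s + \<tau>) y) \<longlongrightarrow>
    1 / (2 * of_real pi * of_nat a) * integral {-pi..pi} (\<lambda>l.
      cis (l * (of_int (x - y) / real a)) * of_real (exp ((t - s) * (1 - cos (l / real a)))))) at_top"
proof -
  define I where "I \<tau> r = integral {-pi..pi} (\<lambda>l.
     cis (l / real a * of_int x - (l + 2 * pi * real r) / real a * of_int y) *
     of_real (exp ((t + \<tau>) * (1 - cos (l / real a)) - (s + \<tau>) * (1 - cos ((l + 2 * pi * real r) / real a)))))"
    for \<tau> and r :: nat
  define J where "J = integral {-pi..pi} (\<lambda>l.
      cis (l * (of_int (x - y) / real a)) * of_real (exp ((t - s) * (1 - cos (l / real a)))))"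
  have I0: "I \<tau> 0 = J" for \<tau>
    unfolding I_def J_def by (intro integral_cong) (simp add: algebra_simps diff_divide_distrib)
  have Ir: "((\<lambda>\<tau>. I \<tau> r) \<longlongrightarrow> 0) at_top" if r: "0 < r" "r < a" for r
  proof (rule tendsto_at_topI_sequentially)
    fix X :: "nat \<Rightarrow> real" assume X: "filterlim X at_top sequentially"
    \<comment> \<open>The bound on the integrand holds for nonnegative shifts only.\<close>
    define Y where "Y n = max 0 (X n)" for n
    have Y: "filterlim Y at_top sequentially"
      by (rule filterlim_at_top_mono[OF X]) (auto simp: Y_def)
    define c where "c l = cos (l / real a) - cos ((l + 2 * pi * real r) / real a)" for l
    define b where "b l = t * (1 - cos (l / real a)) - s * (1 - cos ((l + 2 * pi * real r) / real a))" for l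
    have ex: "(t + \<tau>) * (1 - cos (l / real a)) - (s + \<tau>) * (1 - cos ((l + 2 * pi * real r) / real a))
        = b l - \<tau> * c l" for \<tau> l by (simp add: b_def c_def algebra_simps)
    have "(\<lambda>n. I (Y n) r) \<longlonglongrightarrow> integral {-pi..pi} (\<lambda>l. 0 :: complex)"
      unfolding I_def ex
    proof (rule integral_sequence_limit)
      show "continuous_on {-pi..pi} (\<lambda>l.
          cis (l / real a * of_int x - (l + 2 * pi * real r) / real a * of_int y) *
          of_real (exp (b l - Y n * c l)))" for n
        unfolding b_def c_def by (intro continuous_intros) (use a in auto)
      show "norm (cis (l / real a * of_int x - (l + 2 * pi * real r) / real a * of_int y) *
          of_real (exp (b l - Y n * c l)) :: complex) \<le> exp (2 * \<bar>t\<bar> + 2 * \<bar>s\<bar>)"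
        if "l \<in> {-pi..pi}" for n l
      proof -
        have "0 \<le> c l" using cos_shift_less(1)[OF r, of l] that by (auto simp: c_def)
        then have "0 \<le> Y n * c l" by (simp add: Y_def)
        moreover have "b l \<le> \<bar>t\<bar> * 2 + \<bar>s\<bar> * 2"
          using mult_one_minus_cos_le[of t "l / real a"]
            mult_one_minus_cos_le[of "- s" "(l + 2 * pi * real r) / real a"]
          unfolding b_def by simp
        ultimately show ?thesis by (simp add: norm_mult)
      qed
      show "(\<lambda>n. cis (l / real a * of_int x - (l + 2 * pi * real r) / real a * of_int y) *
          of_real (exp (b l - Y n * c l)) :: complex) \<longlonglongrightarrow> 0" if "l \<in> {-pi<..<pi}" for l
      proof -
        have "0 < c l" using cos_shift_less(2)[OF r, of l] that by (auto simp: c_def)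
        then have "filterlim (\<lambda>n. Y n * c l) at_top sequentially"
          by (intro filterlim_at_top_mult_tendsto_pos[OF tendsto_const _ Y])
        then have "filterlim (\<lambda>n. - b l + Y n * c l) at_top sequentially"
          by (rule filterlim_tendsto_add_at_top[OF tendsto_const])
        then have "filterlim (\<lambda>n. b l - Y n * c l) at_bot sequentially"
          unfolding filterlim_uminus_at_bot by (simp add: algebra_simps)
        then have "(\<lambda>n. exp (b l - Y n * c l)) \<longlonglongrightarrow> 0"
          by (rule filterlim_compose[OF exp_at_bot])
        then show ?thesis
          by (intro tendsto_norm_zero_cancel[of "\<lambda>n. _ n * _ n"]) (simp add: norm_mult)
      qed
    qed
    moreover have "\<forall>\<^sub>F n in sequentially. I (Y n) r = I (X n) r"
      using X[unfolded filterlim_at_top, rule_format, of 0] by eventually_elim (simp add: Y_def max_def)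
    ultimately show "(\<lambda>n. I (X n) r) \<longlonglongrightarrow> 0"
      by (simp add: tendsto_cong)
  qed
  have "((\<lambda>\<tau>. \<Sum>r<a. I \<tau> r) \<longlongrightarrow> (\<Sum>r<a. if r = 0 then J else 0)) at_top"
    by (intro tendsto_sum) (auto simp: I0 intro!: Ir)
  also have "(\<Sum>r<a. if r = 0 then J else 0) = J" using a by (simp add: sum.delta)
  finally show ?thesis
    unfolding lattice_kernel_def I_def[symmetric] J_def[symmetric] by (rule tendsto_mult_left)
qed

lemma integral_cis_even:
  fixes h :: "real \<Rightarrow> real"
  assumes h: "continuous_on {-pi..pi} h" and even: "\<And>l. h (- l) = h l"
  shows "integral {-pi..pi} (\<lambda>l. cis (l * c) * of_real (h l)) =
    of_real (2 * integral {0..pi} (\<lambda>l. cos (l * c) * h l))"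
proof -
  let ?f = "\<lambda>l. cis (l * c) * of_real (h l)"
  have int: "?f integrable_on {-pi..pi}"
    by (intro integrable_continuous_interval continuous_intros h)
  have h0: "continuous_on {0..pi} h" by (rule continuous_on_subset[OF h]) auto
  have i1: "?f integrable_on {0..pi}"
    by (intro integrable_continuous_interval continuous_intros h0)
  have i2: "(\<lambda>l. ?f (- l)) integrable_on {0..pi}"
    unfolding even by (intro integrable_continuous_interval continuous_intros h0)
  have "integral {-pi..pi} ?f = integral {-pi..0} ?f + integral {0..pi} ?f"
    by (rule Henstock_Kurzweil_Integration.integral_combine[symmetric]) (use int in auto)
  also have "integral {-pi..0} ?f = integral {0..pi} (\<lambda>l. ?f (- l))"
    using Henstock_Kurzweil_Integration.integral_reflect_real[where a = "-pi" and b = 0 and f = ?f] by simp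
  also have "\<dots> + integral {0..pi} ?f = integral {0..pi} (\<lambda>l. ?f (- l) + ?f l)"
    by (rule integral_add[OF i2 i1, symmetric])
  also have "\<dots> = integral {0..pi} (\<lambda>l. of_real (2 * (cos (l * c) * h l)))"
    by (intro integral_cong) (simp add: even complex_eq_iff)
  also have "\<dots> = of_real (integral {0..pi} (\<lambda>l. 2 * (cos (l * c) * h l)))"
    by (intro integral_unique has_integral_of_real integrable_integral
        integrable_continuous_interval continuous_intros h0)
  finally show ?thesis by simp
qed

lemma integral_stretch_pi:
  fixes f :: "real \<Rightarrow> real"
  assumes m: "0 < m" and f: "continuous_on {0..pi} f"
  shows "integral {0..1 / m} (\<lambda>u. f (m * pi * u)) = 1 / (m * pi) * integral {0..pi} f"
proof -
  have "(f has_integral integral {0..pi} f) {0..pi}"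
    using integrable_integral[OF integrable_continuous_interval[OF f]] by simp
  from has_integral_stretch_real[OF this, of "m * pi"] m
  have "((\<lambda>u. f (m * pi * u)) has_integral 1 / (m * pi) * integral {0..pi} f) ((\<lambda>x. x / (m * pi)) ` {0..pi})"
    by simp
  also have "(\<lambda>x. x / (m * pi)) ` {0..pi} = {0..1 / m}"
    using m by (subst image_divide_atLeastAtMost) auto
  finally show ?thesis by (rule integral_unique)
qed

text \<open>With \<open>l = a pi u\<close> the surviving term is an integral over \<open>0 \<le> u \<le> 1 / a\<close>, and the
  transition probability is the same integral over \<open>0 \<le> u \<le> 1\<close>. For \<open>t < s\<close> their difference is
  the integral over \<open>1 / a \<le> u \<le> 1\<close> with a minus sign.\<close>
lemma limit_kernel_eq:
  fixes a :: nat
  assumes a: "0 < a"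
  shows "1 / (2 * of_real pi * of_nat a) * integral {-pi..pi} (\<lambda>l.
      cis (l * (of_int (x - y) / real a)) * of_real (exp ((t - s) * (1 - cos (l / real a)))))
    - (if t < s then of_real (srw_transition (s - t) x y) else 0) =
    of_real (exp (t - s) * extended_sine_kernel (1 / real a) (t - s) (x - y))"
proof -
  define d where "d = t - s"
  define z where "z = x - y"
  define g where "g u = cos (u * pi * of_int z) * exp (- d * cos (u * pi))" for u
  have cont_g: "continuous_on A g" for A unfolding g_def by (intro continuous_intros)
  have int_g: "g integrable_on {u..v}" for u v by (rule integrable_continuous_interval[OF cont_g])
  have scaled: "1 / (2 * of_real pi * of_real m) * integral {-pi..pi} (\<lambda>l.
      cis (l * (of_int z / m)) * of_real (exp (d * (1 - cos (l / m))))) =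
      of_real (exp d * integral {0..1 / m} g)" if m: "0 < m" for m
  proof -
    let ?f = "\<lambda>l. cos (l * (of_int z / m)) * exp (d * (1 - cos (l / m)))"
    have "integral {-pi..pi} (\<lambda>l. cis (l * (of_int z / m)) * of_real (exp (d * (1 - cos (l / m)))))
        = of_real (2 * integral {0..pi} ?f)"
      using m by (intro integral_cis_even continuous_intros) auto
    also have "integral {0..pi} ?f = m * pi * integral {0..1 / m} (\<lambda>u. ?f (m * pi * u))"
      using m by (subst integral_stretch_pi) (auto intro!: continuous_intros)
    also have "(\<lambda>u. ?f (m * pi * u)) = (\<lambda>u. exp d * g u)"
      using m by (auto simp: g_def fun_eq_iff exp_add[symmetric] algebra_simps)
    also have "integral {0..1 / m} (\<lambda>u. exp d * g u) = exp d * integral {0..1 / m} g"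
      by simp
    finally show ?thesis using m by simp
  qed
  have main: "1 / (2 * of_real pi * of_nat a) * integral {-pi..pi} (\<lambda>l.
      cis (l * (of_int (x - y) / real a)) * of_real (exp ((t - s) * (1 - cos (l / real a))))) =
      of_real (exp d * integral {0..1 / real a} g)"
    using scaled[of "real a"] a by (simp add: d_def z_def)
  show ?thesis
  proof (cases "t < s")
    case True
    have p: "of_real (srw_transition (s - t) x y) = (of_real (exp d * integral {0..1} g) :: complex)"
      using scaled[of 1] srw_transition_inversion[of "s - t" x y] by (simp add: d_def z_def)
    have "integral {0..1} g = integral {0..1 / real a} g + integral {1 / real a..1} g"
      using a by (intro Henstock_Kurzweil_Integration.integral_combine[symmetric] int_g) (auto simp: field_simps)
    then have "exp d * integral {0..1 / real a} g - exp d * integral {0..1} g =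
        exp d * - integral {1 / real a..1} g"
      by (simp add: algebra_simps)
    moreover have "extended_sine_kernel (1 / real a) (t - s) (x - y) = - integral {1 / real a..1} g"
      using True unfolding extended_sine_kernel_def g_def d_def z_def by simp
    ultimately show ?thesis using True main p
      by (simp only: if_True of_real_diff[symmetric] d_def)
  next
    case False
    have "integral {0..1 / real a} g = extended_sine_kernel (1 / real a) (t - s) (x - y)"
    proof (cases "t = s")
      case True
      have "(g has_integral sine_kernel (1 / real a) z) {0..1 / real a}"
      proof (cases "z = 0")
        case True
        then show ?thesis
          using \<open>t = s\<close> has_integral_const_real[of "1::real" 0 "1 / real a"] by (simp add: g_def[abs_def] d_def sine_kernel_def)
      next
        case False
        have "((\<lambda>u. cos (u * pi * of_int z)) has_integral
          (sin (1 / real a * pi * of_int z) / (pi * of_int z) - sin (0 * pi * of_int z) / (pi * of_int z))) {0..1 / real a}"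
          by (rule fundamental_theorem_of_calculus)
            (use False in \<open>auto intro!: derivative_eq_intros simp flip: has_real_derivative_iff_has_vector_derivative\<close>)
        then show ?thesis
          using \<open>t = s\<close> False by (simp add: g_def[abs_def] d_def sine_kernel_def)
      qed
      then show ?thesis
        using True by (simp add: extended_sine_kernel_def integral_unique z_def)
    next
      case 2: False
      then show ?thesis
        using False unfolding extended_sine_kernel_def g_def d_def z_def by simp
    qed
    then show ?thesis using False main by (simp add: d_def)
  qed
qed

section \<open>Multiplicative path weights and the Markov property\<close>

text \<open>The multiplicative functional \<open>\<Prod>b. z b ^ \<Xi>(b)\<close> of the configuration with a single particle
  following the path \<open>f\<close>; the pairs in \<open>B\<close> consist of a time and a site.\<close>
definition path_weight :: "(real \<times> int \<Rightarrow> real) \<Rightarrow> (real \<times> int) set \<Rightarrow> (real \<Rightarrow> int) \<Rightarrow> real" where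
  "path_weight z B f = (\<Prod>b\<in>B. if f (fst b) = snd b then z b else 1)"

text \<open>Expand the product in the order of time. Two points with the same time cannot both lie on
  the path, hence the weight in front of the factor \<open>b\<close> only involves strictly
  earlier points.\<close>
lemma path_weight_telescope:
  assumes "finite B"
  shows "path_weight z B f = 1 + (\<Sum>b\<in>B. path_weight z {c\<in>B. fst c < fst b} f * (z b - 1) *
    of_bool (f (fst b) = snd b))"
  using assms
proof (induction B rule: finite_ranking_induct[where f = fst])
  case empty
  show ?case by (simp add: path_weight_def)
next
  case (insert b B)
  show ?case
  proof (cases "b \<in> B")
    case True
    then show ?thesis using insert.IH by (simp add: insert_absorb)
  next
    case False
    let ?i = "of_bool (f (fst b) = snd b) :: real"
    have old: "{c \<in> insert b B. fst c < fst d} = {c \<in> B. fst c < fst d}" if "d \<in> insert b B" for d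
    proof -
      have "fst d \<le> fst b" using insert.hyps(2) that by (metis insertE order_refl)
      then show ?thesis by auto
    qed
    have "path_weight z B f * ?i = path_weight z {c\<in>B. fst c < fst b} f * ?i"
    proof (cases "f (fst b) = snd b")
      case True
      have "path_weight z B f = path_weight z {c\<in>B. fst c < fst b} f"
        unfolding path_weight_def
      proof (rule prod.mono_neutral_right)
        show "\<forall>i\<in>B - {c \<in> B. fst c < fst b}. (if f (fst i) = snd i then z i else 1) = 1"
          using True False insert.hyps(2) by (auto simp: prod_eq_iff) (metis prod.collapse order_antisym_conv not_less fst_conv snd_conv)
      qed (use insert.hyps in auto)
      then show ?thesis by simp
    qed simp
    moreover have "path_weight z (insert b B) f = path_weight z B f + (z b - 1) * (path_weight z B f * ?i)"
      using False insert.hyps(1) by (simp add: path_weight_def algebra_simps)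
    ultimately have "path_weight z (insert b B) f = path_weight z B f + path_weight z {c\<in>B. fst c < fst b} f * (z b - 1) * ?i"
      by simp
    also have "\<dots> = 1 + (\<Sum>d\<in>insert b B. path_weight z {c\<in>B. fst c < fst d} f * (z d - 1) *
        of_bool (f (fst d) = snd d))"
      using False insert.hyps(1) insert.IH by simp
    also have "\<dots> = 1 + (\<Sum>d\<in>insert b B. path_weight z {c\<in>insert b B. fst c < fst d} f * (z d - 1) *
        of_bool (f (fst d) = snd d))"
      by (intro arg_cong2[where f="(+)"] refl sum.cong) (simp_all only: old)
    finally show ?thesis .
  qed
qed

lemma path_weight_bound: "finite B \<Longrightarrow> \<bar>path_weight z B f\<bar> \<le> (\<Prod>b\<in>B. \<bar>z b\<bar> + 1)"
  unfolding path_weight_def abs_prod by (intro prod_mono) auto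

locale simple_random_walk = prob_space W for W :: "'v measure" +
  fixes X :: "real \<Rightarrow> 'v \<Rightarrow> int" and x0 :: int
  assumes walk: "srw_from W X x0"
begin

lemma X_measurable: "0 \<le> t \<Longrightarrow> X t \<in> measurable W (count_space UNIV)"
  using walk by (auto simp: srw_from_def)

lemma X_fdd:
  assumes "t 0 = 0" "mono_on {..n} t" "x 0 = x0"
  shows "measure W {\<omega> \<in> space W. \<forall>i\<le>n. X (t i) \<omega> = x i} =
        (\<Prod>i<n. srw_transition (t (Suc i) - t i) (x i) (x (Suc i)))"
  using walk assms unfolding srw_from_def by blast

lemma X_eq_sets: "0 \<le> t \<Longrightarrow> {\<omega> \<in> space W. X t \<omega> = y} \<in> sets W"
  using measurable_sets[OF X_measurable, of t "{y}"] by (simp add: vimage_def Int_def conj_commute)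

lemma AE_start: "AE \<omega> in W. X 0 \<omega> = x0"
proof -
  have "measure W {\<omega> \<in> space W. X 0 \<omega> = x0} = 1"
    using X_fdd[of "\<lambda>_. 0" 0 "\<lambda>_. x0"] by (simp add: mono_on_def)
  then show ?thesis
    using X_eq_sets[of 0 x0] by (subst prob_Collect_eq_1[symmetric]) auto
qed

lemma hit_sets:
  assumes "finite C" "C \<subseteq> {0..} \<times> UNIV"
  shows "{\<omega> \<in> space W. \<forall>b\<in>C. X (fst b) \<omega> = snd b} \<in> sets W"
  using assms by (intro sets.sets_Collect_finite_All X_eq_sets) auto

text \<open>If \<open>C\<close> prescribes two different positions at one time, both sides vanish. Otherwise its
  points, sorted by time, form a sequence to which the finite-dimensional distributions apply, with or without
  the additional point \<open>(u, w)\<close>.\<close>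
lemma measure_cylinder_extend_aux:
  assumes C: "finite C" "C \<subseteq> {0..s} \<times> UNIV" "(s, y) \<in> C" "(0, x0) \<in> C" and u: "s \<le> u"
  shows "measure W {\<omega> \<in> space W. (\<forall>b\<in>C. X (fst b) \<omega> = snd b) \<and> X u \<omega> = w} =
    measure W {\<omega> \<in> space W. \<forall>b\<in>C. X (fst b) \<omega> = snd b} * srw_transition (u - s) y w"
proof (cases "inj_on fst C")
  case False
  then obtain b c where "b \<in> C" "c \<in> C" "fst b = fst c" "b \<noteq> c" by (auto simp: inj_on_def)
  then have no: "\<not> (\<forall>b\<in>C. X (fst b) \<omega> = snd b)" for \<omega>
    by (metis prod_eq_iff)
  show ?thesis by (simp add: no)
next
  case True
  define v where "v r = snd (the_inv_into C fst r)" for r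
  have v: "v (fst b) = snd b" if "b \<in> C" for b
    using True that by (simp add: v_def the_inv_into_f_f)
  define ts where "ts = sorted_list_of_set (fst ` C)"
  have ts: "set ts = fst ` C" "sorted_wrt (<) ts"
    using C(1) by (auto simp: ts_def)
  have len: "0 < length ts" using ts(1) C(3) by (cases ts) auto
  define n where "n = length ts - 1"
  have idx: "i < length ts \<longleftrightarrow> i \<le> n" for i using len unfolding n_def by linarith
  have mono: "ts ! i \<le> ts ! j" if "i \<le> j" "j \<le> n" for i j
    using sorted_wrt_nth_less[OF ts(2), of i j] that len by (cases "i = j") (auto simp: n_def intro!: less_imp_le)
  have rng: "ts ! i \<in> {0..s}" if "i \<le> n" for i
  proof -
    have "i < length ts" using that len unfolding n_def by linarith
    then have "ts ! i \<in> set ts" by (rule nth_mem)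
    then show ?thesis using ts(1) C(2) by auto
  qed
  have "0 \<in> set ts" using ts(1) C(4) by force
  then obtain i where "ts ! i = 0" "i \<le> n" unfolding in_set_conv_nth idx by blast
  then have first: "ts ! 0 = 0" using mono[of 0 i] rng[of 0] by auto
  have "s \<in> set ts" using ts(1) C(3) by force
  then obtain i where "ts ! i = s" "i \<le> n" unfolding in_set_conv_nth idx by blast
  then have last: "ts ! n = s" using mono[of i n] rng[of n] by auto
  have hit: "(\<forall>i\<le>n. X (ts ! i) \<omega> = v (ts ! i)) \<longleftrightarrow> (\<forall>b\<in>C. X (fst b) \<omega> = snd b)" for \<omega>
  proof -
    have "(\<forall>i\<le>n. X (ts ! i) \<omega> = v (ts ! i)) \<longleftrightarrow> (\<forall>r\<in>set ts. X r \<omega> = v r)"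
      unfolding all_set_conv_all_nth idx by blast
    also have "\<dots> \<longleftrightarrow> (\<forall>b\<in>C. X (fst b) \<omega> = snd b)"
      by (simp add: ts(1) v)
    finally show ?thesis .
  qed
  have v0: "v 0 = x0" "v s = y" using v[OF C(3)] v[OF C(4)] by auto
  have "measure W {\<omega> \<in> space W. \<forall>i\<le>n. X (ts ! i) \<omega> = v (ts ! i)} =
      (\<Prod>i<n. srw_transition (ts ! Suc i - ts ! i) (v (ts ! i)) (v (ts ! Suc i)))"
    by (rule X_fdd) (auto simp: first v0 mono_on_def mono)
  then have 1: "measure W {\<omega> \<in> space W. \<forall>b\<in>C. X (fst b) \<omega> = snd b} =
      (\<Prod>i<n. srw_transition (ts ! Suc i - ts ! i) (v (ts ! i)) (v (ts ! Suc i)))"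
    by (simp only: hit)
  define t where "t i = (if i \<le> n then ts ! i else u)" for i
  define x where "x i = (if i \<le> n then v (ts ! i) else w)" for i
  have "measure W {\<omega> \<in> space W. \<forall>i\<le>Suc n. X (t i) \<omega> = x i} =
      (\<Prod>i<Suc n. srw_transition (t (Suc i) - t i) (x i) (x (Suc i)))"
  proof (rule X_fdd)
    show "mono_on {..Suc n} t"
    proof (rule mono_onI)
      fix i j assume "i \<in> {..Suc n}" "j \<in> {..Suc n}" "i \<le> j"
      then show "t i \<le> t j" using mono[of i j] rng[of i] u by (auto simp: t_def)
    qed
  qed (auto simp: t_def x_def first v0)
  moreover have "(\<forall>i\<le>Suc n. X (t i) \<omega> = x i) \<longleftrightarrow> (\<forall>b\<in>C. X (fst b) \<omega> = snd b) \<and> X u \<omega> = w" for \<omega>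
    unfolding hit[symmetric] by (auto simp: t_def x_def le_Suc_eq)
  ultimately have "measure W {\<omega> \<in> space W. (\<forall>b\<in>C. X (fst b) \<omega> = snd b) \<and> X u \<omega> = w} =
     (\<Prod>i<n. srw_transition (t (Suc i) - t i) (x i) (x (Suc i))) * srw_transition (u - s) y w"
    by (simp add: t_def x_def last v0)
  also have "(\<Prod>i<n. srw_transition (t (Suc i) - t i) (x i) (x (Suc i))) =
      (\<Prod>i<n. srw_transition (ts ! Suc i - ts ! i) (v (ts ! i)) (v (ts ! Suc i)))"
    by (intro prod.cong) (auto simp: t_def x_def)
  finally show ?thesis using 1 by simp
qed

lemma measure_cylinder_extend:
  assumes C: "finite C" "C \<subseteq> {0..s} \<times> UNIV" and s: "0 \<le> s" "s \<le> u"
  shows "measure W {\<omega> \<in> space W. (\<forall>b\<in>C. X (fst b) \<omega> = snd b) \<and> X s \<omega> = y \<and> X u \<omega> = w} =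
    measure W {\<omega> \<in> space W. (\<forall>b\<in>C. X (fst b) \<omega> = snd b) \<and> X s \<omega> = y} * srw_transition (u - s) y w"
proof -
  \<comment> \<open>The starting point is added since the distributions refer to sequences that start at time \<open>0\<close>;
    almost surely this changes nothing.\<close>
  let ?C = "insert (0, x0) (insert (s, y) C)"
  have C': "finite ?C" "?C \<subseteq> {0..s} \<times> UNIV" using C s by auto
  have sets1: "{\<omega> \<in> space W. \<forall>b\<in>?C. X (fst b) \<omega> = snd b} \<in> sets W"
    using C' by (intro hit_sets) auto
  have sets1': "{\<omega> \<in> space W. (\<forall>b\<in>C. X (fst b) \<omega> = snd b) \<and> X s \<omega> = y} \<in> sets W"
    using hit_sets[of "insert (s, y) C"] C s by (auto simp: conj_commute subset_iff)
  have "{\<omega> \<in> space W. (\<forall>b\<in>?C. X (fst b) \<omega> = snd b) \<and> X u \<omega> = w} \<in> sets W"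
    using s sets1 by (intro sets.sets_Collect_conj X_eq_sets) auto
  moreover have "{\<omega> \<in> space W. (\<forall>b\<in>C. X (fst b) \<omega> = snd b) \<and> X s \<omega> = y \<and> X u \<omega> = w} \<in> sets W"
    using hit_sets[of "insert (u, w) (insert (s, y) C)"] C s
    by (auto simp: subset_iff conj_commute conj_left_commute)
  ultimately have "measure W {\<omega> \<in> space W. (\<forall>b\<in>C. X (fst b) \<omega> = snd b) \<and> X s \<omega> = y \<and> X u \<omega> = w} =
      measure W {\<omega> \<in> space W. (\<forall>b\<in>?C. X (fst b) \<omega> = snd b) \<and> X u \<omega> = w}"
    using AE_start by (intro measure_eq_AE) auto
  also have "\<dots> = measure W {\<omega> \<in> space W. \<forall>b\<in>?C. X (fst b) \<omega> = snd b} * srw_transition (u - s) y w"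
    using C' s by (intro measure_cylinder_extend_aux) auto
  also have "measure W {\<omega> \<in> space W. \<forall>b\<in>?C. X (fst b) \<omega> = snd b} =
      measure W {\<omega> \<in> space W. (\<forall>b\<in>C. X (fst b) \<omega> = snd b) \<and> X s \<omega> = y}"
    using AE_start sets1 sets1' by (intro measure_eq_AE) auto
  finally show ?thesis .
qed

lemma hit_measurable:
  "0 \<le> t \<Longrightarrow> (\<lambda>\<omega>. of_bool (X t \<omega> = y) :: 'b::{topological_space,zero_neq_one}) \<in> borel_measurable W"
  by (rule measurable_compose[OF X_measurable, where g = "\<lambda>x. of_bool (x = y)"]) auto

lemma path_weight_measurable:
  assumes "B \<subseteq> {0..} \<times> UNIV"
  shows "(\<lambda>\<omega>. path_weight z B (\<lambda>r. X r \<omega>)) \<in> borel_measurable W"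
  unfolding path_weight_def
proof (rule borel_measurable_prod)
  fix b assume "b \<in> B"
  with assms have "0 \<le> fst b" by auto
  then show "(\<lambda>\<omega>. if X (fst b) \<omega> = snd b then z b else 1) \<in> borel_measurable W"
    by (intro measurable_compose[OF X_measurable, where g = "\<lambda>x. if x = snd b then z b else 1"]) auto
qed

lemma path_weight_of_real_measurable:
  assumes "B \<subseteq> {0..} \<times> UNIV"
  shows "(\<lambda>\<omega>. of_real (path_weight z B (\<lambda>r. X r \<omega>)) :: 'b::{real_normed_algebra_1})
    \<in> borel_measurable W"
  by (rule measurable_compose[OF path_weight_measurable[OF assms]])
    (intro borel_measurable_continuous_onI continuous_intros)

lemma hits_measurable:
  assumes "finite C" "C \<subseteq> {0..} \<times> UNIV"
  shows "(\<lambda>\<omega>. of_bool (\<forall>b\<in>C. X (fst b) \<omega> = snd b) :: real) \<in> borel_measurable W"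
  using hit_sets[OF assms] by (simp add: of_bool_def)

lemma path_weight_integrable:
  fixes g :: "'v \<Rightarrow> 'b::{banach, second_countable_topology, real_normed_algebra_1}"
  assumes B: "finite B" "B \<subseteq> {0..} \<times> UNIV"
    and g: "g \<in> borel_measurable W" "\<And>\<omega>. norm (g \<omega>) \<le> K"
  shows "integrable W (\<lambda>\<omega>. of_real (path_weight z B (\<lambda>r. X r \<omega>)) * g \<omega>)"
proof (rule integrable_const_bound)
  show "AE \<omega> in W. norm (of_real (path_weight z B (\<lambda>r. X r \<omega>)) * g \<omega>) \<le> (\<Prod>b\<in>B. \<bar>z b\<bar> + 1) * K"
  proof (rule AE_I2)
    fix \<omega>
    have "norm (of_real (path_weight z B (\<lambda>r. X r \<omega>)) * g \<omega>) \<le>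
        norm (of_real (path_weight z B (\<lambda>r. X r \<omega>)) :: 'b) * norm (g \<omega>)"
      by (rule norm_mult_ineq)
    also have "\<dots> \<le> (\<Prod>b\<in>B. \<bar>z b\<bar> + 1) * K"
      using path_weight_bound[OF B(1), of z] g(2) by (intro mult_mono prod_nonneg) auto
    finally show "norm (of_real (path_weight z B (\<lambda>r. X r \<omega>)) * g \<omega>) \<le> (\<Prod>b\<in>B. \<bar>z b\<bar> + 1) * K" .
  qed
next
  show "(\<lambda>\<omega>. of_real (path_weight z B (\<lambda>r. X r \<omega>)) * g \<omega>) \<in> borel_measurable W"
    by (intro borel_measurable_times path_weight_of_real_measurable B g)
qed

text \<open>The induction replaces the factor of a point \<open>b\<close> of \<open>B\<close> by \<open>1 + (z b - 1) * indicator\<close> and moves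
  the indicator to the cylinder event \<open>C\<close>. No expansion into all paths is needed, as every factor is
  constant outside one site.\<close>
lemma expectation_weight_step:
  assumes B: "finite B" "B \<subseteq> {0..s} \<times> UNIV" and s: "0 \<le> s" "s \<le> u"
    and C: "finite C" "C \<subseteq> {0..s} \<times> UNIV"
  shows "(\<integral>\<omega>. path_weight z B (\<lambda>r. X r \<omega>) * (of_bool (\<forall>b\<in>C. X (fst b) \<omega> = snd b) *
       of_bool (X s \<omega> = y) * of_bool (X u \<omega> = w)) \<partial>W) =
     (\<integral>\<omega>. path_weight z B (\<lambda>r. X r \<omega>) * (of_bool (\<forall>b\<in>C. X (fst b) \<omega> = snd b) *
       of_bool (X s \<omega> = y)) \<partial>W) * srw_transition (u - s) y w"
  using B C
proof (induction B arbitrary: C rule: finite_induct)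
  case empty
  have "(\<integral>\<omega>. (of_bool (\<forall>b\<in>C. X (fst b) \<omega> = snd b) :: real) * of_bool (X s \<omega> = y) * of_bool (X u \<omega> = w) \<partial>W) =
     (\<integral>\<omega>. indicator {\<omega> \<in> space W. (\<forall>b\<in>C. X (fst b) \<omega> = snd b) \<and> X s \<omega> = y \<and> X u \<omega> = w} \<omega> \<partial>W)"
    by (intro Bochner_Integration.integral_cong) (auto simp: indicator_def of_bool_def)
  also have "\<dots> = measure W {\<omega> \<in> space W. (\<forall>b\<in>C. X (fst b) \<omega> = snd b) \<and> X s \<omega> = y} * srw_transition (u - s) y w"
    using measure_cylinder_extend[OF empty(2,3) s]
    by (simp add: Int_absorb2 Collect_conj_eq Int_commute)
  also have "measure W {\<omega> \<in> space W. (\<forall>b\<in>C. X (fst b) \<omega> = snd b) \<and> X s \<omega> = y} =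
      (\<integral>\<omega>. indicator {\<omega> \<in> space W. (\<forall>b\<in>C. X (fst b) \<omega> = snd b) \<and> X s \<omega> = y} \<omega> \<partial>W)"
    by (simp add: Int_absorb2 Collect_conj_eq Int_commute)
  also have "\<dots> = (\<integral>\<omega>. (of_bool (\<forall>b\<in>C. X (fst b) \<omega> = snd b) :: real) * of_bool (X s \<omega> = y) \<partial>W)"
    by (intro Bochner_Integration.integral_cong) (auto simp: indicator_def of_bool_def)
  finally show ?case by (simp add: path_weight_def)
next
  case (insert b B)
  let ?w = "\<lambda>\<omega>. path_weight z B (\<lambda>r. X r \<omega>)"
  let ?h = "\<lambda>C \<omega>. of_bool (\<forall>b\<in>C. X (fst b) \<omega> = snd b) :: real"
  have b: "0 \<le> fst b" "fst b \<le> s" using insert.prems(1) by auto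
  have C: "finite (insert b C)" "insert b C \<subseteq> {0..s} \<times> UNIV"
    using insert.prems by auto
  have split: "path_weight z (insert b B) (\<lambda>r. X r \<omega>) * (?h C \<omega> * g) =
      ?w \<omega> * (?h C \<omega> * g) + (z b - 1) * (?w \<omega> * (?h (insert b C) \<omega> * g))" for \<omega> g
    using insert.hyps by (auto simp: path_weight_def algebra_simps)
  have pos: "B \<subseteq> {0..} \<times> UNIV" and posC: "C \<subseteq> {0..} \<times> UNIV" "insert b C \<subseteq> {0..} \<times> UNIV"
    using insert.prems C by auto
  have meas: "?h C \<in> borel_measurable W" "?h (insert b C) \<in> borel_measurable W"
    "(\<lambda>\<omega>. of_bool (X s \<omega> = y) :: real) \<in> borel_measurable W"
    "(\<lambda>\<omega>. of_bool (X u \<omega> = w) :: real) \<in> borel_measurable W"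
    using hits_measurable[OF insert.prems(2) posC(1)] hits_measurable[OF C(1) posC(2)] s
    by (auto intro!: hit_measurable)
  have int: "integrable W (\<lambda>\<omega>. ?w \<omega> * (?h D \<omega> * g \<omega>))"
    if "D = C \<or> D = insert b C" "g \<in> borel_measurable W" "\<And>\<omega>. \<bar>g \<omega>\<bar> \<le> 1" for g :: "'v \<Rightarrow> real" and D
    using path_weight_integrable[OF insert.hyps(1) pos, of "\<lambda>\<omega>. ?h D \<omega> * g \<omega>" 1 z] that meas
    by (auto simp: abs_mult of_bool_def mult_le_one)
  have lin: "(\<integral>\<omega>. path_weight z (insert b B) (\<lambda>r. X r \<omega>) * (?h C \<omega> * g \<omega>) \<partial>W) =
      (\<integral>\<omega>. ?w \<omega> * (?h C \<omega> * g \<omega>) \<partial>W) + (z b - 1) * (\<integral>\<omega>. ?w \<omega> * (?h (insert b C) \<omega> * g \<omega>) \<partial>W)"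
    if "g \<in> borel_measurable W" "\<And>\<omega>. \<bar>g \<omega>\<bar> \<le> 1" for g :: "'v \<Rightarrow> real"
  proof -
    have "integrable W (\<lambda>\<omega>. ?w \<omega> * (?h C \<omega> * g \<omega>))" "integrable W (\<lambda>\<omega>. ?w \<omega> * (?h (insert b C) \<omega> * g \<omega>))"
      by (rule int[OF _ that], simp)+
    then show ?thesis
      unfolding split
      by (simp only: Bochner_Integration.integral_add integrable_mult_right integral_mult_right_zero)
  qed
  have g: "(\<lambda>\<omega>. of_bool (X s \<omega> = y) * of_bool (X u \<omega> = w) :: real) \<in> borel_measurable W"
    "\<And>\<omega>. \<bar>of_bool (X s \<omega> = y) * of_bool (X u \<omega> = w) :: real\<bar> \<le> 1"
    "\<And>\<omega>. \<bar>of_bool (X s \<omega> = y) :: real\<bar> \<le> 1"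
    using meas by auto
  have sub: "B \<subseteq> {0..s} \<times> UNIV" using insert.prems by auto
  note IH = insert.IH[OF sub insert.prems(2,3)] insert.IH[OF sub C]
  show ?case
    unfolding mult.assoc lin[OF g(1,2)] lin[OF meas(3) g(3)]
    using IH by (simp only: mult.assoc distrib_right)
qed

text \<open>Markov property at time \<open>s\<close> for functionals of the past of product form.\<close>
lemma markov_hit:
  assumes "finite B" "B \<subseteq> {0..s} \<times> UNIV" "0 \<le> s" "s \<le> u"
  shows "(\<integral>\<omega>. path_weight z B (\<lambda>r. X r \<omega>) * (of_bool (X s \<omega> = y) * of_bool (X u \<omega> = w)) \<partial>W) =
     (\<integral>\<omega>. path_weight z B (\<lambda>r. X r \<omega>) * of_bool (X s \<omega> = y) \<partial>W) * srw_transition (u - s) y w"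
  using expectation_weight_step[OF assms, of "{}" z y w] by simp

lemma markov_limit:
  fixes h :: "int \<Rightarrow> complex"
  assumes B: "finite B" "B \<subseteq> {0..s} \<times> UNIV" and s: "0 \<le> s" "s \<le> u" and h: "\<And>w. norm (h w) \<le> K"
  shows "(\<lambda>n. of_real (\<integral>\<omega>. path_weight z B (\<lambda>r. X r \<omega>) * of_bool (X s \<omega> = y) \<partial>W) *
       (\<Sum>w\<in>{-int n..int n}. of_real (srw_transition (u - s) y w) * h w)) \<longlonglongrightarrow>
     (\<integral>\<omega>. of_real (path_weight z B (\<lambda>r. X r \<omega>)) * (of_bool (X s \<omega> = y) * h (X u \<omega>)) \<partial>W)"
proof -
  let ?w = "\<lambda>\<omega>. path_weight z B (\<lambda>r. X r \<omega>)"
  define f where "f n \<omega> = of_real (?w \<omega>) * (of_bool (X s \<omega> = y) * (if \<bar>X u \<omega>\<bar> \<le> int n then h (X u \<omega>) else 0))"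
    for n :: nat and \<omega>
  have pos: "B \<subseteq> {0..} \<times> UNIV" using B by auto
  have K: "0 \<le> K" using h[of 0] norm_ge_zero order_trans by blast
  have f_eq: "f n \<omega> = (\<Sum>w\<in>{-int n..int n}. h w * of_real (?w \<omega> * (of_bool (X s \<omega> = y) * of_bool (X u \<omega> = w))))" for n \<omega>
  proof -
    have "(\<Sum>w\<in>{-int n..int n}. h w * of_real (?w \<omega> * (of_bool (X s \<omega> = y) * of_bool (X u \<omega> = w)))) =
       (\<Sum>w\<in>{-int n..int n}. if w = X u \<omega> then h w * of_real (?w \<omega> * of_bool (X s \<omega> = y)) else 0)"
      by (intro sum.cong) auto
    then show ?thesis by (auto simp: f_def sum.delta)
  qed
  have int: "integrable W (\<lambda>\<omega>. ?w \<omega> * (of_bool (X s \<omega> = y) * of_bool (X u \<omega> = w)))" for w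
    using path_weight_integrable[OF B(1) pos, of "\<lambda>\<omega>. of_bool (X s \<omega> = y) * of_bool (X u \<omega> = w) :: real" 1 z]
      hit_measurable[of s y, where 'b = real] hit_measurable[of u w, where 'b = real] s by auto
  have int_f: "(\<integral>\<omega>. f n \<omega> \<partial>W) = of_real (\<integral>\<omega>. ?w \<omega> * of_bool (X s \<omega> = y) \<partial>W) *
       (\<Sum>w\<in>{-int n..int n}. of_real (srw_transition (u - s) y w) * h w)" for n
  proof -
    have "(\<integral>\<omega>. f n \<omega> \<partial>W) = (\<Sum>w\<in>{-int n..int n}. h w *
        of_real (\<integral>\<omega>. ?w \<omega> * (of_bool (X s \<omega> = y) * of_bool (X u \<omega> = w)) \<partial>W))"
      unfolding f_eq using int
      by (subst Bochner_Integration.integral_sum)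
        (auto intro!: integrable_mult_right simp del: of_real_mult)
    then show ?thesis
      unfolding markov_hit[OF B s] by (simp add: sum_distrib_left sum_distrib_right mult_ac)
  qed
  have mh: "(\<lambda>\<omega>. g (X u \<omega>)) \<in> borel_measurable W" for g :: "int \<Rightarrow> complex"
    using s by (intro measurable_compose[OF X_measurable]) auto
  have "(\<lambda>n. \<integral>\<omega>. f n \<omega> \<partial>W) \<longlonglongrightarrow> (\<integral>\<omega>. of_real (?w \<omega>) * (of_bool (X s \<omega> = y) * h (X u \<omega>)) \<partial>W)"
  proof (rule integral_dominated_convergence)
    show "(\<lambda>\<omega>. of_real (?w \<omega>) * (of_bool (X s \<omega> = y) * h (X u \<omega>))) \<in> borel_measurable W"
      using s pos by (intro borel_measurable_times path_weight_of_real_measurable hit_measurable mh) auto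
    show "f n \<in> borel_measurable W" for n
      unfolding f_def using s pos mh[of "\<lambda>x. if \<bar>x\<bar> \<le> int n then h x else 0"]
      by (intro borel_measurable_times path_weight_of_real_measurable hit_measurable) auto
    show "integrable W (\<lambda>_. (\<Prod>b\<in>B. \<bar>z b\<bar> + 1) * (1 * K))" by simp
    show "AE \<omega> in W. (\<lambda>n. f n \<omega>) \<longlonglongrightarrow> of_real (?w \<omega>) * (of_bool (X s \<omega> = y) * h (X u \<omega>))"
    proof (rule AE_I2)
      fix \<omega>
      have "\<forall>\<^sub>F n in sequentially. f n \<omega> = of_real (?w \<omega>) * (of_bool (X s \<omega> = y) * h (X u \<omega>))"
        by (rule eventually_sequentiallyI[of "nat \<bar>X u \<omega>\<bar>"]) (auto simp: f_def)
      then show "(\<lambda>n. f n \<omega>) \<longlonglongrightarrow> of_real (?w \<omega>) * (of_bool (X s \<omega> = y) * h (X u \<omega>))"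
        by (rule tendsto_eventually)
    qed
    show "AE \<omega> in W. norm (f n \<omega>) \<le> (\<Prod>b\<in>B. \<bar>z b\<bar> + 1) * (1 * K)" for n
    proof (rule AE_I2)
      fix \<omega>
      show "norm (f n \<omega>) \<le> (\<Prod>b\<in>B. \<bar>z b\<bar> + 1) * (1 * K)"
        unfolding f_def norm_mult
        using path_weight_bound[OF B(1), of z] h K by (intro mult_mono prod_nonneg) auto
    qed
  qed
  then show ?thesis unfolding int_f .
qed

text \<open>The martingale property of \<open>M_hat\<close> for such functionals of the past.\<close>
lemma markov_M_hat:
  assumes B: "finite B" "B \<subseteq> {0..s} \<times> UNIV" and s: "0 \<le> s" "s \<le> u" and a: "0 < a"
  shows "(\<integral>\<omega>. of_real (path_weight z B (\<lambda>r. X r \<omega>)) * (of_bool (X s \<omega> = y) * M_hat a k u (X u \<omega>)) \<partial>W) =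
     of_real (\<integral>\<omega>. path_weight z B (\<lambda>r. X r \<omega>) * of_bool (X s \<omega> = y) \<partial>W) * M_hat a k s y"
proof -
  obtain K where K: "\<And>w. norm (M_hat a k u w) \<le> K" using M_hat_bounded[OF a] by blast
  have "(\<lambda>n. of_real (\<integral>\<omega>. path_weight z B (\<lambda>r. X r \<omega>) * of_bool (X s \<omega> = y) \<partial>W) *
       (\<Sum>w\<in>{-int n..int n}. of_real (srw_transition (u - s) y w) * M_hat a k u w)) \<longlonglongrightarrow>
     of_real (\<integral>\<omega>. path_weight z B (\<lambda>r. X r \<omega>) * of_bool (X s \<omega> = y) \<partial>W) * M_hat a k (u - (u - s)) y"
    by (rule tendsto_mult_left[OF srw_transition_M_hat[OF a]])
  from LIMSEQ_unique[OF markov_limit[OF B s K] this] show ?thesis by simp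
qed

text \<open>The vectors \<open>A j\<close> of the linear system: the weight counts only times strictly before that of \<open>b\<close>.\<close>
definition weighted_hit :: "(real \<times> int \<Rightarrow> real) \<Rightarrow> (real \<times> int) set \<Rightarrow> real \<times> int \<Rightarrow> real" where
  "weighted_hit z B b = (\<integral>\<omega>. path_weight z {c\<in>B. fst c < fst b} (\<lambda>r. X r \<omega>) * of_bool (X (fst b) \<omega> = snd b) \<partial>W)"

lemma expectation_start:
  fixes g :: "'v \<Rightarrow> 'b::{banach, second_countable_topology, real_normed_algebra_1}"
  assumes "g \<in> borel_measurable W"
  shows "(\<integral>\<omega>. of_bool (X 0 \<omega> = x0) * g \<omega> \<partial>W) = (\<integral>\<omega>. g \<omega> \<partial>W)"
  using AE_start assms hit_measurable[of 0 x0, where 'b = 'b] by (intro integral_cong_AE) auto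

text \<open>Expanding the weight of the strictly earlier points gives a system that is triangular in
  time; its solution is \<open>A = p + A (z - 1) P\<close> in matrix form.\<close>
lemma weighted_hit_eq:
  assumes B: "finite B" "B \<subseteq> {0..} \<times> UNIV" and b: "b \<in> B"
  shows "weighted_hit z B b = srw_transition (fst b) x0 (snd b) +
    (\<Sum>c\<in>{c\<in>B. fst c < fst b}. weighted_hit z B c * (z c - 1) * srw_transition (fst b - fst c) (snd c) (snd b))"
proof -
  let ?B = "{c\<in>B. fst c < fst b}"
  have b0: "0 \<le> fst b" using B b by auto
  have fin: "finite ?B" using B by auto
  let ?w = "\<lambda>c \<omega>. path_weight z {d\<in>B. fst d < fst c} (\<lambda>r. X r \<omega>)"
  let ?i = "\<lambda>c \<omega>. of_bool (X (fst c) \<omega> = snd c) :: real"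
  have eq: "?w b \<omega> * ?i b \<omega> = ?i b \<omega> + (\<Sum>c\<in>?B. (z c - 1) * (?w c \<omega> * (?i c \<omega> * ?i b \<omega>)))" for \<omega>
  proof -
    have "?w b \<omega> = 1 + (\<Sum>c\<in>?B. path_weight z {d\<in>?B. fst d < fst c} (\<lambda>r. X r \<omega>) * (z c - 1) * ?i c \<omega>)"
      by (rule path_weight_telescope[OF fin])
    also have "\<dots> = 1 + (\<Sum>c\<in>?B. ?w c \<omega> * (z c - 1) * ?i c \<omega>)"
      by (intro arg_cong2[where f="(+)"] refl sum.cong)
        (auto intro!: arg_cong[where f="\<lambda>S. path_weight z S _"])
    finally show ?thesis by (simp add: algebra_simps sum_distrib_left)
  qed
  have int: "integrable W (\<lambda>\<omega>. ?w c \<omega> * (?i c \<omega> * ?i b \<omega>))" if "c \<in> ?B" for c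
  proof -
    have "(\<lambda>\<omega>. ?i c \<omega> * ?i b \<omega>) \<in> borel_measurable W"
      using B b0 that by (intro borel_measurable_times hit_measurable) auto
    then show ?thesis
      using path_weight_integrable[of "{d\<in>B. fst d < fst c}" "\<lambda>\<omega>. ?i c \<omega> * ?i b \<omega>" 1 z] B
      by (auto simp: subset_iff)
  qed
  have int_b: "integrable W (?i b)"
    using b0 by (intro integrable_const_bound[of _ 1] hit_measurable) auto
  have "weighted_hit z B b = (\<integral>\<omega>. ?i b \<omega> \<partial>W) + (\<Sum>c\<in>?B. (z c - 1) * (\<integral>\<omega>. ?w c \<omega> * (?i c \<omega> * ?i b \<omega>) \<partial>W))"
    unfolding weighted_hit_def eq using int int_b
    by (subst Bochner_Integration.integral_add) (auto intro!: Bochner_Integration.integrable_sum)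
  also have "(\<integral>\<omega>. ?i b \<omega> \<partial>W) = srw_transition (fst b) x0 (snd b)"
    using markov_hit[of "{}" 0 "fst b" z x0 "snd b"] b0
      expectation_start[OF hit_measurable[OF b0, of "snd b", where 'b = real]]
      expectation_start[of "\<lambda>_. 1 :: real"] prob_space
    by (simp add: path_weight_def)
  also have "(\<Sum>c\<in>?B. (z c - 1) * (\<integral>\<omega>. ?w c \<omega> * (?i c \<omega> * ?i b \<omega>) \<partial>W)) =
    (\<Sum>c\<in>?B. weighted_hit z B c * (z c - 1) * srw_transition (fst b - fst c) (snd c) (snd b))"
  proof (rule sum.cong[OF refl])
    fix c assume c: "c \<in> ?B"
    have "(\<integral>\<omega>. ?w c \<omega> * (?i c \<omega> * ?i b \<omega>) \<partial>W) = weighted_hit z B c * srw_transition (fst b - fst c) (snd c) (snd b)"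
      unfolding weighted_hit_def using B c by (intro markov_hit) auto
    then show "(z c - 1) * (\<integral>\<omega>. ?w c \<omega> * (?i c \<omega> * ?i b \<omega>) \<partial>W) =
       weighted_hit z B c * (z c - 1) * srw_transition (fst b - fst c) (snd c) (snd b)"
      by simp
  qed
  finally show ?thesis .
qed

text \<open>One-particle expectation. In the telescoped weight each summand ends with a hit of \<open>b\<close>, from
  where the martingale property brings \<open>M_hat\<close> back from time \<open>u\<close> to the time of \<open>b\<close>.\<close>
lemma expectation_weight_M_hat:
  assumes B: "finite B" "B \<subseteq> {0..u} \<times> UNIV" and u: "0 \<le> u" and a: "0 < a"
  shows "(\<integral>\<omega>. of_real (path_weight z B (\<lambda>r. X r \<omega>)) * M_hat a k u (X u \<omega>) \<partial>W) =
    M_hat a k 0 x0 + (\<Sum>b\<in>B. of_real (weighted_hit z B b * (z b - 1)) * M_hat a k (fst b) (snd b))"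
proof -
  let ?w = "\<lambda>c \<omega>. path_weight z {d\<in>B. fst d < fst c} (\<lambda>r. X r \<omega>)"
  let ?i = "\<lambda>c \<omega>. of_bool (X (fst c) \<omega> = snd c) :: complex"
  let ?M = "\<lambda>\<omega>. M_hat a k u (X u \<omega>)"
  obtain K where K: "\<And>w. norm (M_hat a k u w) \<le> K" using M_hat_bounded[OF a] by blast
  have K0: "0 \<le> K" using K[of 0] norm_ge_zero order_trans by blast
  have mM: "?M \<in> borel_measurable W"
    using u by (intro measurable_compose[OF X_measurable]) auto
  have eq: "of_real (path_weight z B (\<lambda>r. X r \<omega>)) * ?M \<omega> =
     ?M \<omega> + (\<Sum>b\<in>B. of_real (z b - 1) * (of_real (?w b \<omega>) * (?i b \<omega> * ?M \<omega>)))" for \<omega>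
  proof -
    have ob: "of_real (of_bool P) = (of_bool P :: complex)" for P by (simp add: of_bool_def)
    have "of_real (path_weight z B (\<lambda>r. X r \<omega>)) = (1 + (\<Sum>b\<in>B. of_real (?w b \<omega>) * of_real (z b - 1) * ?i b \<omega>))"
      by (subst path_weight_telescope[OF B(1)])
        (simp only: of_real_add of_real_sum of_real_mult of_real_1 ob)
    then show ?thesis
      by (simp only: distrib_left sum_distrib_left mult_1_right mult_1_left mult_ac)
  qed
  have int: "integrable W (\<lambda>\<omega>. of_real (?w b \<omega>) * (?i b \<omega> * ?M \<omega>))" if "b \<in> B" for b
  proof (rule path_weight_integrable)
    show "(\<lambda>\<omega>. ?i b \<omega> * ?M \<omega>) \<in> borel_measurable W"
      using B that by (intro borel_measurable_times hit_measurable mM) auto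
    show "norm (?i b \<omega> * ?M \<omega>) \<le> 1 * K" for \<omega>
      unfolding norm_mult using K by (intro mult_mono) auto
  qed (use B in auto)
  have int_M: "integrable W ?M"
    using K by (intro integrable_const_bound[of _ K] mM) auto
  have "(\<integral>\<omega>. of_real (path_weight z B (\<lambda>r. X r \<omega>)) * ?M \<omega> \<partial>W) =
     (\<integral>\<omega>. ?M \<omega> \<partial>W) + (\<Sum>b\<in>B. of_real (z b - 1) * (\<integral>\<omega>. of_real (?w b \<omega>) * (?i b \<omega> * ?M \<omega>) \<partial>W))"
    unfolding eq using int int_M
    by (subst Bochner_Integration.integral_add) (auto intro!: Bochner_Integration.integrable_sum simp del: of_real_diff)
  also have "(\<integral>\<omega>. ?M \<omega> \<partial>W) = M_hat a k 0 x0"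
    using markov_M_hat[of "{}" 0 u a z x0 k] u a expectation_start[OF mM]
      expectation_start[of "\<lambda>_. 1 :: real"] prob_space
    by (simp add: path_weight_def)
  also have "(\<Sum>b\<in>B. of_real (z b - 1) * (\<integral>\<omega>. of_real (?w b \<omega>) * (?i b \<omega> * ?M \<omega>) \<partial>W)) =
     (\<Sum>b\<in>B. of_real (weighted_hit z B b * (z b - 1)) * M_hat a k (fst b) (snd b))"
  proof (rule sum.cong[OF refl])
    fix b assume b: "b \<in> B"
    have "(\<integral>\<omega>. of_real (?w b \<omega>) * (?i b \<omega> * ?M \<omega>) \<partial>W) = of_real (weighted_hit z B b) * M_hat a k (fst b) (snd b)"
      unfolding weighted_hit_def using B b a by (intro markov_M_hat) auto
    then show "of_real (z b - 1) * (\<integral>\<omega>. of_real (?w b \<omega>) * (?i b \<omega> * ?M \<omega>) \<partial>W) =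
       of_real (weighted_hit z B b * (z b - 1)) * M_hat a k (fst b) (snd b)"
      by simp
  qed
  finally show ?thesis .
qed

end

section \<open>Correlations of the noncolliding walk\<close>

lemma config_space_coordinate:
  assumes "X \<in> measurable P config_space"
  shows "(\<lambda>\<omega>. X \<omega> x) \<in> measurable P (count_space UNIV)"
  using assms unfolding config_space_def
  by (rule measurable_compose[OF _ measurable_component_singleton]) simp

definition walk_step :: "real \<times> int \<Rightarrow> real \<times> int \<Rightarrow> real" where
  "walk_step b c = (if fst b < fst c then srw_transition (fst c - fst b) (snd b) (snd c) else 0)"

text \<open>Functionals of product form factorise over the particles.\<close>
lemma prod_power_empirical_config:
  fixes z :: "real \<times> int \<Rightarrow> real"
  assumes "finite B" "finite J"
  shows "(\<Prod>b\<in>B. z b ^ empirical_config J (\<lambda>j. v j (fst b)) (snd b)) = (\<Prod>j\<in>J. path_weight z B (v j))"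
proof -
  have "(\<Prod>j\<in>J. if v j (fst b) = snd b then z b else 1) = z b ^ empirical_config J (\<lambda>j. v j (fst b)) (snd b)" for b
    using assms(2) by (simp add: empirical_config_def prod.If_cases Int_def)
  then show ?thesis
    unfolding path_weight_def by (subst prod.swap) simp
qed

context
  fixes a :: nat and W :: "'v measure" and V :: "int \<Rightarrow> real \<Rightarrow> 'v \<Rightarrow> int"
  assumes a: "0 < a" and walks: "independent_walks a W V"
begin

lemma walk_locale: "simple_random_walk W (V j) (int a * j)"
  using walks by (simp add: independent_walks_def simple_random_walk_def simple_random_walk_axioms_def)

text \<open>By independence, each permutation in the expansion of the determinant contributes a product of
  one-particle expectations.\<close>
lemma expectation_D_hat:
  assumes B: "finite B" "B \<subseteq> {0..u} \<times> UNIV" and u: "0 \<le> u" and J: "finite J"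
  shows "(\<integral>\<omega>. of_real (\<Prod>b\<in>B. z b ^ empirical_config J (\<lambda>j. V j (fst b) \<omega>) (snd b)) *
      D_hat a J u (\<lambda>j. V j u \<omega>) \<partial>W) =
    det_on J (\<lambda>j k. \<integral>\<omega>. of_real (path_weight z B (\<lambda>r. V j r \<omega>)) * M_hat a k u (V j u \<omega>) \<partial>W)"
proof -
  interpret prob_space W using walks by (simp add: independent_walks_def)
  have pos: "B \<subseteq> {0..} \<times> UNIV" using B by auto
  define H where "H k f = of_real (path_weight z B f) * M_hat a k u (f u)" for k f
  let ?P = "\<Pi>\<^sub>M t\<in>{0::real..}. count_space (UNIV :: int set)"
  have coord: "(\<lambda>f. g (f t)) \<in> borel_measurable ?P" if "0 \<le> t" for t and g :: "int \<Rightarrow> 'c::topological_space"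
    using that by (intro measurable_compose[OF measurable_component_singleton]) auto
  have H_meas: "H k \<in> borel_measurable ?P" for k
    unfolding H_def path_weight_def of_real_prod
  proof (intro borel_measurable_times borel_measurable_prod coord u)
    fix b assume "b \<in> B"
    with pos show "0 \<le> fst b" by auto
  qed
  have H_restrict: "H k (restrict f {0..}) = H k f" for k f
  proof -
    have "path_weight z B (restrict f {0..}) = path_weight z B f"
      unfolding path_weight_def using pos by (intro prod.cong) auto
    then show ?thesis using u by (simp add: H_def)
  qed
  have indep: "indep_vars (\<lambda>_. borel) (\<lambda>j \<omega>. H (p j) (\<lambda>r. V j r \<omega>)) J" for p
  proof -
    have "indep_vars (\<lambda>_. ?P) (\<lambda>j \<omega>. \<lambda>t\<in>{0..}. V j t \<omega>) J"
      using walks by (auto simp: independent_walks_def intro: indep_vars_subset)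
    from indep_vars_compose2[OF this, of "\<lambda>j. H (p j)" "\<lambda>_. borel"] H_meas show ?thesis
      by (simp add: H_restrict)
  qed
  obtain K where K: "\<And>k w. k \<in> J \<Longrightarrow> norm (M_hat a k u w) \<le> K k"
  proof -
    have "\<forall>k. \<exists>C. \<forall>w. norm (M_hat a k u w) \<le> C" using M_hat_bounded[OF a] by blast
    then show ?thesis using that by metis
  qed
  have int: "integrable W (\<lambda>\<omega>. H k (\<lambda>r. V j r \<omega>))" if "k \<in> J" for j k
  proof -
    interpret X: simple_random_walk W "V j" "int a * j" by (rule walk_locale)
    show ?thesis unfolding H_def
      by (rule X.path_weight_integrable[OF B(1) pos _ K[OF that]])
        (use u in \<open>auto intro!: measurable_compose[OF X.X_measurable]\<close>)
  qed
  have eq: "of_real (\<Prod>b\<in>B. z b ^ empirical_config J (\<lambda>j. V j (fst b) \<omega>) (snd b)) * D_hat a J u (\<lambda>j. V j u \<omega>) =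
      (\<Sum>p | p permutes J. of_int (sign p) * (\<Prod>j\<in>J. H (p j) (\<lambda>r. V j r \<omega>)))" for \<omega>
    unfolding prod_power_empirical_config[OF B(1) J, of z "\<lambda>j r. V j r \<omega>"] D_hat_def det_on_def H_def
    by (simp add: sum_distrib_left prod.distrib mult_ac)
  have intp: "integrable W (\<lambda>\<omega>. \<Prod>j\<in>J. H (p j) (\<lambda>r. V j r \<omega>))" if "p permutes J" for p
    by (rule indep_vars_integrable[OF J indep]) (use that int in \<open>auto simp: permutes_in_image\<close>)
  have "(\<integral>\<omega>. of_real (\<Prod>b\<in>B. z b ^ empirical_config J (\<lambda>j. V j (fst b) \<omega>) (snd b)) *
      D_hat a J u (\<lambda>j. V j u \<omega>) \<partial>W) =
      (\<Sum>p | p permutes J. of_int (sign p) * (\<integral>\<omega>. (\<Prod>j\<in>J. H (p j) (\<lambda>r. V j r \<omega>)) \<partial>W))"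
    unfolding eq using intp by (subst Bochner_Integration.integral_sum) auto
  also have "\<dots> = (\<Sum>p | p permutes J. of_int (sign p) * (\<Prod>j\<in>J. \<integral>\<omega>. H (p j) (\<lambda>r. V j r \<omega>) \<partial>W))"
    by (intro sum.cong refl arg_cong2[where f="(*)"] indep_vars_lebesgue_integral[OF J indep])
      (auto simp: permutes_in_image intro: int)
  finally show ?thesis unfolding det_on_def H_def .
qed

text \<open>With \<open>X = A\<close> and \<open>Y = (z - 1) M_hat\<close>, the label determinant is
  \<open>det (1 + X Y) = det (1 + Y X)\<close>. The system for \<open>A\<close> gives
  \<open>(1 + Y X) (1 - (z - 1) P) = 1 + (z - 1) (K - P)\<close>, where \<open>K\<close> is the sum over labels
  and the second factor on the left is unitriangular.\<close>
lemma expectation_D_hat_kernel: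
  assumes B: "finite B" "B \<subseteq> {0..u} \<times> UNIV" and u: "0 \<le> u" and J: "finite J"
  shows "(\<integral>\<omega>. of_real (\<Prod>b\<in>B. z b ^ empirical_config J (\<lambda>j. V j (fst b) \<omega>) (snd b)) *
      D_hat a J u (\<lambda>j. V j u \<omega>) \<partial>W) =
    det_on B (\<lambda>b c. of_bool (b = c) + of_real (z b - 1) *
      ((\<Sum>j\<in>J. M_hat a j (fst b) (snd b) * of_real (srw_transition (fst c) (int a * j) (snd c)))
        - of_real (walk_step b c)))"
proof -
  have pos: "B \<subseteq> {0..} \<times> UNIV" using B by auto
  define A where "A j b = (of_real (simple_random_walk.weighted_hit W (V j) z B b) :: complex)" for j b
  define \<eta> where "\<eta> b = (of_real (z b - 1) :: complex)" for b
  define P where "P b c = (of_real (walk_step b c) :: complex)" for b c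
  define K where "K b c = (\<Sum>j\<in>J. M_hat a j (fst b) (snd b) * of_real (srw_transition (fst c) (int a * j) (snd c)))" for b c
  define Q where "Q b c = (\<Sum>j\<in>J. (\<eta> b * M_hat a j (fst b) (snd b)) * A j c)" for b c
  have A_eq: "A j c = of_real (srw_transition (fst c) (int a * j) (snd c)) + (\<Sum>d\<in>B. A j d * \<eta> d * P d c)"
    if "c \<in> B" for j c
  proof -
    interpret X: simple_random_walk W "V j" "int a * j" by (rule walk_locale)
    have "(\<Sum>d\<in>{d\<in>B. fst d < fst c}. X.weighted_hit z B d * (z d - 1) * srw_transition (fst c - fst d) (snd d) (snd c))
      = (\<Sum>d\<in>B. X.weighted_hit z B d * (z d - 1) * walk_step d c)"
      using B(1) by (intro sum.mono_neutral_cong_left) (auto simp: walk_step_def)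
    then show ?thesis
      unfolding A_def \<eta>_def P_def X.weighted_hit_eq[OF B(1) pos that] by simp
  qed
  have entry: "(\<integral>\<omega>. of_real (path_weight z B (\<lambda>r. V j r \<omega>)) * M_hat a k u (V j u \<omega>) \<partial>W) =
      of_bool (j = k) + (\<Sum>b\<in>B. A j b * (\<eta> b * M_hat a k (fst b) (snd b)))" for j k
  proof -
    interpret X: simple_random_walk W "V j" "int a * j" by (rule walk_locale)
    show ?thesis
      unfolding X.expectation_weight_M_hat[OF B u a] M_hat_0[OF a] A_def \<eta>_def by (simp add: mult_ac)
  qed
  have Q_eq: "Q b c = \<eta> b * K b c + (\<Sum>d\<in>B. Q b d * (\<eta> d * P d c))" if "c \<in> B" for b c
  proof -
    have "Q b c = (\<Sum>j\<in>J. (\<eta> b * M_hat a j (fst b) (snd b)) *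
        (of_real (srw_transition (fst c) (int a * j) (snd c)) + (\<Sum>d\<in>B. A j d * \<eta> d * P d c)))"
      unfolding Q_def by (simp only: A_eq[OF that])
    also have "\<dots> = \<eta> b * K b c + (\<Sum>j\<in>J. \<Sum>d\<in>B. (\<eta> b * M_hat a j (fst b) (snd b)) * A j d * (\<eta> d * P d c))"
      by (simp only: distrib_left sum.distrib K_def sum_distrib_left mult.assoc)
    also have "(\<Sum>j\<in>J. \<Sum>d\<in>B. (\<eta> b * M_hat a j (fst b) (snd b)) * A j d * (\<eta> d * P d c)) =
        (\<Sum>d\<in>B. Q b d * (\<eta> d * P d c))"
      unfolding Q_def sum_distrib_right by (rule sum.swap)
    finally show ?thesis .
  qed
  \<comment> \<open>The steps between points go strictly forward in time.\<close>
  have tri: "det_on B (\<lambda>b c. of_bool (b = c) + - (\<eta> b * P b c)) = 1"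
    by (rule det_on_unitriangular[OF B(1), where r = fst]) (auto simp: P_def walk_step_def)
  have "(\<integral>\<omega>. of_real (\<Prod>b\<in>B. z b ^ empirical_config J (\<lambda>j. V j (fst b) \<omega>) (snd b)) *
      D_hat a J u (\<lambda>j. V j u \<omega>) \<partial>W) =
    det_on J (\<lambda>j k. of_bool (j = k) + (\<Sum>b\<in>B. A j b * (\<eta> b * M_hat a k (fst b) (snd b))))"
    unfolding expectation_D_hat[OF B u J] entry ..
  also have "\<dots> = det_on B (\<lambda>b c. of_bool (b = c) + Q b c)"
    unfolding Q_def by (rule det_on_one_plus_mult_commute[OF J B(1)])
  also have "\<dots> = det_on B (\<lambda>b c. \<Sum>d\<in>B. (of_bool (b = d) + Q b d) * (of_bool (d = c) + - (\<eta> d * P d c)))"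
    unfolding det_on_mult[OF B(1)] tri by simp
  also have "\<dots> = det_on B (\<lambda>b c. of_bool (b = c) + \<eta> b * (K b c - P b c))"
  proof (rule det_on_cong)
    fix b c assume b: "b \<in> B" and c: "c \<in> B"
    have "(\<Sum>d\<in>B. (of_bool (b = d) + Q b d) * (of_bool (d = c) + - (\<eta> d * P d c))) =
        (\<Sum>d\<in>B. (if d = b then of_bool (b = c) - \<eta> b * P b c else 0) + (if d = c then Q b c else 0)
          - Q b d * (\<eta> d * P d c))"
      by (intro sum.cong refl) (auto simp: algebra_simps)
    also have "\<dots> = of_bool (b = c) - \<eta> b * P b c + Q b c - (\<Sum>d\<in>B. Q b d * (\<eta> d * P d c))"
      using b c B(1) by (simp add: sum_subtractf sum.distrib sum.delta)
    also have "\<dots> = of_bool (b = c) + \<eta> b * (K b c - P b c)"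
      by (simp add: Q_eq[OF c] algebra_simps)
    finally show "(\<Sum>d\<in>B. (of_bool (b = d) + Q b d) * (of_bool (d = c) + - (\<eta> d * P d c))) =
      of_bool (b = c) + \<eta> b * (K b c - P b c)" .
  qed
  finally show ?thesis unfolding \<eta>_def K_def P_def .
qed

end

definition walk_kernel :: "nat \<Rightarrow> real \<times> int \<Rightarrow> real \<times> int \<Rightarrow> complex" where
  "walk_kernel a b c = lattice_kernel a (fst b) (snd b) (fst c) (snd c) - of_real (walk_step b c)"

lemma local_functional_prod_power:
  assumes B: "finite B" and z: "\<And>b. b \<in> B \<Longrightarrow> 0 \<le> z b \<and> z b \<le> 1"
  shows "local_functional (fst ` B) (snd ` B) (\<lambda>\<xi>. \<Prod>b\<in>B. z b ^ \<xi> (fst b) (snd b))"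
  unfolding local_functional_def
proof (intro conjI allI impI)
  show "bounded (range (\<lambda>\<xi>. \<Prod>b\<in>B. z b ^ \<xi> (fst b) (snd b) :: real))"
  proof (rule boundedI)
    fix r assume "r \<in> range (\<lambda>\<xi>. \<Prod>b\<in>B. z b ^ \<xi> (fst b) (snd b))"
    then obtain \<xi> where r: "r = (\<Prod>b\<in>B. z b ^ \<xi> (fst b) (snd b))" by blast
    have "0 \<le> r" "r \<le> 1"
      unfolding r using z by (auto intro!: prod_nonneg prod_le_1 power_le_one)
    then show "norm r \<le> 1" by simp
  qed
qed (intro prod.cong refl, auto)

lemma noncolliding_generating_function:
  assumes a: "0 < a" and walks: "independent_walks a W V" and nc: "noncolliding_walk a W V M \<Xi>"
    and B: "finite B" "B \<subseteq> {0..} \<times> UNIV" and z: "\<And>b. b \<in> B \<Longrightarrow> 0 \<le> z b \<and> z b \<le> 1"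
  shows "of_real (\<integral>\<omega>. (\<Prod>b\<in>B. z b ^ \<Xi> (fst b) \<omega> (snd b)) \<partial>M) =
    (\<Sum>D\<in>Pow B. (\<Prod>b\<in>D. of_real (z b - 1)) * det_on D (walk_kernel a))"
proof -
  \<comment> \<open>The horizon only has to bound all times in \<open>B\<close>.\<close>
  define u where "u = Max (insert 0 (fst ` B))"
  have "0 \<le> fst b" "fst b \<le> u" if "b \<in> B" for b
    using B that by (auto simp: u_def)
  then have u: "0 \<le> u" "B \<subseteq> {0..u} \<times> UNIV"
    using B(1) by (simp add: u_def, simp only: subset_iff mem_Times_iff atLeastAtMost_iff) simp
  define F where "F \<xi> = (\<Prod>b\<in>B. z b ^ \<xi> (fst b) (snd b))" for \<xi> :: "real \<Rightarrow> config"
  let ?K = "\<lambda>n b c. (\<Sum>j\<in>{-int n..int n}. M_hat a j (fst b) (snd b) *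
    of_real (srw_transition (fst c) (int a * j) (snd c))) - of_real (walk_step b c)"
  have "(\<lambda>L :: nat. \<integral>\<omega>. of_real (F (\<lambda>s. empirical_config {-int L..int L} (\<lambda>j. V j s \<omega>))) *
            D_hat a {-int L..int L} u (\<lambda>j. V j u \<omega>) \<partial>W)
        \<longlonglongrightarrow> of_real (\<integral>\<omega>. F (\<lambda>s. \<Xi> s \<omega>) \<partial>M)"
  proof -
    have "local_functional (fst ` B) (snd ` B) F"
      using local_functional_prod_power[OF B(1), of z] z by (simp add: F_def[abs_def])
    moreover have "fst ` B \<subseteq> {0..u}" using u by auto
    ultimately show ?thesis
      using nc u(1) B(1) unfolding noncolliding_walk_def by blast
  qed
  moreover have "(\<lambda>L :: nat. \<integral>\<omega>. of_real (F (\<lambda>s. empirical_config {-int L..int L} (\<lambda>j. V j s \<omega>))) *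
            D_hat a {-int L..int L} u (\<lambda>j. V j u \<omega>) \<partial>W) \<longlonglongrightarrow>
      det_on B (\<lambda>b c. of_bool (b = c) + of_real (z b - 1) * walk_kernel a b c)"
    unfolding F_def expectation_D_hat_kernel[OF a walks B(1) u(2,1) finite_atLeastAtMost_int] walk_kernel_def
    by (intro det_on_tendsto tendsto_intros M_hat_srw_transition_sums[OF a])
  ultimately have "of_real (\<integral>\<omega>. F (\<lambda>s. \<Xi> s \<omega>) \<partial>M) =
      det_on B (\<lambda>b c. of_bool (b = c) + of_real (z b - 1) * walk_kernel a b c)"
    by (rule LIMSEQ_unique)
  also have "\<dots> = (\<Sum>D\<in>Pow B. (\<Prod>b\<in>D. of_real (z b - 1)) * det_on D (walk_kernel a))"
    unfolding det_on_one_plus[OF B(1)]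
    using B(1) by (intro sum.cong refl det_on_scale_rows) (auto intro: finite_subset)
  finally show ?thesis unfolding F_def .
qed

text \<open>The generating function of a single occupation number \<open>n\<close> is affine in \<open>z\<close>, so the expectation
  of its second difference \<open>1 + 0 ^ n - 2 * (1 / 2) ^ n\<close> vanishes. This quantity is
  nonnegative, and positive for \<open>n \<ge> 2\<close>.\<close>
lemma noncolliding_occupation_le_1:
  assumes a: "0 < a" and walks: "independent_walks a W V" and nc: "noncolliding_walk a W V M \<Xi>"
    and t: "0 \<le> t"
  shows "AE \<omega> in M. \<Xi> t \<omega> x \<le> 1"
proof -
  have cp: "config_process M \<Xi>" using nc by (simp add: noncolliding_walk_def)
  interpret prob_space M using cp by (simp add: config_process_def)
  have meas_t: "\<Xi> t \<in> measurable M config_space" using cp t by (simp add: config_process_def)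
  have meas: "(\<lambda>\<omega>. h (\<Xi> t \<omega> x)) \<in> borel_measurable M" for h :: "nat \<Rightarrow> real"
    by (rule measurable_compose[OF config_space_coordinate[OF meas_t]]) simp
  have int: "integrable M (\<lambda>\<omega>. z ^ \<Xi> t \<omega> x)" if "0 \<le> z" "z \<le> 1" for z :: real
    using that by (intro integrable_const_bound[of _ 1] meas) (auto intro: power_le_one)
  have gf: "complex_of_real (\<integral>\<omega>. z ^ \<Xi> t \<omega> x \<partial>M) = 1 + of_real (z - 1) * det_on {(t, x)} (walk_kernel a)"
    if "0 \<le> z" "z \<le> 1" for z
    using noncolliding_generating_function[OF a walks nc, of "{(t, x)}" "\<lambda>_. z"] that t
    by (simp add: Pow_insert det_on_def)
  have "complex_of_real (\<integral>\<omega>. 1 + 0 ^ \<Xi> t \<omega> x - 2 * (1 / 2) ^ \<Xi> t \<omega> x \<partial>M) =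
      1 + of_real (\<integral>\<omega>. 0 ^ \<Xi> t \<omega> x \<partial>M) - 2 * of_real (\<integral>\<omega>. (1 / 2) ^ \<Xi> t \<omega> x \<partial>M)"
    using int[of 0] int[of "1/2"] by (simp add: prob_space)
  also have "\<dots> = 0"
  proof -
    let ?d = "det_on {(t, x)} (walk_kernel a)"
    have "complex_of_real (\<integral>\<omega>. 0 ^ \<Xi> t \<omega> x \<partial>M) = 1 - ?d"
      using gf[of 0] by simp
    moreover have "complex_of_real (\<integral>\<omega>. (1 / 2) ^ \<Xi> t \<omega> x \<partial>M) = 1 - ?d / 2"
      using gf[of "1 / 2"] by (simp only: of_real_diff) simp
    ultimately show ?thesis by (simp only:) (simp add: field_simps)
  qed
  finally have zero: "(\<integral>\<omega>. 1 + 0 ^ \<Xi> t \<omega> x - 2 * (1 / 2) ^ \<Xi> t \<omega> x \<partial>M) = (0 :: real)"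
    by simp
  have nonneg: "(0 :: real) \<le> 1 + 0 ^ n - 2 * (1 / 2) ^ n" and pos: "1 < n \<Longrightarrow> (0 :: real) \<noteq> 1 + 0 ^ n - 2 * (1 / 2) ^ n" for n :: nat
  proof -
    consider "n = 0" | "n = 1" | m where "n = Suc (Suc m)" by (metis One_nat_def not0_implies_Suc)
    then have "(0 :: real) \<le> 1 + 0 ^ n - 2 * (1 / 2) ^ n \<and> (1 < n \<longrightarrow> (0 :: real) \<noteq> 1 + 0 ^ n - 2 * (1 / 2) ^ n)"
    proof cases
      case 3
      have "(1 / 2 :: real) ^ m \<le> 1" by (rule power_le_one) auto
      then show ?thesis by (simp add: 3)
    qed auto
    then show "(0 :: real) \<le> 1 + 0 ^ n - 2 * (1 / 2) ^ n" "1 < n \<Longrightarrow> (0 :: real) \<noteq> 1 + 0 ^ n - 2 * (1 / 2) ^ n"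
      by auto
  qed
  have "AE \<omega> in M. 1 + 0 ^ \<Xi> t \<omega> x - 2 * (1 / 2) ^ \<Xi> t \<omega> x = (0 :: real)"
    using zero int[of 0] int[of "1/2"] nonneg
    by (subst integral_nonneg_eq_0_iff_AE[symmetric]) auto
  then show ?thesis
    by eventually_elim (use pos in \<open>metis not_le\<close>)
qed

text \<open>At \<open>z = 0\<close> the generating functions are the probabilities that \<open>C\<close> is empty, expanded into
  minors over the subsets of \<open>C\<close> with alternating signs. Inclusion and exclusion inverts
  this relation.\<close>
lemma noncolliding_correlation:
  assumes a: "0 < a" and walks: "independent_walks a W V" and nc: "noncolliding_walk a W V M \<Xi>"
    and D: "finite D" "D \<subseteq> {0..} \<times> UNIV"
  shows "of_real (measure M {\<omega> \<in> space M. \<forall>b\<in>D. 0 < \<Xi> (fst b) \<omega> (snd b)}) = det_on D (walk_kernel a)"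
proof -
  have cp: "config_process M \<Xi>" using nc by (simp add: noncolliding_walk_def)
  interpret prob_space M using cp by (simp add: config_process_def)
  let ?N = "{0::real..} \<times> (UNIV :: int set)"
  define e where "e C \<omega> = (\<Prod>b\<in>C. 0 ^ \<Xi> (fst b) \<omega> (snd b) :: real)" for C and \<omega>
  \<comment> \<open>Intersecting with the nonnegative times makes the relation hold for all finite sets.\<close>
  define g where "g C = complex_of_real (\<integral>\<omega>. e (C \<inter> ?N) \<omega> \<partial>M)" for C
  define f where "f C = (if C \<subseteq> ?N then det_on C (walk_kernel a) else 0)" for C
  have ge: "g C = (\<Sum>T\<in>Pow C. (- 1) ^ card T * f T)" if "finite C" for C
  proof -
    have "g C = (\<Sum>T\<in>Pow (C \<inter> ?N). (\<Prod>b\<in>T. of_real (0 - 1)) * det_on T (walk_kernel a))"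
      unfolding g_def e_def using that
      by (intro noncolliding_generating_function[OF a walks nc, of "C \<inter> ?N" "\<lambda>_. 0"]) auto
    also have "\<dots> = (\<Sum>T\<in>Pow C. (- 1) ^ card T * f T)"
      using that by (intro sum.mono_neutral_cong_left) (auto simp: f_def)
    finally show ?thesis .
  qed
  have meas: "(\<lambda>\<omega>. h (\<Xi> (fst b) \<omega> (snd b))) \<in> borel_measurable M" if "b \<in> D" for h :: "nat \<Rightarrow> real" and b
  proof -
    have "0 \<le> fst b" using D that by auto
    then have "\<Xi> (fst b) \<in> measurable M config_space" using cp by (simp add: config_process_def)
    then show ?thesis by (rule measurable_compose[OF config_space_coordinate]) simp
  qed
  have int: "integrable M (e C)" if "C \<subseteq> D" for C
    unfolding e_def using that D(1)
    by (intro integrable_const_bound[of _ 1] borel_measurable_prod meas)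
      (auto intro!: AE_I2 prod_le_1 power_le_one simp: abs_prod)
  have "indicator {\<omega> \<in> space M. \<forall>b\<in>D. 0 < \<Xi> (fst b) \<omega> (snd b)} \<omega> = (\<Sum>C\<in>Pow D. (- 1) ^ card C * e C \<omega>)"
    if "\<omega> \<in> space M" for \<omega>
  proof -
    have "(\<Sum>C\<in>Pow D. (- 1) ^ card C * e C \<omega>) =
        (\<Sum>C\<in>Pow D. (\<Prod>b\<in>C. - (0 ^ \<Xi> (fst b) \<omega> (snd b))) * (\<Prod>b\<in>D - C. 1))"
      by (intro sum.cong) (auto simp: e_def prod_uminus)
    also have "\<dots> = (\<Prod>b\<in>D. - (0 ^ \<Xi> (fst b) \<omega> (snd b)) + 1)"
      by (rule prod_add[OF D(1), symmetric])
    also have "\<dots> = indicator {\<omega> \<in> space M. \<forall>b\<in>D. 0 < \<Xi> (fst b) \<omega> (snd b)} \<omega>"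
      using that D(1) by (auto simp: indicator_def power_0_left intro!: prod.neutral)
    finally show ?thesis by simp
  qed
  then have "(\<integral>\<omega>. indicator {\<omega> \<in> space M. \<forall>b\<in>D. 0 < \<Xi> (fst b) \<omega> (snd b)} \<omega> \<partial>M) =
      (\<integral>\<omega>. (\<Sum>C\<in>Pow D. (- 1) ^ card C * e C \<omega>) \<partial>M)"
    by (intro Bochner_Integration.integral_cong) auto
  also have "\<dots> = (\<Sum>C\<in>Pow D. (- 1) ^ card C * (\<integral>\<omega>. e C \<omega> \<partial>M))"
    using int by (subst Bochner_Integration.integral_sum) auto
  finally have "complex_of_real (measure M {\<omega> \<in> space M. \<forall>b\<in>D. 0 < \<Xi> (fst b) \<omega> (snd b)}) =
      (\<Sum>C\<in>Pow D. (- 1) ^ card C * g C)"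
    using D by (simp add: g_def Int_absorb2 Collect_conj_eq Int_commute[of _ "space M"])
  also have "\<dots> = f D"
    using inclusion_exclusion_symmetric[of g f, OF ge D(1)] by simp
  finally show ?thesis using D by (simp add: f_def)
qed

text \<open>The limits of the kernels carry the factor \<open>exp (t - s)\<close> and appear with the arguments
  exchanged; neither is visible in the minors.\<close>
lemma noncolliding_correlation_limit:
  assumes a: "0 < a" and walks: "independent_walks a W V" and nc: "noncolliding_walk a W V M \<Xi>"
    and D: "finite D"
  shows "((\<lambda>\<tau>. measure M {\<omega> \<in> space M. \<forall>b\<in>D. 0 < \<Xi> (fst b + \<tau>) \<omega> (snd b)}) \<longlongrightarrow>
    det_on D (\<lambda>b c. extended_sine_kernel (1 / real a) (fst c - fst b) (snd c - snd b))) at_top"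
proof -
  let ?E = "\<lambda>b c. extended_sine_kernel (1 / real a) (fst c - fst b) (snd c - snd b)"
  define K where "K \<tau> b c = walk_kernel a (fst b + \<tau>, snd b) (fst c + \<tau>, snd c)" for \<tau> b c
  have "((\<lambda>\<tau>. K \<tau> b c) \<longlongrightarrow> of_real (exp (fst b - fst c) * ?E c b)) at_top" for b c
    unfolding K_def walk_kernel_def walk_step_def
    using tendsto_diff[OF lattice_kernel_limit[OF a] tendsto_const, of "fst b" "snd b" "fst c" "snd c"
        "if fst b < fst c then of_real (srw_transition (fst c - fst b) (snd b) (snd c)) else 0"]
    unfolding limit_kernel_eq[OF a] by (simp add: if_distrib[of of_real] cong: if_cong)
  then have "((\<lambda>\<tau>. det_on D (K \<tau>)) \<longlongrightarrow> det_on D (\<lambda>b c. of_real (exp (fst b - fst c) * ?E c b))) at_top"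
    by (rule det_on_tendsto)
  also have "det_on D (\<lambda>b c. of_real (exp (fst b - fst c) * ?E c b)) = complex_of_real (det_on D ?E)"
  proof -
    have "det_on D (\<lambda>b c. exp (fst b - fst c) * ?E c b) = det_on D (\<lambda>b c. exp (fst b) * ?E c b / exp (fst c))"
      by (simp add: exp_diff)
    also have "\<dots> = det_on D (\<lambda>b c. ?E c b)" by (rule det_on_gauge[OF D]) simp
    also have "\<dots> = det_on D ?E" by (rule det_on_transpose[OF D])
    finally show ?thesis by (simp only: det_on_of_real)
  qed
  finally have lim: "((\<lambda>\<tau>. det_on D (K \<tau>)) \<longlongrightarrow> of_real (det_on D ?E)) at_top" .
  have "\<forall>\<^sub>F \<tau> in at_top. det_on D (K \<tau>) =
      of_real (measure M {\<omega> \<in> space M. \<forall>b\<in>D. 0 < \<Xi> (fst b + \<tau>) \<omega> (snd b)})"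
  proof (rule eventually_at_top_linorderI)
    fix \<tau> assume \<tau>: "Max (insert 0 ((\<lambda>b. - fst b) ` D)) \<le> \<tau>"
    have nonneg: "0 \<le> fst b + \<tau>" if "b \<in> D" for b
    proof -
      have "- fst b \<le> Max (insert 0 ((\<lambda>b. - fst b) ` D))" using D that by (intro Max_ge) auto
      with \<tau> show ?thesis by simp
    qed
    define s where "s b = (fst b + \<tau>, snd b)" for b :: "real \<times> int"
    have bij: "bij_betw s D (s ` D)" by (auto simp: s_def bij_betw_def inj_on_def prod_eq_iff)
    have "of_real (measure M {\<omega> \<in> space M. \<forall>b\<in>s ` D. 0 < \<Xi> (fst b) \<omega> (snd b)}) = det_on (s ` D) (walk_kernel a)"
      using D nonneg by (intro noncolliding_correlation[OF a walks nc]) (auto simp: s_def)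
    also have "\<dots> = det_on D (K \<tau>)"
      unfolding det_on_reindex[OF bij D] by (simp add: K_def[abs_def] s_def)
    finally show "det_on D (K \<tau>) =
      of_real (measure M {\<omega> \<in> space M. \<forall>b\<in>D. 0 < \<Xi> (fst b + \<tau>) \<omega> (snd b)})"
      by (simp add: s_def)
  qed
  with lim have "((\<lambda>\<tau>. complex_of_real (measure M {\<omega> \<in> space M. \<forall>b\<in>D. 0 < \<Xi> (fst b + \<tau>) \<omega> (snd b)}))
      \<longlongrightarrow> of_real (det_on D ?E)) at_top"
    by (simp only: tendsto_cong)
  then show ?thesis by (simp only: tendsto_of_real_iff)
qed

section \<open>Random sets and their limits in law\<close>

lemma (in prob_space) random_set_events:
  assumes "\<And>b. b \<in> D \<Longrightarrow> {\<omega> \<in> space M. b \<in> Z \<omega>} \<in> events" "finite D"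
  shows "{\<omega> \<in> space M. D \<subseteq> Z \<omega>} \<in> events"
proof -
  have "{\<omega> \<in> space M. \<forall>b\<in>D. b \<in> Z \<omega>} \<in> events"
    using assms by (intro sets.sets_Collect_finite_All) auto
  then show ?thesis by (simp add: subset_eq)
qed

lemma (in prob_space) random_set_pattern_event:
  assumes ev: "\<And>b. b \<in> B \<Longrightarrow> {\<omega> \<in> space M. b \<in> Z \<omega>} \<in> events" and B: "finite B" "C \<subseteq> B"
  shows "{\<omega> \<in> space M. Z \<omega> \<inter> B = C} \<in> events"
proof -
  have "{\<omega> \<in> space M. \<forall>b\<in>B. b \<in> Z \<omega> \<longleftrightarrow> b \<in> C} \<in> events"
  proof (rule sets.sets_Collect_finite_All[OF _ B(1)])
    fix b assume "b \<in> B"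
    then have "{\<omega> \<in> space M. b \<in> Z \<omega>} \<in> events" by (rule ev)
    then show "{\<omega> \<in> space M. b \<in> Z \<omega> \<longleftrightarrow> b \<in> C} \<in> events"
      by (cases "b \<in> C") (auto intro: sets.sets_Collect_neg)
  qed
  also have "{\<omega> \<in> space M. \<forall>b\<in>B. b \<in> Z \<omega> \<longleftrightarrow> b \<in> C} = {\<omega> \<in> space M. Z \<omega> \<inter> B = C}"
    using B(2) by blast
  finally show ?thesis .
qed

text \<open>Inclusion-exclusion expression, in terms of the probabilities \<open>r\<close> of occupied sets, for the
  probability that precisely \<open>C\<close> is occupied within \<open>B\<close>.\<close>
definition pattern_weight :: "('i set \<Rightarrow> real) \<Rightarrow> 'i set \<Rightarrow> 'i set \<Rightarrow> real" where
  "pattern_weight r B C = (\<Sum>X\<in>Pow (B - C). (- 1) ^ card X * r (C \<union> X))"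

text \<open>Expand \<open>\<Prod>b\<in>B - C. 1 - indicator b\<close>.\<close>
lemma (in prob_space) random_set_pattern_prob:
  assumes ev: "\<And>b. b \<in> B \<Longrightarrow> {\<omega> \<in> space M. b \<in> Z \<omega>} \<in> events" and B: "finite B" "C \<subseteq> B"
  shows "prob {\<omega> \<in> space M. Z \<omega> \<inter> B = C} = pattern_weight (\<lambda>D. prob {\<omega> \<in> space M. D \<subseteq> Z \<omega>}) B C"
proof -
  have CX: "{\<omega> \<in> space M. C \<union> X \<subseteq> Z \<omega>} \<in> events" if "X \<in> Pow (B - C)" for X
    using that B by (intro random_set_events ev) (auto intro: finite_subset)
  have "indicator {\<omega> \<in> space M. Z \<omega> \<inter> B = C} \<omega> =
      (\<Sum>X\<in>Pow (B - C). (- 1) ^ card X * indicator {\<omega> \<in> space M. C \<union> X \<subseteq> Z \<omega>} \<omega> :: real)"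
    if "\<omega> \<in> space M" for \<omega>
  proof -
    have fin: "finite X" if "X \<subseteq> B - C" for X using B that by (auto intro: finite_subset)
    have "(\<Sum>X\<in>Pow (B - C). (- 1) ^ card X * indicator {\<omega> \<in> space M. C \<union> X \<subseteq> Z \<omega>} \<omega> :: real) =
        (\<Sum>X\<in>Pow (B - C). of_bool (C \<subseteq> Z \<omega>) * ((\<Prod>b\<in>X. - of_bool (b \<in> Z \<omega>)) * (\<Prod>b\<in>(B - C) - X. 1)))"
      using that fin by (intro sum.cong) (auto simp: indicator_def prod_uminus intro!: prod.neutral)
    also have "\<dots> = of_bool (C \<subseteq> Z \<omega>) * (\<Prod>b\<in>B - C. - of_bool (b \<in> Z \<omega>) + 1)"
      using B by (subst prod_add) (auto simp: sum_distrib_left)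
    also have "\<dots> = indicator {\<omega> \<in> space M. Z \<omega> \<inter> B = C} \<omega>"
      using that B by (auto simp: indicator_def intro!: prod.neutral)
    finally show ?thesis by simp
  qed
  then have "(\<integral>\<omega>. indicator {\<omega> \<in> space M. Z \<omega> \<inter> B = C} \<omega> \<partial>M) =
      (\<integral>\<omega>. (\<Sum>X\<in>Pow (B - C). (- 1) ^ card X * indicator {\<omega> \<in> space M. C \<union> X \<subseteq> Z \<omega>} \<omega> :: real) \<partial>M)"
    by (intro Bochner_Integration.integral_cong) auto
  also have "\<dots> = (\<Sum>X\<in>Pow (B - C). (- 1) ^ card X * prob {\<omega> \<in> space M. C \<union> X \<subseteq> Z \<omega>})"
    using CX by (subst Bochner_Integration.integral_sum) (auto simp: emeasure_eq_measure Int_absorb2 Collect_conj_eq Int_commute[of _ "space M"])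
  finally show ?thesis
    by (simp add: pattern_weight_def Int_absorb2 Collect_conj_eq Int_commute[of _ "space M"])
qed

lemma (in prob_space) random_set_pattern_expectation:
  assumes ev: "\<And>b. b \<in> B \<Longrightarrow> {\<omega> \<in> space M. b \<in> Z \<omega>} \<in> events" and B: "finite B"
  shows "has_bochner_integral M (\<lambda>\<omega>. H (Z \<omega> \<inter> B) :: real)
    (\<Sum>C\<in>Pow B. H C * pattern_weight (\<lambda>D. prob {\<omega> \<in> space M. D \<subseteq> Z \<omega>}) B C)"
proof -
  have "has_bochner_integral M (\<lambda>\<omega>. \<Sum>C\<in>Pow B. H C * indicator {\<omega> \<in> space M. Z \<omega> \<inter> B = C} \<omega>)
    (\<Sum>C\<in>Pow B. H C * prob {\<omega> \<in> space M. Z \<omega> \<inter> B = C})"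
    using random_set_pattern_event[OF ev B]
    by (intro has_bochner_integral_sum has_bochner_integral_mult_right has_bochner_integral_real_indicator)
      (auto simp: emeasure_eq_measure)
  also have "(\<Sum>C\<in>Pow B. H C * prob {\<omega> \<in> space M. Z \<omega> \<inter> B = C}) =
      (\<Sum>C\<in>Pow B. H C * pattern_weight (\<lambda>D. prob {\<omega> \<in> space M. D \<subseteq> Z \<omega>}) B C)"
    using B by (intro sum.cong refl) (simp add: random_set_pattern_prob[OF ev])
  finally show ?thesis
  proof (subst has_bochner_integral_cong[OF refl _ refl])
    fix \<omega> assume "\<omega> \<in> space M"
    then have "(\<Sum>C\<in>Pow B. H C * indicator {\<omega> \<in> space M. Z \<omega> \<inter> B = C} \<omega>) =
        (\<Sum>C\<in>Pow B. if C = Z \<omega> \<inter> B then H C else 0)"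
      by (intro sum.cong) (auto simp: indicator_def)
    then show "H (Z \<omega> \<inter> B) = (\<Sum>C\<in>Pow B. H C * indicator {\<omega> \<in> space M. Z \<omega> \<inter> B = C} \<omega>)"
      using B by (simp add: sum.delta)
  qed simp
qed

text \<open>Random sets whose probabilities of containing a given finite set converge. Events are only
  required eventually, because a shifted time is nonnegative only for large shifts.\<close>
locale random_set_limit = prob_space M for M :: "'w measure" +
  fixes Z :: "'x \<Rightarrow> 'w \<Rightarrow> 'i set" and F :: "'x filter" and r :: "'i set \<Rightarrow> real"
  assumes nontrivial: "F \<noteq> bot"
    and ev: "\<And>b. \<forall>\<^sub>F \<tau> in F. {\<omega> \<in> space M. b \<in> Z \<tau> \<omega>} \<in> events"
    and lim: "\<And>D. finite D \<Longrightarrow> ((\<lambda>\<tau>. prob {\<omega> \<in> space M. D \<subseteq> Z \<tau> \<omega>}) \<longlongrightarrow> r D) F"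
begin

lemma eventually_events:
  assumes "finite B"
  shows "\<forall>\<^sub>F \<tau> in F. \<forall>b\<in>B. {\<omega> \<in> space M. b \<in> Z \<tau> \<omega>} \<in> events"
  using assms ev by (simp add: eventually_ball_finite)

lemma expectation_limit:
  assumes B: "finite B"
  shows "((\<lambda>\<tau>. \<integral>\<omega>. H (Z \<tau> \<omega> \<inter> B) \<partial>M) \<longlongrightarrow> (\<Sum>C\<in>Pow B. H C * pattern_weight r B C)) F"
proof -
  have "((\<lambda>\<tau>. \<Sum>C\<in>Pow B. H C * pattern_weight (\<lambda>D. prob {\<omega> \<in> space M. D \<subseteq> Z \<tau> \<omega>}) B C) \<longlongrightarrow>
      (\<Sum>C\<in>Pow B. H C * pattern_weight r B C)) F"
    unfolding pattern_weight_def using B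
    by (intro tendsto_intros lim) (auto intro: finite_subset)
  moreover have "\<forall>\<^sub>F \<tau> in F. (\<integral>\<omega>. H (Z \<tau> \<omega> \<inter> B) \<partial>M) =
      (\<Sum>C\<in>Pow B. H C * pattern_weight (\<lambda>D. prob {\<omega> \<in> space M. D \<subseteq> Z \<tau> \<omega>}) B C)"
    using eventually_events[OF B]
    by eventually_elim (auto intro!: has_bochner_integral_integral_eq random_set_pattern_expectation B)
  ultimately show ?thesis by (subst tendsto_cong) auto
qed

lemma pattern_weight_limit:
  assumes B: "finite B" and C: "C \<subseteq> B"
  shows "((\<lambda>\<tau>. prob {\<omega> \<in> space M. Z \<tau> \<omega> \<inter> B = C}) \<longlongrightarrow> pattern_weight r B C) F"
proof -
  have "((\<lambda>\<tau>. pattern_weight (\<lambda>D. prob {\<omega> \<in> space M. D \<subseteq> Z \<tau> \<omega>}) B C) \<longlongrightarrow> pattern_weight r B C) F"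
    unfolding pattern_weight_def using B C
    by (intro tendsto_intros lim) (auto intro: finite_subset)
  moreover have "\<forall>\<^sub>F \<tau> in F. prob {\<omega> \<in> space M. Z \<tau> \<omega> \<inter> B = C} =
      pattern_weight (\<lambda>D. prob {\<omega> \<in> space M. D \<subseteq> Z \<tau> \<omega>}) B C"
    using eventually_events[OF B] by eventually_elim (simp add: random_set_pattern_prob B C)
  ultimately show ?thesis by (subst tendsto_cong) auto
qed

lemma pattern_weight_nonneg:
  assumes "finite B" "C \<subseteq> B"
  shows "0 \<le> pattern_weight r B C"
  by (rule tendsto_lowerbound[OF pattern_weight_limit[OF assms]]) (use nontrivial in auto)

text \<open>Consistency is inherited from the random sets \<open>Z \<tau>\<close> in the limit.\<close>
lemma pattern_weight_marginal:
  assumes B: "finite B" and A: "A \<subseteq> B" "C \<subseteq> A"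
  shows "(\<Sum>C'\<in>{C'\<in>Pow B. C' \<inter> A = C}. pattern_weight r B C') = pattern_weight r A C"
proof -
  have "((\<lambda>\<tau>. \<Sum>C'\<in>{C'\<in>Pow B. C' \<inter> A = C}. prob {\<omega> \<in> space M. Z \<tau> \<omega> \<inter> B = C'}) \<longlongrightarrow>
      (\<Sum>C'\<in>{C'\<in>Pow B. C' \<inter> A = C}. pattern_weight r B C')) F"
    by (intro tendsto_sum pattern_weight_limit B) auto
  moreover have "\<forall>\<^sub>F \<tau> in F. (\<Sum>C'\<in>{C'\<in>Pow B. C' \<inter> A = C}. prob {\<omega> \<in> space M. Z \<tau> \<omega> \<inter> B = C'}) =
      prob {\<omega> \<in> space M. Z \<tau> \<omega> \<inter> A = C}"
    using eventually_events[OF B]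
  proof eventually_elim
    case (elim \<tau>)
    have "(\<Sum>C'\<in>{C'\<in>Pow B. C' \<inter> A = C}. prob {\<omega> \<in> space M. Z \<tau> \<omega> \<inter> B = C'}) =
        prob (\<Union>C'\<in>{C'\<in>Pow B. C' \<inter> A = C}. {\<omega> \<in> space M. Z \<tau> \<omega> \<inter> B = C'})"
      using B elim
      by (intro finite_measure_finite_Union[symmetric])
        (auto simp: disjoint_family_on_def intro!: random_set_pattern_event)
    also have "(\<Union>C'\<in>{C'\<in>Pow B. C' \<inter> A = C}. {\<omega> \<in> space M. Z \<tau> \<omega> \<inter> B = C'}) =
        {\<omega> \<in> space M. Z \<tau> \<omega> \<inter> A = C}"
      using A by auto
    finally show ?case .
  qed
  ultimately have "((\<lambda>\<tau>. prob {\<omega> \<in> space M. Z \<tau> \<omega> \<inter> A = C}) \<longlongrightarrow>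
      (\<Sum>C'\<in>{C'\<in>Pow B. C' \<inter> A = C}. pattern_weight r B C')) F"
    by (simp add: tendsto_cong)
  then show ?thesis
    using tendsto_unique[OF nontrivial _ pattern_weight_limit[of A C]] A B by (auto intro: finite_subset)
qed

definition pattern_pmf :: "'i set \<Rightarrow> 'i set pmf" where
  "pattern_pmf B = embed_pmf (\<lambda>C. if C \<subseteq> B then pattern_weight r B C else 0)"

lemma r_empty: "r {} = 1"
  using tendsto_unique[OF nontrivial lim[of "{}"], of 1] by (simp add: prob_space)

lemma pmf_pattern_pmf:
  assumes B: "finite B"
  shows "pmf (pattern_pmf B) C = (if C \<subseteq> B then pattern_weight r B C else 0)"
  unfolding pattern_pmf_def
proof (rule pmf_embed_pmf)
  show "0 \<le> (if C \<subseteq> B then pattern_weight r B C else 0)" for C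
    using pattern_weight_nonneg[OF B] by auto
  have "(\<integral>\<^sup>+C. ennreal (if C \<subseteq> B then pattern_weight r B C else 0) \<partial>count_space UNIV) =
      (\<Sum>C\<in>Pow B. ennreal (if C \<subseteq> B then pattern_weight r B C else 0))"
    using B by (intro nn_integral_count_space') auto
  also have "\<dots> = ennreal (\<Sum>C\<in>Pow B. pattern_weight r B C)"
    using pattern_weight_nonneg[OF B] by (subst sum_ennreal[symmetric]) (auto intro!: sum.cong)
  also have "(\<Sum>C\<in>Pow B. pattern_weight r B C) = 1"
    using pattern_weight_marginal[OF B, of "{}" "{}"] r_empty
    by (simp add: pattern_weight_def[of r "{}"] Pow_def)
  finally show "(\<integral>\<^sup>+C. ennreal (if C \<subseteq> B then pattern_weight r B C else 0) \<partial>count_space UNIV) = 1"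
    by simp
qed

lemma map_pattern_pmf:
  assumes B: "finite B" and A: "A \<subseteq> B"
  shows "map_pmf (\<lambda>C. C \<inter> A) (pattern_pmf B) = pattern_pmf A"
proof (rule pmf_eqI)
  fix C
  have finA: "finite A" using A B by (rule finite_subset)
  have supp: "set_pmf (pattern_pmf B) \<subseteq> Pow B"
    by (auto simp: set_pmf_iff pmf_pattern_pmf[OF B] split: if_splits)
  have "pmf (map_pmf (\<lambda>C. C \<inter> A) (pattern_pmf B)) C = measure (pattern_pmf B) {C'. C' \<inter> A = C}"
    by (simp add: pmf_map vimage_def)
  also have "\<dots> = measure (pattern_pmf B) ({C'. C' \<inter> A = C} \<inter> Pow B)"
    using supp by (intro measure_prob_cong_0) (auto simp: set_pmf_iff)
  also have "\<dots> = (\<Sum>C'\<in>{C'\<in>Pow B. C' \<inter> A = C}. pattern_weight r B C')"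
    using B by (subst measure_measure_pmf_finite) (auto simp: pmf_pattern_pmf intro!: sum.cong)
  also have "\<dots> = pmf (pattern_pmf A) C"
  proof (cases "C \<subseteq> A")
    case True
    then show ?thesis using pattern_weight_marginal[OF B A True] by (simp add: pmf_pattern_pmf[OF finA])
  next
    case False
    then have "{C'\<in>Pow B. C' \<inter> A = C} = {}" by auto
    then show ?thesis using False by (simp only: pmf_pattern_pmf[OF finA]) simp
  qed
  finally show "pmf (map_pmf (\<lambda>C. C \<inter> A) (pattern_pmf B)) C = pmf (pattern_pmf A) C" .
qed

definition window_law :: "'i set \<Rightarrow> ('i \<Rightarrow> real) measure" where
  "window_law B = distr (measure_pmf (pattern_pmf B)) (\<Pi>\<^sub>M b\<in>B. borel) (\<lambda>C. \<lambda>b\<in>B. of_bool (b \<in> C))"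

lemma window_measurable: "(\<lambda>C. \<lambda>b\<in>B. of_bool (b \<in> C) :: real) \<in> measurable (measure_pmf p) (\<Pi>\<^sub>M b\<in>B. borel)"
  by (rule measurable_PiM_single') auto

lemma window_law_projective:
  assumes "A \<subseteq> B" "finite B"
  shows "window_law A = distr (window_law B) (\<Pi>\<^sub>M b\<in>A. borel) (\<lambda>f. restrict f A)"
proof -
  have "distr (window_law B) (\<Pi>\<^sub>M b\<in>A. borel) (\<lambda>f. restrict f A) =
      distr (measure_pmf (pattern_pmf B)) (\<Pi>\<^sub>M b\<in>A. borel) (\<lambda>C. \<lambda>b\<in>A. of_bool (b \<in> C))"
    unfolding window_law_def using assms(1)
    by (subst distr_distr[OF measurable_restrict_subset[OF assms(1)] window_measurable])
      (auto intro!: distr_cong simp: fun_eq_iff)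
  also have "\<dots> = distr (measure_pmf (map_pmf (\<lambda>C. C \<inter> A) (pattern_pmf B))) (\<Pi>\<^sub>M b\<in>A. borel) (\<lambda>C. \<lambda>b\<in>A. of_bool (b \<in> C))"
    unfolding map_pmf_rep_eq
    by (subst distr_distr) (auto intro!: distr_cong measurable_PiM_single' simp: fun_eq_iff space_PiM)
  also have "\<dots> = window_law A"
    unfolding map_pattern_pmf[OF assms(2,1)] window_law_def ..
  finally show ?thesis ..
qed

text \<open>Kolmogorov extension of the limiting window laws. Real numbers \<open>0\<close> and \<open>1\<close> encode
  occupation because the extension theorem asks for a Polish space.\<close>
lemma limit_law_exists:
  "\<exists>N :: ('i \<Rightarrow> real) measure. prob_space N \<and> sets N = sets (\<Pi>\<^sub>M b\<in>UNIV. borel) \<and>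
    (\<forall>D. finite D \<longrightarrow> measure N {f \<in> space N. \<forall>b\<in>D. 0 < f b} = r D)"
proof -
  have "prob_space (window_law J)" for J
    unfolding window_law_def by (intro prob_space.prob_space_distr prob_space_measure_pmf window_measurable)
  then interpret K: polish_projective UNIV window_law
    unfolding polish_projective_def projective_family_def using window_law_projective by auto
  have "measure K.lim {f \<in> space K.lim. \<forall>b\<in>D. 0 < f b} = r D" if D: "finite D" for D
  proof -
    let ?X = "{f \<in> space (\<Pi>\<^sub>M b\<in>D. borel). \<forall>b\<in>D. 0 < (f b :: real)}"
    have X: "?X \<in> sets (\<Pi>\<^sub>M b\<in>D. borel)"
      using D by measurable
    have "{f \<in> space K.lim. \<forall>b\<in>D. 0 < f b} = prod_emb UNIV (\<lambda>_. borel) D ?X"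
      by (auto simp: prod_emb_def space_PiM)
    then have "measure K.lim {f \<in> space K.lim. \<forall>b\<in>D. 0 < f b} = measure (window_law D) ?X"
      using K.measure_lim_emb[OF _ D X] by simp
    also have "\<dots> = measure (pattern_pmf D) {C. D \<subseteq> C}"
      unfolding window_law_def using X
      by (subst measure_distr[OF window_measurable])
        (auto simp: space_PiM intro!: arg_cong[where f="measure _"])
    also have "\<dots> = measure (pattern_pmf D) {D}"
      by (intro measure_prob_cong_0) (auto simp: pmf_pattern_pmf[OF D])
    also have "\<dots> = r D"
      by (simp add: measure_pmf_single pmf_pattern_pmf[OF D] pattern_weight_def)
    finally show ?thesis .
  qed
  then show ?thesis by (intro exI[of _ K.lim]) (auto intro: K.P.prob_space_axioms)
qed

end

section \<open>From correlations to finite-dimensional distributions\<close>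

definition occupied :: "(real \<Rightarrow> 'w \<Rightarrow> config) \<Rightarrow> real \<Rightarrow> 'w \<Rightarrow> (real \<times> int) set" where
  "occupied \<Xi> \<tau> \<omega> = {b. 0 < \<Xi> (fst b + \<tau>) \<omega> (snd b)}"

definition simple_path :: "real set \<Rightarrow> (real \<times> int) set \<Rightarrow> real \<Rightarrow> config" where
  "simple_path J C = (\<lambda>s\<in>J. \<lambda>x. of_bool ((s, x) \<in> C))"

lemma tendsto_fun_iff:
  fixes l :: "'i \<Rightarrow> 'a::topological_space"
  shows "(f \<longlongrightarrow> l) F \<longleftrightarrow> (\<forall>i. ((\<lambda>x. f x i) \<longlongrightarrow> l i) F)"
  using limitin_componentwise[of "\<lambda>_. euclidean :: 'a topology" UNIV f l F]
  by (simp add: euclidean_product_topology)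

lemma measurable_finite_coordinates:
  fixes h :: "('i \<Rightarrow> nat) \<Rightarrow> real"
  assumes B: "finite B" and Y: "\<And>b. b \<in> B \<Longrightarrow> Y b \<in> measurable P (count_space UNIV)"
  shows "(\<lambda>\<omega>. h (\<lambda>b\<in>B. Y b \<omega>)) \<in> borel_measurable P"
proof -
  have "(\<lambda>\<omega>. \<lambda>b\<in>B. Y b \<omega>) \<in> measurable P (\<Pi>\<^sub>M b\<in>B. count_space UNIV)"
    using Y by (intro measurable_restrict) auto
  then show ?thesis
    unfolding count_space_PiM_finite[OF B countableI_type]
    by (rule measurable_compose) simp
qed

text \<open>A continuous functional is the pointwise limit of its values at configurations that
  are cut off outside finite windows, and those depend on finitely many discrete coordinates.\<close>
lemma continuous_functional_measurable:
  fixes G :: "(real \<Rightarrow> config) \<Rightarrow> real"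
  assumes J: "finite J" and X: "\<And>s. s \<in> J \<Longrightarrow> X s \<in> measurable P config_space"
    and G: "continuous_on UNIV G"
  shows "(\<lambda>\<omega>. G (\<lambda>s\<in>J. X s \<omega>)) \<in> borel_measurable P"
proof (rule borel_measurable_LIMSEQ_real)
  define B where "B n = J \<times> {-int n..int n}" for n
  define h where "h n f = G (\<lambda>s\<in>J. \<lambda>x. if \<bar>x\<bar> \<le> int n then f (s, x) else 0)" for n and f :: "real \<times> int \<Rightarrow> nat"
  show "(\<lambda>\<omega>. h n (\<lambda>b\<in>B n. X (fst b) \<omega> (snd b))) \<in> borel_measurable P" for n
    using J by (intro measurable_finite_coordinates config_space_coordinate X) (auto simp: B_def)
  fix \<omega>
  have "(\<lambda>n. G (\<lambda>s\<in>J. \<lambda>x. if \<bar>x\<bar> \<le> int n then X s \<omega> x else 0)) \<longlonglongrightarrow> G (\<lambda>s\<in>J. X s \<omega>)"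
  proof (rule continuous_on_tendsto_compose[OF G])
    show "(\<lambda>n. \<lambda>s\<in>J. \<lambda>x. if \<bar>x\<bar> \<le> int n then X s \<omega> x else 0) \<longlonglongrightarrow> (\<lambda>s\<in>J. X s \<omega>)"
    proof (subst tendsto_fun_iff, rule allI)
      fix s
      show "(\<lambda>n. (\<lambda>s\<in>J. \<lambda>x. if \<bar>x\<bar> \<le> int n then X s \<omega> x else 0) s) \<longlonglongrightarrow> (\<lambda>s\<in>J. X s \<omega>) s"
      proof (cases "s \<in> J")
        case True
        have "(\<lambda>n. if \<bar>x\<bar> \<le> int n then X s \<omega> x else 0) \<longlonglongrightarrow> X s \<omega> x" for x
          by (rule tendsto_eventually, rule eventually_sequentiallyI[of "nat \<bar>x\<bar>"]) auto
        then show ?thesis using True by (simp add: tendsto_fun_iff)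
      qed simp
    qed
  qed auto
  moreover have "h n (\<lambda>b\<in>B n. X (fst b) \<omega> (snd b)) = G (\<lambda>s\<in>J. \<lambda>x. if \<bar>x\<bar> \<le> int n then X s \<omega> x else 0)" for n
    unfolding h_def by (intro arg_cong[where f = G]) (auto simp: B_def fun_eq_iff)
  ultimately show "(\<lambda>n. h n (\<lambda>b\<in>B n. X (fst b) \<omega> (snd b))) \<longlonglongrightarrow> G (\<lambda>s\<in>J. X s \<omega>)"
    by simp
qed

lemma compact_zero_one: "compact {h :: 'i \<Rightarrow> real. \<forall>i. h i \<in> {0, 1}}"
proof -
  have "{h :: 'i \<Rightarrow> real. \<forall>i. h i \<in> {0, 1}} = PiE UNIV (\<lambda>_. {0, 1})"
    by (simp add: PiE_UNIV_domain Pi_def)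
  moreover have "compactin (product_topology (\<lambda>_ :: 'i. euclidean :: real topology) UNIV) (PiE UNIV (\<lambda>_. {0, 1}))"
    by (subst compactin_PiE) (simp add: finite_imp_compact)
  ultimately show ?thesis by (simp add: euclidean_product_topology)
qed

text \<open>Uniform continuity on a compact space of \<open>{0, 1}\<close>-valued functions. The finitely many times are
  replaced by natural numbers, since functions on a countable set carry a metric in which
  agreement on finitely many coordinates means closeness.\<close>
lemma continuous_functional_truncation:
  fixes G :: "(real \<Rightarrow> config) \<Rightarrow> real"
  assumes J: "finite J" and G: "continuous_on UNIV G" and \<epsilon>: "0 < \<epsilon>"
  obtains n where "\<And>C. \<bar>G (simple_path J C) - G (simple_path J (C \<inter> J \<times> {-int n..int n}))\<bar> < \<epsilon>"
proof -
  define K where "K = {h :: nat \<times> int \<Rightarrow> real. \<forall>i. h i \<in> {0, 1}}"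
  define g where "g h = G (\<lambda>s\<in>J. \<lambda>x. nat \<lfloor>h (to_nat_on J s, x)\<rfloor>)" for h :: "nat \<times> int \<Rightarrow> real"
  have inj: "inj_on (to_nat_on J) J" using J by (intro inj_on_to_nat_on countable_finite)
  have "continuous_on K g"
    unfolding g_def
  proof (rule continuous_on_compose2[OF G])
    show "continuous_on K (\<lambda>h. \<lambda>s\<in>J. \<lambda>x. nat \<lfloor>h (to_nat_on J s, x)\<rfloor>)"
    proof (rule continuous_on_coordinatewise_then_product)
      fix s
      have "continuous_on K (\<lambda>h. nat \<lfloor>h i\<rfloor>)" for i
      proof (rule continuous_on_compose2[where g = "\<lambda>u. nat \<lfloor>u\<rfloor>" and f = "\<lambda>h. h i" and t = "{0, 1}"])
        show "continuous_on {0, 1 :: real} (\<lambda>u. nat \<lfloor>u\<rfloor>)" by (rule continuous_on_finite) simp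
        show "continuous_on K (\<lambda>h. h i)"
          by (rule continuous_on_subset[OF continuous_on_product_coordinates]) simp
      qed (use K_def in blast)
      then show "continuous_on K (\<lambda>h. (\<lambda>s\<in>J. \<lambda>x. nat \<lfloor>h (to_nat_on J s, x)\<rfloor>) s)"
        by (cases "s \<in> J") (simp_all add: continuous_on_coordinatewise_then_product)
    qed
  qed auto
  then have "uniformly_continuous_on K g"
    unfolding K_def by (rule compact_uniformly_continuous[OF _ compact_zero_one])
  then obtain \<delta> where \<delta>: "0 < \<delta>"
    "\<forall>h\<in>K. \<forall>h'\<in>K. dist h' h < \<delta> \<longrightarrow> dist (g h') (g h) < \<epsilon>"
    using \<epsilon> unfolding uniformly_continuous_on_def by metis
  obtain N where N: "(1 / 2 :: real) ^ N < \<delta>" using real_arch_pow_inv[OF \<delta>(1), of "1/2"] by auto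
  define n where "n = nat (Max ((\<lambda>i. \<bar>snd (from_nat i :: nat \<times> int)\<bar>) ` {..N}))"
  have n: "\<bar>snd (from_nat i :: nat \<times> int)\<bar> \<le> int n" if "i \<le> N" for i
  proof -
    have "\<bar>snd (from_nat i :: nat \<times> int)\<bar> \<le> Max ((\<lambda>i. \<bar>snd (from_nat i :: nat \<times> int)\<bar>) ` {..N})"
      using that by (intro Max_ge) auto
    then show ?thesis unfolding n_def by linarith
  qed
  show thesis
  proof (rule that)
    fix C :: "(real \<times> int) set"
    define h where "h C' p = (of_bool (\<exists>s\<in>J. fst p = to_nat_on J s \<and> (s, snd p) \<in> C') :: real)" for C' and p :: "nat \<times> int"
    have h_K: "h C' \<in> K" for C'
      unfolding K_def h_def by (simp only: mem_Collect_eq insert_iff of_bool_def) simp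
    have path: "simple_path J C' = (\<lambda>s\<in>J. \<lambda>x. nat \<lfloor>h C' (to_nat_on J s, x)\<rfloor>)" for C'
    proof -
      have "h C' (to_nat_on J s, x) = of_bool ((s, x) \<in> C')" if "s \<in> J" for s x
      proof -
        have "(\<exists>s'\<in>J. to_nat_on J s = to_nat_on J s' \<and> (s', x) \<in> C') \<longleftrightarrow> (s, x) \<in> C'"
          using inj that by (metis inj_onD)
        then show ?thesis unfolding h_def by simp
      qed
      then show ?thesis
        unfolding simple_path_def by (intro restrict_ext ext) simp
    qed
    let ?C = "C \<inter> J \<times> {-int n..int n}"
    have agree: "h ?C (from_nat i) = h C (from_nat i)" if "i \<le> N" for i
    proof -
      have "snd (from_nat i :: nat \<times> int) \<in> {-int n..int n}"
        using n[OF that] unfolding atLeastAtMost_iff by linarith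
      then show ?thesis unfolding h_def by simp
    qed
    have "dist (h ?C) (h C) \<le> 2 * Max {dist (h ?C (from_nat i)) (h C (from_nat i)) |i. i \<le> N} + (1/2)^N"
      by (rule dist_fun_le_dist_first_terms)
    also have "{dist (h ?C (from_nat i)) (h C (from_nat i)) |i. i \<le> N} = {0}"
    proof -
      have "{dist (h ?C (from_nat i)) (h C (from_nat i)) |i. i \<le> N} = (\<lambda>_. 0) ` {..N}"
        unfolding setcompr_eq_image by (intro image_cong) (simp_all add: agree atMost_def)
      then show ?thesis by (simp add: image_constant_conv)
    qed
    also have "2 * Max {0} + (1/2)^N < \<delta>" using N by simp
    finally have "dist (g (h ?C)) (g (h C)) < \<epsilon>"
      using \<delta>(2) h_K by blast
    then show "\<bar>G (simple_path J C) - G (simple_path J ?C)\<bar> < \<epsilon>"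
      unfolding path g_def by (simp add: dist_real_def abs_minus_commute)
  qed
qed

lemma occupied_event:
  assumes "X \<in> measurable P config_space"
  shows "{\<omega> \<in> space P. 0 < X \<omega> x} \<in> sets P"
  using measurable_sets[OF config_space_coordinate[OF assms, of x], of "{0<..}"]
  by (simp add: vimage_def Int_def conj_commute)

text \<open>Almost surely the configurations at the times \<open>s + \<tau>\<close> are \<open>{0, 1}\<close>-valued, so that the uniform
  approximation applies to the integrand.\<close>
lemma (in prob_space) functional_truncation_error:
  fixes G :: "(real \<Rightarrow> config) \<Rightarrow> real"
  assumes J: "finite J" and X: "\<And>s. s \<in> J \<Longrightarrow> X (s + \<tau>) \<in> measurable M config_space"
    and le1: "\<And>s x. s \<in> J \<Longrightarrow> AE \<omega> in M. X (s + \<tau>) \<omega> x \<le> 1"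
    and G: "continuous_on UNIV G" and bdd: "bounded (range G)"
    and trunc: "\<And>C. \<bar>G (simple_path J C) - G (simple_path J (C \<inter> J \<times> {-int n..int n}))\<bar> < \<epsilon>"
  shows "\<bar>(\<integral>\<omega>. G (\<lambda>s\<in>J. X (s + \<tau>) \<omega>) \<partial>M) -
    (\<integral>\<omega>. G (simple_path J (occupied X \<tau> \<omega> \<inter> J \<times> {-int n..int n})) \<partial>M)\<bar> \<le> \<epsilon>"
proof -
  let ?B = "J \<times> {-int n..int n}"
  obtain K where K: "\<And>f. \<bar>G f\<bar> \<le> K" using bdd unfolding bounded_iff by (metis UNIV_I image_eqI real_norm_def)
  have 1: "integrable M (\<lambda>\<omega>. G (\<lambda>s\<in>J. X (s + \<tau>) \<omega>))"
    by (intro integrable_const_bound[of _ K] continuous_functional_measurable[OF J _ G] X) (auto intro: K)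
  have 2: "integrable M (\<lambda>\<omega>. G (simple_path J (occupied X \<tau> \<omega> \<inter> ?B)))"
  proof (rule integrable.intros, rule random_set_pattern_expectation)
    show "{\<omega> \<in> space M. b \<in> occupied X \<tau> \<omega>} \<in> events" if "b \<in> ?B" for b
      using that by (auto simp: occupied_def intro!: occupied_event X)
  qed (use J in auto)
  have "AE \<omega> in M. \<forall>s\<in>J. \<forall>x. X (s + \<tau>) \<omega> x \<le> 1"
    using J le1 by (intro AE_finite_allI) (auto simp: AE_all_countable)
  then have "AE \<omega> in M. \<bar>G (\<lambda>s\<in>J. X (s + \<tau>) \<omega>) - G (simple_path J (occupied X \<tau> \<omega> \<inter> ?B))\<bar> \<le> \<epsilon>"
  proof eventually_elim
    case (elim \<omega>)
    have "X (s + \<tau>) \<omega> x = of_bool (0 < X (s + \<tau>) \<omega> x)" if "s \<in> J" for s x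
      using elim that by (auto simp: of_bool_def) (metis One_nat_def le_antisym Suc_leI)
    then have "(\<lambda>s\<in>J. X (s + \<tau>) \<omega>) = simple_path J (occupied X \<tau> \<omega>)"
      by (auto simp: simple_path_def occupied_def fun_eq_iff)
    then show ?case using trunc[of "occupied X \<tau> \<omega>"] by simp
  qed
  then have "(\<integral>\<omega>. \<bar>G (\<lambda>s\<in>J. X (s + \<tau>) \<omega>) - G (simple_path J (occupied X \<tau> \<omega> \<inter> ?B))\<bar> \<partial>M) \<le> (\<integral>\<omega>. \<epsilon> \<partial>M)"
    using 1 2 by (intro integral_mono_AE) auto
  moreover have "\<bar>\<integral>\<omega>. G (\<lambda>s\<in>J. X (s + \<tau>) \<omega>) - G (simple_path J (occupied X \<tau> \<omega> \<inter> ?B)) \<partial>M\<bar> \<le>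
     (\<integral>\<omega>. \<bar>G (\<lambda>s\<in>J. X (s + \<tau>) \<omega>) - G (simple_path J (occupied X \<tau> \<omega> \<inter> ?B))\<bar> \<partial>M)"
    by (rule integral_abs_bound)
  ultimately show ?thesis using 1 2 by (simp add: prob_space)
qed

text \<open>Functionals of a finite window converge since the probabilities of all patterns do; the
  error of the approximation by such functionals does not depend on \<open>\<tau>\<close>.\<close>
lemma shifted_fdd_convergenceI:
  assumes M: "config_process M \<Xi>" and M1: "\<And>t x. 0 \<le> t \<Longrightarrow> AE \<omega> in M. \<Xi> t \<omega> x \<le> 1"
    and N: "config_process N \<Upsilon>" and N1: "\<And>t x. 0 \<le> t \<Longrightarrow> AE \<omega> in N. \<Upsilon> t \<omega> x \<le> 1"
    and lim: "\<And>D. finite D \<Longrightarrow> ((\<lambda>\<tau>. measure M {\<omega> \<in> space M. D \<subseteq> occupied \<Xi> \<tau> \<omega>}) \<longlongrightarrow> r D) at_top"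
    and r: "\<And>D. finite D \<Longrightarrow> D \<subseteq> {0..} \<times> UNIV \<Longrightarrow> measure N {\<omega> \<in> space N. D \<subseteq> occupied \<Upsilon> 0 \<omega>} = r D"
  shows "shifted_fdd_convergence M \<Xi> N \<Upsilon>"
  unfolding shifted_fdd_convergence_def
proof (intro allI impI)
  fix J :: "real set" and G :: "(real \<Rightarrow> config) \<Rightarrow> real"
  assume "finite J \<and> J \<subseteq> {0..}" and "continuous_on UNIV G \<and> bounded (range G)"
  then have J: "finite J" "J \<subseteq> {0..}" and G: "continuous_on UNIV G" "bounded (range G)" by auto
  have M_meas: "\<Xi> t \<in> measurable M config_space" if "0 \<le> t" for t
    using M that by (simp add: config_process_def)
  have N_meas: "\<Upsilon> t \<in> measurable N config_space" if "0 \<le> t" for t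
    using N that by (simp add: config_process_def)
  interpret N: prob_space N using N by (simp add: config_process_def)
  interpret M: prob_space M using M by (simp add: config_process_def)
  interpret M: random_set_limit M "occupied \<Xi>" at_top r
  proof
    fix b :: "real \<times> int"
    show "\<forall>\<^sub>F \<tau> in at_top. {\<omega> \<in> space M. b \<in> occupied \<Xi> \<tau> \<omega>} \<in> M.events"
      using eventually_ge_at_top[of "- fst b"]
      by eventually_elim (simp add: occupied_def, intro occupied_event M_meas, simp)
  qed (use lim in auto)
  show "((\<lambda>\<tau>. \<integral>\<omega>. G (\<lambda>s\<in>J. \<Xi> (s + \<tau>) \<omega>) \<partial>M) \<longlongrightarrow> (\<integral>\<omega>. G (\<lambda>s\<in>J. \<Upsilon> s \<omega>) \<partial>N)) at_top"
  proof (rule tendstoI)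
    fix e :: real assume e: "0 < e"
    obtain n where n: "\<And>C. \<bar>G (simple_path J C) - G (simple_path J (C \<inter> J \<times> {-int n..int n}))\<bar> < e / 4"
      using continuous_functional_truncation[OF J(1) G(1), of "e / 4"] e by auto
    let ?B = "J \<times> {-int n..int n}"
    let ?H = "\<lambda>C. G (simple_path J C)"
    have B: "finite ?B" using J by simp
    have "(\<integral>\<omega>. ?H (occupied \<Upsilon> 0 \<omega> \<inter> ?B) \<partial>N) =
        (\<Sum>C\<in>Pow ?B. ?H C * pattern_weight (\<lambda>D. measure N {\<omega> \<in> space N. D \<subseteq> occupied \<Upsilon> 0 \<omega>}) ?B C)"
      using J by (intro has_bochner_integral_integral_eq N.random_set_pattern_expectation B)
        (auto simp: occupied_def intro!: occupied_event N_meas)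
    also have "\<dots> = (\<Sum>C\<in>Pow ?B. ?H C * pattern_weight r ?B C)"
      unfolding pattern_weight_def using J B
      by (intro sum.cong refl arg_cong2[where f="(*)"] r) (auto intro: finite_subset)
    finally have "((\<lambda>\<tau>. \<integral>\<omega>. ?H (occupied \<Xi> \<tau> \<omega> \<inter> ?B) \<partial>M) \<longlongrightarrow> (\<integral>\<omega>. ?H (occupied \<Upsilon> 0 \<omega> \<inter> ?B) \<partial>N)) at_top"
      using M.expectation_limit[OF B, of ?H] by simp
    then have "\<forall>\<^sub>F \<tau> in at_top. dist (\<integral>\<omega>. ?H (occupied \<Xi> \<tau> \<omega> \<inter> ?B) \<partial>M) (\<integral>\<omega>. ?H (occupied \<Upsilon> 0 \<omega> \<inter> ?B) \<partial>N) < e / 4"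
      using e by (intro tendstoD) auto
    moreover have "\<forall>\<^sub>F \<tau> :: real in at_top. 0 \<le> \<tau>" by (rule eventually_ge_at_top)
    ultimately show "\<forall>\<^sub>F \<tau> in at_top. dist (\<integral>\<omega>. G (\<lambda>s\<in>J. \<Xi> (s + \<tau>) \<omega>) \<partial>M) (\<integral>\<omega>. G (\<lambda>s\<in>J. \<Upsilon> s \<omega>) \<partial>N) < e"
    proof eventually_elim
      case (elim \<tau>)
      have "\<bar>(\<integral>\<omega>. G (\<lambda>s\<in>J. \<Xi> (s + \<tau>) \<omega>) \<partial>M) - (\<integral>\<omega>. ?H (occupied \<Xi> \<tau> \<omega> \<inter> ?B) \<partial>M)\<bar> \<le> e / 4"
        using elim(2) J by (intro M.functional_truncation_error G n M_meas M1) auto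
      moreover have "\<bar>(\<integral>\<omega>. G (\<lambda>s\<in>J. \<Upsilon> (s + 0) \<omega>) \<partial>N) - (\<integral>\<omega>. ?H (occupied \<Upsilon> 0 \<omega> \<inter> ?B) \<partial>N)\<bar> \<le> e / 4"
        using J by (intro N.functional_truncation_error G n N_meas N1) auto
      ultimately show ?case using elim(1) e unfolding dist_real_def add_0_right by linarith
    qed
  qed
qed

section \<open>Laws and Fredholm expansions from correlations\<close>

text \<open>Cylinder events of \<open>{0, 1}\<close>-valued configurations are unions of patterns, whose probabilities
  are determined by those of occupied sets. The cylinder events determine the law on the
  product over \<open>J \<times> UNIV\<close>, of which the joint law is an image.\<close>
lemma (in prob_space) joint_distr_eqI:
  fixes X Y :: "real \<Rightarrow> 'a \<Rightarrow> config"
  assumes J: "finite J"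
    and X: "\<And>s. s \<in> J \<Longrightarrow> X s \<in> measurable M config_space" "\<And>s x. s \<in> J \<Longrightarrow> AE \<omega> in M. X s \<omega> x \<le> 1"
    and Y: "\<And>s. s \<in> J \<Longrightarrow> Y s \<in> measurable M config_space" "\<And>s x. s \<in> J \<Longrightarrow> AE \<omega> in M. Y s \<omega> x \<le> 1"
    and eq: "\<And>D. finite D \<Longrightarrow> D \<subseteq> J \<times> UNIV \<Longrightarrow>
      prob {\<omega> \<in> space M. D \<subseteq> occupied X 0 \<omega>} = prob {\<omega> \<in> space M. D \<subseteq> occupied Y 0 \<omega>}"
  shows "distr M (\<Pi>\<^sub>M s\<in>J. config_space) (\<lambda>\<omega>. \<lambda>s\<in>J. X s \<omega>) =
    distr M (\<Pi>\<^sub>M s\<in>J. config_space) (\<lambda>\<omega>. \<lambda>s\<in>J. Y s \<omega>)"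
proof -
  define I where "I = J \<times> (UNIV :: int set)"
  let ?P = "\<Pi>\<^sub>M b\<in>I. count_space (UNIV :: nat set)"
  define flat where "flat Z \<omega> = (\<lambda>b\<in>I. Z (fst b) \<omega> (snd b))" for Z :: "real \<Rightarrow> 'a \<Rightarrow> config" and \<omega>
  define unflat where "unflat f = (\<lambda>s\<in>J. \<lambda>x. f (s, x))" for f :: "real \<times> int \<Rightarrow> nat"
  have unflat: "unflat \<in> measurable ?P (\<Pi>\<^sub>M s\<in>J. config_space)"
    unfolding unflat_def config_space_def
    by (intro measurable_restrict measurable_PiM_single') (auto simp: I_def space_PiM)
  have flat: "flat Z \<in> measurable M ?P" if "\<And>s. s \<in> J \<Longrightarrow> Z s \<in> measurable M config_space" for Z
    unfolding flat_def using that by (intro measurable_restrict config_space_coordinate) (auto simp: I_def)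
  have cylinder: "emeasure M {\<omega> \<in> space M. \<forall>b\<in>K. Z (fst b) \<omega> (snd b) \<in> A b} =
      ennreal (\<Sum>C\<in>Pow K. of_bool (\<forall>b\<in>K. of_bool (b \<in> C) \<in> A b) *
        pattern_weight (\<lambda>D. prob {\<omega> \<in> space M. D \<subseteq> occupied Z 0 \<omega>}) K C)"
    if Z: "\<And>s. s \<in> J \<Longrightarrow> Z s \<in> measurable M config_space" "\<And>s x. s \<in> J \<Longrightarrow> AE \<omega> in M. Z s \<omega> x \<le> 1"
      and K: "finite K" "K \<subseteq> I" for Z K and A :: "real \<times> int \<Rightarrow> nat set"
  proof -
    define H :: "(real \<times> int) set \<Rightarrow> real" where "H C = of_bool (\<forall>b\<in>K. of_bool (b \<in> C) \<in> A b)" for C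
    have bochner: "has_bochner_integral M (\<lambda>\<omega>. H (occupied Z 0 \<omega> \<inter> K))
        (\<Sum>C\<in>Pow K. H C * pattern_weight (\<lambda>D. prob {\<omega> \<in> space M. D \<subseteq> occupied Z 0 \<omega>}) K C)"
      by (rule random_set_pattern_expectation[OF _ K(1)])
        (use K in \<open>auto simp: occupied_def I_def intro!: occupied_event Z\<close>)
    have ev: "{\<omega> \<in> space M. \<forall>b\<in>K. Z (fst b) \<omega> (snd b) \<in> A b} \<in> events"
    proof (rule sets.sets_Collect_finite_All[OF _ K(1)])
      fix b assume "b \<in> K"
      then have "(\<lambda>\<omega>. Z (fst b) \<omega> (snd b)) \<in> measurable M (count_space UNIV)"
        using K(2) by (intro config_space_coordinate Z) (auto simp: I_def)
      from measurable_sets[OF this, of "A b"] show "{\<omega> \<in> space M. Z (fst b) \<omega> (snd b) \<in> A b} \<in> events"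
        by (simp add: vimage_def Int_def conj_commute)
    qed
    have "AE \<omega> in M. \<forall>b\<in>K. Z (fst b) \<omega> (snd b) \<le> 1"
      using K Z(2) by (intro AE_finite_allI) (auto simp: I_def)
    then have "AE \<omega> in M. indicator {\<omega> \<in> space M. \<forall>b\<in>K. Z (fst b) \<omega> (snd b) \<in> A b} \<omega> = H (occupied Z 0 \<omega> \<inter> K)"
      using AE_space
    proof eventually_elim
      case (elim \<omega>)
      have "of_bool (b \<in> occupied Z 0 \<omega> \<inter> K) = Z (fst b) \<omega> (snd b)" if "b \<in> K" for b
      proof -
        have "Z (fst b) \<omega> (snd b) \<le> 1" using elim(1) that by blast
        then have "Z (fst b) \<omega> (snd b) = 0 \<or> Z (fst b) \<omega> (snd b) = 1" by linarith
        then show ?thesis using that by (auto simp: occupied_def)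
      qed
      then have "(\<forall>b\<in>K. of_bool (b \<in> occupied Z 0 \<omega> \<inter> K) \<in> A b) \<longleftrightarrow> (\<forall>b\<in>K. Z (fst b) \<omega> (snd b) \<in> A b)"
        by metis
      then show ?case using elim(2) by (simp only: H_def) (simp add: indicator_def)
    qed
    then have "has_bochner_integral M (indicator {\<omega> \<in> space M. \<forall>b\<in>K. Z (fst b) \<omega> (snd b) \<in> A b} :: _ \<Rightarrow> real)
        (\<Sum>C\<in>Pow K. H C * pattern_weight (\<lambda>D. prob {\<omega> \<in> space M. D \<subseteq> occupied Z 0 \<omega>}) K C)"
      using iffD2[OF has_bochner_integral_cong_AE[OF borel_measurable_indicator[OF ev]
          borel_measurable_has_bochner_integral[OF bochner]] bochner] by blast
    moreover have "has_bochner_integral M (indicator {\<omega> \<in> space M. \<forall>b\<in>K. Z (fst b) \<omega> (snd b) \<in> A b} :: _ \<Rightarrow> real)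
        (prob {\<omega> \<in> space M. \<forall>b\<in>K. Z (fst b) \<omega> (snd b) \<in> A b})"
      by (rule has_bochner_integral_real_indicator[OF ev]) (simp add: emeasure_eq_measure)
    ultimately have "prob {\<omega> \<in> space M. \<forall>b\<in>K. Z (fst b) \<omega> (snd b) \<in> A b} =
        (\<Sum>C\<in>Pow K. H C * pattern_weight (\<lambda>D. prob {\<omega> \<in> space M. D \<subseteq> occupied Z 0 \<omega>}) K C)"
      by (rule has_bochner_integral_eq[symmetric])
    then show ?thesis unfolding H_def by (simp add: emeasure_eq_measure)
  qed
  have "distr M ?P (flat X) = distr M ?P (flat Y)"
  proof (rule measure_eqI_PiM_infinite)
    fix A :: "real \<times> int \<Rightarrow> nat set" and K assume K: "finite K" "K \<subseteq> I"
    have XY: "emeasure (distr M ?P (flat Z)) (prod_emb I (\<lambda>_. count_space UNIV) K (Pi\<^sub>E K A)) =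
        emeasure M {\<omega> \<in> space M. \<forall>b\<in>K. Z (fst b) \<omega> (snd b) \<in> A b}"
      if "\<And>s. s \<in> J \<Longrightarrow> Z s \<in> measurable M config_space" for Z
    proof -
      have "flat Z -` prod_emb I (\<lambda>_. count_space UNIV) K (Pi\<^sub>E K A) \<inter> space M =
          {\<omega> \<in> space M. \<forall>b\<in>K. Z (fst b) \<omega> (snd b) \<in> A b}"
      proof -
        have "restrict (flat Z \<omega>) K = (\<lambda>b\<in>K. Z (fst b) \<omega> (snd b))" for \<omega>
          using K(2) by (auto simp: flat_def fun_eq_iff restrict_def)
        moreover have "flat Z \<omega> \<in> (\<Pi>\<^sub>E i\<in>I. UNIV)" for \<omega>
          by (simp add: flat_def)
        moreover have "flat Z \<omega> i = Z (fst i) \<omega> (snd i)" if "i \<in> K" for \<omega> i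
          using K(2) that by (auto simp: flat_def)
        ultimately show ?thesis
          by (simp add: prod_emb_def Pi_iff vimage_def Int_def conj_commute cong: ball_cong)
      qed
      then show ?thesis
        using K by (subst emeasure_distr[OF flat[OF that]]) (auto intro!: sets_PiM_I)
    qed
    have "pattern_weight (\<lambda>D. prob {\<omega> \<in> space M. D \<subseteq> occupied X 0 \<omega>}) K C =
        pattern_weight (\<lambda>D. prob {\<omega> \<in> space M. D \<subseteq> occupied Y 0 \<omega>}) K C" if "C \<subseteq> K" for C
      unfolding pattern_weight_def using that K
      by (intro sum.cong refl arg_cong2[where f="(*)"] eq) (auto simp: I_def intro: finite_subset)
    then show "emeasure (distr M ?P (flat X)) (prod_emb I (\<lambda>_. count_space UNIV) K (Pi\<^sub>E K A)) =
        emeasure (distr M ?P (flat Y)) (prod_emb I (\<lambda>_. count_space UNIV) K (Pi\<^sub>E K A))"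
      using XY[of X] XY[of Y] cylinder[of X K A] cylinder[of Y K A] X Y K by simp
  next
    show "finite_measure (distr M ?P (flat X))"
      by (intro prob_space.finite_measure prob_space_distr flat X)
  qed simp_all
  then have "distr (distr M ?P (flat X)) (\<Pi>\<^sub>M s\<in>J. config_space) unflat =
      distr (distr M ?P (flat Y)) (\<Pi>\<^sub>M s\<in>J. config_space) unflat" by simp
  moreover have "unflat \<circ> flat Z = (\<lambda>\<omega>. \<lambda>s\<in>J. Z s \<omega>)" for Z
    by (auto simp: unflat_def flat_def I_def fun_eq_iff)
  ultimately show ?thesis
    using X(1) Y(1) by (simp add: distr_distr[OF unflat flat])
qed

text \<open>A family of increasing lists is the same as a finite set of pairs \<open>(m, x)\<close>, and lists that
  leave the support of \<open>w\<close> contribute \<open>0\<close>.\<close>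
lemma fredholm_det_eq_sum:
  assumes A: "\<And>m. m \<in> {1..M} \<Longrightarrow> finite (A m)" and w: "\<And>m x. m \<in> {1..M} \<Longrightarrow> x \<notin> A m \<Longrightarrow> w m x = 0"
  shows "fredholm_det M w K = (\<Sum>D\<in>Pow (SIGMA m:{1..M}. A m).
    (\<Prod>(m, x)\<in>D. w m x) * det_on D (\<lambda>(m, x) (n, y). K m x n y))"
proof -
  define P where "P = (\<Pi>\<^sub>E m\<in>{1..M}. {xs :: int list. sorted_wrt (<) xs})"
  define Q where "Q = {x \<in> P. \<forall>m\<in>{1..M}. set (x m) \<subseteq> A m}"
  define F where "F x = (\<Prod>m\<in>{1..M}. \<Prod>j<length (x m). w m (x m ! j)) *
        det_on (SIGMA m:{1..M}. {..<length (x m)}) (\<lambda>(m, j) (n, k). K m (x m ! j) n (x n ! k))" for x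
  define S where "S x = (SIGMA m:{1..M}. set (x m))" for x :: "nat \<Rightarrow> int list"
  define L where "L D = (\<lambda>m\<in>{1..M}. sorted_list_of_set {x. (m, x) \<in> D})" for D :: "(nat \<times> int) set"
  have zero: "F x = 0" if x: "x \<in> P - Q" for x
  proof -
    have "\<not> (\<forall>m\<in>{1..M}. set (x m) \<subseteq> A m)" using x by (simp add: Q_def)
    then obtain m y where m: "m \<in> {1..M}" and y: "y \<in> set (x m)" "y \<notin> A m" by blast
    then obtain j where "j < length (x m)" "w m (x m ! j) = 0" using w by (metis in_set_conv_nth)
    then have "(\<Prod>j<length (x m). w m (x m ! j)) = 0" by (intro prod_zero) auto
    then have "(\<Prod>m\<in>{1..M}. \<Prod>j<length (x m). w m (x m ! j)) = 0" using m by (intro prod_zero) auto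
    then show ?thesis by (simp add: F_def)
  qed
  have F_eq: "F x = (\<Prod>(m, x)\<in>S x. w m x) * det_on (S x) (\<lambda>(m, x) (n, y). K m x n y)" if "x \<in> P" for x
  proof -
    have dist: "distinct (x m)" if "m \<in> {1..M}" for m
      using \<open>x \<in> P\<close> that by (auto simp: P_def PiE_iff strict_sorted_iff)
    have nth: "bij_betw (\<lambda>j. x m ! j) {..<length (x m)} (set (x m))" if "m \<in> {1..M}" for m
      using dist[OF that] by (intro bij_betw_nth) auto
    define e where "e = (\<lambda>(m, j). (m, x m ! j))"
    have bij: "bij_betw e (SIGMA m:{1..M}. {..<length (x m)}) (S x)"
      unfolding e_def S_def by (rule bij_betw_imageI)
        (use dist in \<open>auto simp: inj_on_def nth_eq_iff_index_eq in_set_conv_nth image_iff\<close>)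
    have "(\<Prod>m\<in>{1..M}. \<Prod>j<length (x m). w m (x m ! j)) = (\<Prod>m\<in>{1..M}. \<Prod>y\<in>set (x m). w m y)"
      using nth by (intro prod.cong refl prod.reindex_bij_betw) auto
    also have "\<dots> = (\<Prod>(m, x)\<in>S x. w m x)" unfolding S_def by (rule prod.Sigma) auto
    finally have 1: "(\<Prod>m\<in>{1..M}. \<Prod>j<length (x m). w m (x m ! j)) = (\<Prod>(m, x)\<in>S x. w m x)" .
    have "det_on (S x) (\<lambda>(m, x) (n, y). K m x n y) =
        det_on (SIGMA m:{1..M}. {..<length (x m)}) (\<lambda>i j. (\<lambda>(m, x) (n, y). K m x n y) (e i) (e j))"
      by (rule det_on_reindex[OF bij]) auto
    also have "(\<lambda>i j. (\<lambda>(m, x) (n, y). K m x n y) (e i) (e j)) = (\<lambda>(m, j) (n, k). K m (x m ! j) n (x n ! k))"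
      by (auto simp: e_def fun_eq_iff)
    finally show ?thesis unfolding F_def 1 by simp
  qed
  have LS: "L (S x) = x" if "x \<in> P" for x
  proof
    fix m
    show "L (S x) m = x m"
    proof (cases "m \<in> {1..M}")
      case True
      then have "sorted_wrt (<) (x m)" using that by (auto simp: P_def)
      moreover have "{y. (m, y) \<in> S x} = set (x m)" using True by (auto simp: S_def)
      ultimately show ?thesis using True
        by (simp add: L_def strict_sorted_iff sorted_list_of_set.idem_if_sorted_distinct)
    next
      case False
      then show ?thesis using that by (auto simp: L_def P_def PiE_def extensional_def)
    qed
  qed
  have D_fin: "finite {x. (m, x) \<in> D}" if "D \<subseteq> (SIGMA m:{1..M}. A m)" "m \<in> {1..M}" for D m
    by (rule finite_subset[OF _ A[OF that(2)]]) (use that in auto)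
  have bij: "bij_betw S Q (Pow (SIGMA m:{1..M}. A m))"
  proof (rule bij_betwI[where g = L])
    show "S \<in> Q \<rightarrow> Pow (SIGMA m:{1..M}. A m)" unfolding S_def Q_def by blast
    show "L \<in> Pow (SIGMA m:{1..M}. A m) \<rightarrow> Q"
      using D_fin by (auto simp: L_def Q_def P_def)
    show "L (S x) = x" if "x \<in> Q" for x using that LS by (auto simp: Q_def)
    show "S (L D) = D" if "D \<in> Pow (SIGMA m:{1..M}. A m)" for D
      using that D_fin[of D] by (auto simp: S_def L_def)
  qed
  have finQ: "finite Q"
    using bij_betw_finite[OF bij] A by auto
  have "fredholm_det M w K = (\<Sum>\<^sub>\<infinity>x\<in>P. F x)"
    unfolding fredholm_det_def P_def F_def ..
  also have "\<dots> = (\<Sum>\<^sub>\<infinity>x\<in>Q. F x)"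
    using zero by (intro infsum_cong_neutral) (auto simp: Q_def)
  also have "\<dots> = (\<Sum>x\<in>Q. F x)" using finQ by simp
  also have "\<dots> = (\<Sum>x\<in>Q. (\<Prod>(m, x)\<in>S x. w m x) * det_on (S x) (\<lambda>(m, x) (n, y). K m x n y))"
    by (intro sum.cong refl F_eq) (simp add: Q_def)
  also have "\<dots> = (\<Sum>D\<in>Pow (SIGMA m:{1..M}. A m).
    (\<Prod>(m, x)\<in>D. w m x) * det_on D (\<lambda>(m, x) (n, y). K m x n y))"
    by (rule sum.reindex_bij_betw[OF bij])
  finally show ?thesis .
qed

text \<open>Where occupation numbers are at most \<open>1\<close>, the exponential is
  \<open>\<Prod>b. 1 + (exp (f b) - 1) * indicator b\<close>; its expansion over subsets is the Fredholm
  expansion term by term.\<close>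
lemma (in prob_space) determinantal_processI:
  assumes X: "\<And>t. 0 \<le> t \<Longrightarrow> X t \<in> measurable M config_space" "\<And>t x. 0 \<le> t \<Longrightarrow> AE \<omega> in M. X t \<omega> x \<le> 1"
    and corr: "\<And>D. finite D \<Longrightarrow> D \<subseteq> {0..} \<times> UNIV \<Longrightarrow>
      prob {\<omega> \<in> space M. D \<subseteq> occupied X 0 \<omega>} = det_on D (\<lambda>b c. K (fst b) (snd b) (fst c) (snd c))"
  shows "determinantal_process M X K"
  unfolding determinantal_process_def
proof (intro allI impI)
  fix n and t :: "nat \<Rightarrow> real" and f :: "nat \<Rightarrow> int \<Rightarrow> real"
  assume "(\<forall>m\<in>{1..n}. 0 \<le> t m) \<and> strict_mono_on {1..n} t \<and> (\<forall>m\<in>{1..n}. finite {x. f m x \<noteq> 0})"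
  then have t: "\<And>m. m \<in> {1..n} \<Longrightarrow> 0 \<le> t m" and mono: "strict_mono_on {1..n} t"
    and fin: "\<And>m. m \<in> {1..n} \<Longrightarrow> finite {x. f m x \<noteq> 0}" by auto
  define B where "B = (SIGMA m:{1..n}. {x. f m x \<noteq> 0})"
  define e where "e = (\<lambda>(m, x). (t m, x :: int))"
  define w where "w = (\<lambda>m x. exp (f m x) - 1)"
  have finB: "finite B" unfolding B_def using fin by auto
  have inj: "inj_on e B"
  proof (rule inj_onI)
    fix b c assume "b \<in> B" "c \<in> B" "e b = e c"
    then have "fst b \<in> {1..n}" "fst c \<in> {1..n}" "t (fst b) = t (fst c)" "snd b = snd c"
      by (auto simp: B_def e_def)
    then show "b = c" using inj_onD[OF strict_mono_on_imp_inj_on[OF mono]] by (metis prod_eqI)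
  qed
  let ?i = "\<lambda>D. {\<omega> \<in> space M. e ` D \<subseteq> occupied X 0 \<omega>}"
  have ev: "?i D \<in> events" if "D \<subseteq> B" for D
    using that t finite_subset[OF that finB]
    by (intro random_set_events) (auto simp: e_def B_def occupied_def intro!: occupied_event X)
  have corr_D: "prob (?i D) = det_on D (\<lambda>(m, x) (n, y). K (t m) x (t n) y)" if D: "D \<subseteq> B" for D
  proof -
    have finD: "finite D" using D finB by (rule finite_subset)
    have "prob (?i D) = det_on (e ` D) (\<lambda>b c. K (fst b) (snd b) (fst c) (snd c))"
    proof (rule corr)
      show "e ` D \<subseteq> {0..} \<times> UNIV" using D t by (force simp: e_def B_def)
    qed (simp add: finD)
    also have "\<dots> = det_on D (\<lambda>i j. K (fst (e i)) (snd (e i)) (fst (e j)) (snd (e j)))"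
      using inj_on_subset[OF inj D] finD by (intro det_on_reindex) (auto simp: bij_betw_def)
    also have "(\<lambda>i j. K (fst (e i)) (snd (e i)) (fst (e j)) (snd (e j))) = (\<lambda>(m, x) (n, y). K (t m) x (t n) y)"
      by (auto simp: e_def fun_eq_iff)
    finally show ?thesis .
  qed
  have "has_bochner_integral M (\<lambda>\<omega>. \<Sum>D\<in>Pow B. (\<Prod>(m, x)\<in>D. w m x) * indicator (?i D) \<omega>)
      (\<Sum>D\<in>Pow B. (\<Prod>(m, x)\<in>D. w m x) * prob (?i D))"
    using ev by (intro has_bochner_integral_sum has_bochner_integral_mult_right has_bochner_integral_real_indicator)
      (auto simp: emeasure_eq_measure)
  also have "(\<Sum>D\<in>Pow B. (\<Prod>(m, x)\<in>D. w m x) * prob (?i D)) =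
      (\<Sum>D\<in>Pow B. (\<Prod>(m, x)\<in>D. w m x) * det_on D (\<lambda>(m, x) (n, y). K (t m) x (t n) y))"
    by (intro sum.cong refl) (simp add: corr_D)
  also have "\<dots> = fredholm_det n w (\<lambda>m x n y. K (t m) x (t n) y)"
    unfolding B_def using fin by (intro fredholm_det_eq_sum[symmetric]) (auto simp: w_def)
  finally have main: "has_bochner_integral M (\<lambda>\<omega>. \<Sum>D\<in>Pow B. (\<Prod>(m, x)\<in>D. w m x) * indicator (?i D) \<omega>)
      (fredholm_det n w (\<lambda>m x n y. K (t m) x (t n) y))" .
  let ?E = "\<lambda>\<omega>. exp (\<Sum>m\<in>{1..n}. \<Sum>x | f m x \<noteq> 0. f m x * real (X (t m) \<omega> x))"
  have E_eq: "?E \<omega> = (\<Prod>(m, x)\<in>B. exp (f m x * real (X (t m) \<omega> x)))" for \<omega>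
  proof -
    have "?E \<omega> = (\<Prod>m\<in>{1..n}. exp (\<Sum>x | f m x \<noteq> 0. f m x * real (X (t m) \<omega> x)))"
      by (rule exp_sum) simp
    also have "\<dots> = (\<Prod>m\<in>{1..n}. \<Prod>x | f m x \<noteq> 0. exp (f m x * real (X (t m) \<omega> x)))"
      by (intro prod.cong refl exp_sum fin)
    also have "\<dots> = (\<Prod>(m, x)\<in>B. exp (f m x * real (X (t m) \<omega> x)))"
      unfolding B_def using fin by (intro prod.Sigma) auto
    finally show ?thesis .
  qed
  have E_meas: "?E \<in> borel_measurable M"
    unfolding E_eq case_prod_beta'
  proof (rule borel_measurable_prod)
    fix b assume "b \<in> B"
    then have "(\<lambda>\<omega>. X (t (fst b)) \<omega> (snd b)) \<in> measurable M (count_space UNIV)"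
      using t by (intro config_space_coordinate X) (auto simp: B_def)
    then show "(\<lambda>\<omega>. exp (f (fst b) (snd b) * real (X (t (fst b)) \<omega> (snd b)))) \<in> borel_measurable M"
      by (rule measurable_compose) simp
  qed
  have "AE \<omega> in M. \<forall>b\<in>B. X (t (fst b)) \<omega> (snd b) \<le> 1"
    using finB t X(2) by (intro AE_finite_allI) (auto simp: B_def)
  then have AE: "AE \<omega> in M. ?E \<omega> = (\<Sum>D\<in>Pow B. (\<Prod>(m, x)\<in>D. w m x) * indicator (?i D) \<omega>)"
    using AE_space
  proof eventually_elim
    case (elim \<omega>)
    let ?o = "\<lambda>b. of_bool (e b \<in> occupied X 0 \<omega>) :: real"
    have "?E \<omega> = (\<Prod>b\<in>B. w (fst b) (snd b) * ?o b + 1)"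
      unfolding E_eq case_prod_beta'
    proof (rule prod.cong[OF refl])
      fix b assume "b \<in> B"
      then have "X (t (fst b)) \<omega> (snd b) \<le> 1" using elim(1) by blast
      then have "X (t (fst b)) \<omega> (snd b) = 0 \<or> X (t (fst b)) \<omega> (snd b) = 1" by linarith
      then show "exp (f (fst b) (snd b) * real (X (t (fst b)) \<omega> (snd b))) = w (fst b) (snd b) * ?o b + 1"
        by (auto simp: occupied_def e_def w_def case_prod_beta')
    qed
    also have "\<dots> = (\<Sum>D\<in>Pow B. (\<Prod>b\<in>D. w (fst b) (snd b) * ?o b) * (\<Prod>b\<in>B - D. 1))"
      by (rule prod_add[OF finB])
    also have "\<dots> = (\<Sum>D\<in>Pow B. (\<Prod>(m, x)\<in>D. w m x) * indicator (?i D) \<omega>)"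
    proof (rule sum.cong[OF refl])
      fix D assume "D \<in> Pow B"
      then have "finite D" using finB by (auto intro: finite_subset)
      then have "(\<Prod>b\<in>D. ?o b) = indicator (?i D) \<omega>"
      proof (cases "e ` D \<subseteq> occupied X 0 \<omega>")
        case True
        then have "(\<Prod>b\<in>D. ?o b) = 1" by (intro prod.neutral) auto
        then show ?thesis using True elim(2) by simp
      next
        case False
        then obtain b where "b \<in> D" "e b \<notin> occupied X 0 \<omega>" by blast
        with \<open>finite D\<close> have "(\<Prod>b\<in>D. ?o b) = 0" by (intro prod_zero bexI[of _ b]) auto
        then show ?thesis using False by simp
      qed
      then show "(\<Prod>b\<in>D. w (fst b) (snd b) * ?o b) * (\<Prod>b\<in>B - D. 1) = (\<Prod>(m, x)\<in>D. w m x) * indicator (?i D) \<omega>"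
        by (simp add: prod.distrib case_prod_beta')
    qed
    finally show ?case .
  qed
  show "has_bochner_integral M ?E (fredholm_det n (\<lambda>m x. exp (f m x) - 1) (\<lambda>m x n y. K (t m) x (t n) y))"
    using has_bochner_integral_cong_AE[OF E_meas borel_measurable_has_bochner_integral[OF main] AE] main
    unfolding w_def by simp
qed

section \<open>The stationary process\<close>

text \<open>The values of \<open>\<Upsilon>\<close> are \<open>0\<close> or \<open>1\<close> at every sample point because \<open>\<Upsilon>\<close> records only whether a
  site is occupied.\<close>
lemma limit_process_exists:
  assumes M: "config_process M \<Xi>"
    and lim: "\<And>D. finite D \<Longrightarrow> ((\<lambda>\<tau>. measure M {\<omega> \<in> space M. D \<subseteq> occupied \<Xi> \<tau> \<omega>}) \<longlongrightarrow> r D) at_top"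
  obtains N :: "(real \<Rightarrow> config) measure" and \<Upsilon> :: "real \<Rightarrow> (real \<Rightarrow> config) \<Rightarrow> config"
  where "prob_space N" "\<And>t. \<Upsilon> t \<in> measurable N config_space" "\<And>t \<omega> x. \<Upsilon> t \<omega> x \<le> 1"
    "\<And>D. finite D \<Longrightarrow> measure N {\<omega> \<in> space N. D \<subseteq> occupied \<Upsilon> 0 \<omega>} = r D"
proof -
  interpret M: prob_space M using M by (simp add: config_process_def)
  interpret M: random_set_limit M "occupied \<Xi>" at_top r
  proof
    fix b :: "real \<times> int"
    show "\<forall>\<^sub>F \<tau> in at_top. {\<omega> \<in> space M. b \<in> occupied \<Xi> \<tau> \<omega>} \<in> M.events"
      using eventually_ge_at_top[of "- fst b"]
    proof eventually_elim
      case (elim \<tau>)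
      then have "\<Xi> (fst b + \<tau>) \<in> measurable M config_space" using M by (simp add: config_process_def)
      then show ?case unfolding occupied_def by (simp add: occupied_event)
    qed
  qed (use lim in auto)
  obtain L :: "(real \<times> int \<Rightarrow> real) measure" where L: "prob_space L" "sets L = sets (\<Pi>\<^sub>M b\<in>UNIV. borel)"
    and Lr: "\<And>D. finite D \<Longrightarrow> measure L {f \<in> space L. \<forall>b\<in>D. 0 < f b} = r D"
    using M.limit_law_exists by blast
  define path where "path f = (\<lambda>t x. of_bool (0 < f (t, x)) :: nat)" for f :: "real \<times> int \<Rightarrow> real"
  define N where "N = distr L (\<Pi>\<^sub>M t\<in>UNIV. config_space) path"
  define \<Upsilon> where "\<Upsilon> t \<omega> = (\<lambda>x. of_bool (0 < \<omega> t x) :: nat)" for t :: real and \<omega> :: "real \<Rightarrow> config"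
  have coord: "(\<lambda>f. f b) \<in> borel_measurable L" for b
    using measurable_component_singleton[of b UNIV "\<lambda>_. borel"] by (simp add: measurable_cong_sets[OF L(2) refl])
  have path: "path \<in> measurable L (\<Pi>\<^sub>M t\<in>UNIV. config_space)"
    unfolding path_def config_space_def
  proof (intro measurable_PiM_single')
    fix t :: real and x :: int
    have "(\<lambda>u :: real. of_bool (0 < u) :: nat) \<in> measurable borel (count_space UNIV)" by measurable
    then show "(\<lambda>f. of_bool (0 < f (t, x))) \<in> measurable L (count_space (UNIV :: nat set))"
      by (rule measurable_compose[OF coord])
  qed (auto simp: space_PiM)
  have \<Upsilon>: "\<Upsilon> t \<in> measurable N config_space" for t
  proof -
    have 1: "(\<lambda>\<omega>. \<omega> t) \<in> measurable N config_space"
      unfolding N_def by (simp add: measurable_component_singleton)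
    have "(\<lambda>\<omega>. of_bool (0 < \<omega> t x) :: nat) \<in> measurable N (count_space UNIV)" for x
      by (rule measurable_compose[OF config_space_coordinate[OF 1]]) simp
    then show ?thesis
      unfolding \<Upsilon>_def config_space_def by (intro measurable_PiM_single') auto
  qed
  show thesis
  proof (rule that)
    interpret L: prob_space L by (rule L)
    show "prob_space N" unfolding N_def by (rule L.prob_space_distr[OF path])
    fix D :: "(real \<times> int) set" assume D: "finite D"
    interpret N: prob_space N by fact
    have "{\<omega> \<in> space N. D \<subseteq> occupied \<Upsilon> 0 \<omega>} \<in> sets N"
      using D by (intro N.random_set_events) (auto simp: occupied_def intro!: occupied_event[OF \<Upsilon>])
    then have "measure N {\<omega> \<in> space N. D \<subseteq> occupied \<Upsilon> 0 \<omega>} =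
        measure L (path -` {\<omega> \<in> space N. D \<subseteq> occupied \<Upsilon> 0 \<omega>} \<inter> space L)"
      unfolding N_def by (intro measure_distr[OF path]) simp
    also have "path -` {\<omega> \<in> space N. D \<subseteq> occupied \<Upsilon> 0 \<omega>} \<inter> space L = {f \<in> space L. \<forall>b\<in>D. 0 < f b}"
      using measurable_space[OF path] by (auto simp: N_def path_def \<Upsilon>_def occupied_def subset_eq)
    also have "measure L \<dots> = r D" by (rule Lr[OF D])
    finally show "measure N {\<omega> \<in> space N. D \<subseteq> occupied \<Upsilon> 0 \<omega>} = r D" .
  qed (use \<Upsilon> in \<open>auto simp: \<Upsilon>_def\<close>)
qed

lemma extended_sine_kernel_uminus: "extended_sine_kernel \<rho> d (- z) = extended_sine_kernel \<rho> d z"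
  by (simp add: extended_sine_kernel_def sine_kernel_def)

lemma det_extended_sine_kernel_shift:
  assumes "finite D"
  shows "det_on ((\<lambda>b. (fst b + h, snd b)) ` D) (\<lambda>b c. extended_sine_kernel \<rho> (fst c - fst b) (snd c - snd b)) =
    det_on D (\<lambda>b c. extended_sine_kernel \<rho> (fst c - fst b) (snd c - snd b))"
  using assms by (subst det_on_reindex[where f = "\<lambda>b. (fst b + h, snd b)"])
    (auto simp: bij_betw_def inj_on_def prod_eq_iff)

text \<open>Time reflection transposes the kernel, which is even in space.\<close>
lemma det_extended_sine_kernel_reflect:
  assumes D: "finite D"
  shows "det_on ((\<lambda>b. (T - fst b, snd b)) ` D) (\<lambda>b c. extended_sine_kernel \<rho> (fst c - fst b) (snd c - snd b)) =
    det_on D (\<lambda>b c. extended_sine_kernel \<rho> (fst c - fst b) (snd c - snd b))"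
proof -
  have "det_on ((\<lambda>b. (T - fst b, snd b)) ` D) (\<lambda>b c. extended_sine_kernel \<rho> (fst c - fst b) (snd c - snd b)) =
      det_on D (\<lambda>b c. extended_sine_kernel \<rho> (fst b - fst c) (snd c - snd b))"
    using D by (subst det_on_reindex[where f = "\<lambda>b. (T - fst b, snd b)"])
      (auto simp: bij_betw_def inj_on_def prod_eq_iff)
  also have "\<dots> = det_on D (\<lambda>b c. extended_sine_kernel \<rho> (fst b - fst c) (snd b - snd c))"
    using extended_sine_kernel_uminus by (metis minus_diff_eq)
  also have "\<dots> = det_on D (\<lambda>b c. extended_sine_kernel \<rho> (fst c - fst b) (snd c - snd b))"
    by (rule det_on_transpose[OF D])
  finally show ?thesis .
qed

theorem theorem5p6:
  fixes a :: nat
    and W :: "'v measure" and V :: "int \<Rightarrow> real \<Rightarrow> 'v \<Rightarrow> int"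
    and M :: "'w measure" and \<Xi> :: "real \<Rightarrow> 'w \<Rightarrow> config"
    and \<rho> :: real
  assumes "2 \<le> a"
    and "\<rho> = 1 / of_nat a"
    and "independent_walks a W V"
    and "noncolliding_walk a W V M \<Xi>"
  shows "\<exists>(N :: (real \<Rightarrow> config) measure) (\<Upsilon> :: real \<Rightarrow> (real \<Rightarrow> config) \<Rightarrow> config) \<mu>.
      config_process N \<Upsilon> \<and>
      shifted_fdd_convergence M \<Xi> N \<Upsilon> \<and>
      stationary N \<Upsilon> \<and>
      determinantal_point_process \<mu> (\<lambda>x y. sine_kernel \<rho> (y - x)) \<and>
      reversible_wrt N \<Upsilon> \<mu> \<and>
      determinantal_process N \<Upsilon> (\<lambda>s x t y. extended_sine_kernel \<rho> (t - s) (y - x))"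
proof -
  note walks = assms(3) and nc = assms(4)
  have a: "0 < a" using assms(1) by simp
  have cp: "config_process M \<Xi>" using nc by (simp add: noncolliding_walk_def)
  define r where "r D = det_on D (\<lambda>b c. extended_sine_kernel \<rho> (fst c - fst b) (snd c - snd b))"
    for D :: "(real \<times> int) set"
  have lim: "((\<lambda>\<tau>. measure M {\<omega> \<in> space M. D \<subseteq> occupied \<Xi> \<tau> \<omega>}) \<longlongrightarrow> r D) at_top" if "finite D" for D
    using noncolliding_correlation_limit[OF a walks nc that]
    by (simp add: occupied_def subset_eq r_def assms(2))
  obtain N :: "(real \<Rightarrow> config) measure" and \<Upsilon> :: "real \<Rightarrow> (real \<Rightarrow> config) \<Rightarrow> config"
    where N: "prob_space N" and \<Upsilon>: "\<And>t. \<Upsilon> t \<in> measurable N config_space" "\<And>t \<omega> x. \<Upsilon> t \<omega> x \<le> 1"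
    and corr: "\<And>D. finite D \<Longrightarrow> measure N {\<omega> \<in> space N. D \<subseteq> occupied \<Upsilon> 0 \<omega>} = r D"
    using limit_process_exists[OF cp lim] by blast
  interpret N: prob_space N by (rule N)
  have cpN: "config_process N \<Upsilon>" using N \<Upsilon>(1) by (simp add: config_process_def)
  have conv: "shifted_fdd_convergence M \<Xi> N \<Upsilon>"
    by (rule shifted_fdd_convergenceI[OF cp noncolliding_occupation_le_1[OF a walks nc] cpN _ lim corr])
      (use \<Upsilon>(2) in auto)
  have joint: "joint_law N \<Upsilon> g J = joint_law N \<Upsilon> (\<lambda>s. s) J"
    if J: "finite J" and g: "\<And>D. finite D \<Longrightarrow> r ((\<lambda>b. (g (fst b), snd b)) ` D) = r D" for g J
    unfolding joint_law_def
  proof (rule N.joint_distr_eqI[where X = "\<lambda>s. \<Upsilon> (g s)" and Y = \<Upsilon>, OF J])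
    fix D :: "(real \<times> int) set" assume D: "finite D"
    have "{\<omega> \<in> space N. D \<subseteq> occupied (\<lambda>s. \<Upsilon> (g s)) 0 \<omega>} =
        {\<omega> \<in> space N. (\<lambda>b. (g (fst b), snd b)) ` D \<subseteq> occupied \<Upsilon> 0 \<omega>}"
      by (auto simp: occupied_def)
    then show "N.prob {\<omega> \<in> space N. D \<subseteq> occupied (\<lambda>s. \<Upsilon> (g s)) 0 \<omega>} = N.prob {\<omega> \<in> space N. D \<subseteq> occupied \<Upsilon> 0 \<omega>}"
      using D by (simp add: corr g)
  qed (use \<Upsilon> in auto)
  have stat: "joint_law N \<Upsilon> (\<lambda>s. s + h) J = joint_law N \<Upsilon> (\<lambda>s. s) J" if "finite J" for h J
    using that det_extended_sine_kernel_shift by (intro joint) (auto simp: r_def)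
  have rev: "joint_law N \<Upsilon> (\<lambda>s. T - s) J = joint_law N \<Upsilon> (\<lambda>s. s) J" if "finite J" for T J
    using that det_extended_sine_kernel_reflect by (intro joint) (auto simp: r_def)
  define \<mu> where "\<mu> = distr N config_space (\<Upsilon> 0)"
  have marginal: "distr N config_space (\<Upsilon> t) = \<mu>" for t
  proof -
    have proj: "(\<lambda>f. f 0) \<in> measurable (\<Pi>\<^sub>M s\<in>{0 :: real}. config_space) config_space"
      by (rule measurable_component_singleton) simp
    have "distr (joint_law N \<Upsilon> g {0}) config_space (\<lambda>f. f 0) = distr N config_space (\<Upsilon> (g 0))" for g
      unfolding joint_law_def using \<Upsilon>(1)
      by (subst distr_distr[OF proj]) (auto intro!: measurable_restrict simp: o_def)
    from this[of "\<lambda>s. s + t"] this[of "\<lambda>s. s"] show ?thesis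
      by (simp add: stat \<mu>_def)
  qed
  have det: "determinantal_process N \<Upsilon> (\<lambda>s x t y. extended_sine_kernel \<rho> (t - s) (y - x))"
    by (rule N.determinantal_processI) (use \<Upsilon> in \<open>auto simp: corr r_def\<close>)
  have "determinantal_point_process \<mu> (\<lambda>x y. sine_kernel \<rho> (y - x))"
    unfolding determinantal_point_process_def
  proof (intro conjI allI impI)
    show "prob_space \<mu>" unfolding \<mu>_def by (rule N.prob_space_distr[OF \<Upsilon>(1)])
    show "sets \<mu> = sets config_space" by (simp add: \<mu>_def)
    fix f :: "int \<Rightarrow> real" assume f: "finite {x. f x \<noteq> 0}"
    have "has_bochner_integral N (\<lambda>\<omega>. exp (\<Sum>x | f x \<noteq> 0. f x * real (\<Upsilon> 0 \<omega> x)))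
        (fredholm_det 1 (\<lambda>_ x. exp (f x) - 1) (\<lambda>_ x _ y. sine_kernel \<rho> (y - x)))"
      using det[unfolded determinantal_process_def, rule_format, of 1 "\<lambda>_. 0" "\<lambda>_. f"] f
      by (simp add: strict_mono_on_def extended_sine_kernel_def)
    moreover have "(\<lambda>\<xi>. exp (\<Sum>x | f x \<noteq> 0. f x * real (\<xi> x))) \<in> borel_measurable config_space"
    proof (rule measurable_compose[OF _ borel_measurable_exp], intro borel_measurable_sum borel_measurable_times)
      fix x
      show "(\<lambda>\<xi>. real (\<xi> x)) \<in> borel_measurable config_space"
        by (rule measurable_compose[OF config_space_coordinate]) simp_all
    qed simp
    ultimately show "has_bochner_integral \<mu> (\<lambda>\<xi>. exp (\<Sum>x | f x \<noteq> 0. f x * real (\<xi> x)))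
        (fredholm_det 1 (\<lambda>_ x. exp (f x) - 1) (\<lambda>_ x _ y. sine_kernel \<rho> (y - x)))"
      unfolding \<mu>_def by (intro has_bochner_integral_distr[OF _ \<Upsilon>(1)])
  qed
  moreover have "stationary N \<Upsilon>" unfolding stationary_def using stat by blast
  moreover have "reversible_wrt N \<Upsilon> \<mu>"
    unfolding reversible_wrt_def using rev marginal by blast
  ultimately show ?thesis using cpN conv det by blast
qed

end
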